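(* For all integers $k\ge 2$ and every $\alpha>0$ there exists $n_0$ such that every $k$-graph $H$ on $n\ge n_0$ vertices with $\delta(H)\ge\left(1-\frac{1}{2k-1}+\alpha\right)n$ contains the square (i.e. second power) $C^{2}_{k,n}$ of a tight Hamilton cycle.
   Context: A $k$-graph is a $k$-uniform hypergraph. For a $k$-graph $H$, the minimum codegree $\delta(H)$ is the maximum number $m$ such that each set of $k-1$ vertices of $H$ lies in at least $m$ edges of $H$. For $j\ge 1$, the $j$th power of a $k$-cycle on $n$ vertices, denoted $C^{j}_{k,n}$, is the $k$-graph on $n$ cyclically ordered vertices whose edges are all $k$-subsets of all sets of $k+j-1$ consecutive vertices; $C^{1}_{k,n}$ is the tight Hamilton cycle, and $C^2_{k,n}$ is its square. *)

theory Defs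
  imports Complex_Main
begin

definition k_graph :: "nat \<Rightarrow> 'a set \<Rightarrow> 'a set set \<Rightarrow> bool" where
  "k_graph k V E \<longleftrightarrow> finite V \<and> (\<forall>e\<in>E. e \<subseteq> V \<and> card e = k)"

(* The maximum is taken over a nonempty set of naturals, and that set is bounded exactly when
   V has a subset of size k - 1. For card V < k - 1 the value is unspecified. *)
definition min_codegree :: "nat \<Rightarrow> 'a set \<Rightarrow> 'a set set \<Rightarrow> nat" where
  "min_codegree k V E =
     (GREATEST m. \<forall>S. S \<subseteq> V \<and> card S = k - 1 \<longrightarrow> m \<le> card {e \<in> E. S \<subseteq> e})"

lemma le_min_codegree_iff:
  assumes "k_graph k V E" and "k - 1 \<le> card V"
  shows "m \<le> min_codegree k V E \<longleftrightarrow>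
    (\<forall>S. S \<subseteq> V \<and> card S = k - 1 \<longrightarrow> m \<le> card {e \<in> E. S \<subseteq> e})"
proof -
  let ?P = "\<lambda>m. \<forall>S. S \<subseteq> V \<and> card S = k - 1 \<longrightarrow> m \<le> card {e \<in> E. S \<subseteq> e}"
  obtain S where S: "S \<subseteq> V" "card S = k - 1"
    using obtain_subset_with_card_n[OF assms(2)] by metis
  have bound: "y \<le> card {e \<in> E. S \<subseteq> e}" if "?P y" for y
    using that S by blast
  have "?P (min_codegree k V E)"
    unfolding min_codegree_def by (rule GreatestI_nat[of ?P 0]) (use bound in auto)
  moreover have "m \<le> min_codegree k V E" if "?P m"
    unfolding min_codegree_def by (rule Greatest_le_nat[of ?P]) (use bound that in auto)
  ultimately show ?thesis
    using le_trans by blast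
qed

(* Edge set of the j-th power of a k-cycle on the vertex set {..<n} in its natural cyclic order
   (indices mod n), for j \<ge> 1: every k-subset of a window of k + j - 1 consecutive vertices. *)
definition cycle_power_edges :: "nat \<Rightarrow> nat \<Rightarrow> nat \<Rightarrow> nat set set" where
  "cycle_power_edges j k n =
     {e. card e = k \<and> (\<exists>i<n. e \<subseteq> (\<lambda>t. (i + t) mod n) ` {..<k + j - 1})}"

(* Containment of (V', E') in (V, E) as a not necessarily induced subhypergraph, up to
   isomorphism; it is spanning when card V' = card V. *)
definition contains_copy ::
  "'a set \<Rightarrow> 'a set set \<Rightarrow> 'b set \<Rightarrow> 'b set set \<Rightarrow> bool" where
  "contains_copy V E V' E' \<longleftrightarrow>
     (\<exists>f. inj_on f V' \<and> f ` V' \<subseteq> V \<and> (\<forall>e\<in>E'. f ` e \<in> E))"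

end

theory Submission
  imports Defs "HOL-Library.FuncSet" "HOL-Library.Disjoint_Sets"
begin

text \<open>
  Write \<open>\<tau> = 1 - 1 / (2k - 1)\<close>. The codegree condition says that any \<open>2k - 1\<close> sets of size \<open>k - 1\<close> have
  linearly many common neighbours. This is exactly what is needed to choose a vertex extending two
  \<open>k\<close>-sets that share \<open>k - 1\<close> vertices, and two such \<open>k\<close>-sets are what a new vertex sees in both of
  the greedy arguments below.

  Absorbing: the vertices of \<open>x\<^sub>1 \<dots> x\<^sub>2\<^sub>k\<close> can be chosen one by one so that the sequence is a path both
  with and without \<open>v\<close> inserted in its middle. Multiplicative weights select few such sequences
  that together serve every \<open>v\<close> linearly often.

  Connecting: two ordered edges are joined by a sequence of edges, each differing from the previous one
  in a single coordinate, with a common extension of consecutive edges inserted between them. This is a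
  walk that repeats vertices; there are so many choices for its vertices that, by the theorem of
  Erdos on complete partite subgraphs, each vertex can be replaced by many copies.

  Covering: the path is extended by blocks while the set \<open>U\<close> of unused vertices keeps codegree ratio
  above \<open>\<tau>\<close>. An exponential potential of the codegree ratios assigns a weight to every vertex, and a
  block whose mean weight is at most the mean over \<open>U\<close> keeps the potential from growing. Blow-ups of
  cliques with vertices from suitable quantiles of the weight are such blocks, so neither the
  regularity lemma nor linear programming duality is needed.
\<close>

section \<open>Square paths and complete partite subgraphs\<close>

text \<open>Two \<open>k\<close>-sets with \<open>k - 1\<close> common vertices have
  \<open>k + k - 1\<close> faces between them, which is the affordable number \<open>2k - 1\<close>.
  A vertex between two unrelated ends would have to see the faces of both sides and mixed ones as
  well, so the ends are moved towards each other one coordinate at a time.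

  Deleting a block \<open>B\<close> from \<open>U\<close> changes the ratio of a face
  \<open>S\<close>, to first order, in proportion to the difference between its ratios in
  \<open>U\<close> and in \<open>B\<close>. If \<open>S\<close> has weight
  \<open>exp (- \<kappa> * ratio)\<close> and a vertex collects the weights of the faces that it
  completes to edges, then the first-order change of the potential compares the mean weight over
  \<open>B\<close> with that over \<open>U\<close>. The parameter \<open>\<kappa>\<close> is a small
  multiple of \<open>card V\<close>: large enough that the polynomial number of faces costs a
  negligible part of the exponent, small enough that a block of bounded size moves every exponent
  only slightly. The errors are charged to the length of the path, which never exceeds
  \<open>card V\<close>; this bounds their total although the number of steps is linear.\<close>

abbreviation (input) faces :: "nat \<Rightarrow> 'a set \<Rightarrow> 'a set set" where
  "faces k V \<equiv> {S. S \<subseteq> V \<and> card S = k - 1}"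

abbreviation (input) gap :: "nat \<Rightarrow> real" where
  "gap k \<equiv> 1 / (2 * real k - 1)"

abbreviation (input) template_edges :: "('t \<Rightarrow> 't set set) \<Rightarrow> 't list \<Rightarrow> 't set set" where
  "template_edges Fam ts \<equiv> {insert t S | t S. t \<in> set ts \<and> S \<in> Fam t}"

text \<open>A window of \<open>k + 2 - 1\<close> consecutive positions is \<open>{i..i + k}\<close>.
  Indexing edges by sets of positions rather than vertices makes sense for lists with repetitions,
  so walks in a template are chains too. Windows may reach beyond the end of the list, and lists
  shorter than \<open>k\<close> are chains vacuously.\<close>

definition chain :: "nat \<Rightarrow> 'a set set \<Rightarrow> 'a list \<Rightarrow> bool" where
  "chain k E xs \<longleftrightarrow>
     (\<forall>i I. I \<subseteq> {i..i + k} \<and> I \<subseteq> {..<length xs} \<and> card I = k \<longrightarrow> (!) xs ` I \<in> E)"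

lemma chainD:
  "\<lbrakk>chain k E xs; I \<subseteq> {i..i + k}; I \<subseteq> {..<length xs}; card I = k\<rbrakk> \<Longrightarrow> (!) xs ` I \<in> E"
  unfolding chain_def by blast

lemma chain_appendD1:
  assumes "chain k E (xs @ ys)" shows "chain k E xs"
  unfolding chain_def
proof (intro allI impI, elim conjE)
  fix i I assume I: "I \<subseteq> {i..i + k}" "I \<subseteq> {..<length xs}" "card I = k"
  have "(!) (xs @ ys) ` I \<in> E"
    by (rule chainD[OF assms I(1)]) (use I in auto)
  also have "(!) (xs @ ys) ` I = (!) xs ` I"
    using I(2) by (intro image_cong) (auto simp: nth_append)
  finally show "(!) xs ` I \<in> E" .
qed

lemma chain_appendD2:
  assumes "chain k E (xs @ ys)" shows "chain k E ys"
  unfolding chain_def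
proof (intro allI impI, elim conjE)
  fix i I assume I: "I \<subseteq> {i..i + k}" "I \<subseteq> {..<length ys}" "card I = k"
  have "(!) (xs @ ys) ` ((+) (length xs) ` I) \<in> E"
    by (rule chainD[OF assms, of _ "length xs + i"]) (use I in \<open>auto simp: card_image\<close>)
  also have "(!) (xs @ ys) ` ((+) (length xs) ` I) = (!) ys ` I"
    by (simp add: image_image)
  finally show "(!) ys ` I \<in> E" .
qed

text \<open>A window of \<open>k + 1\<close> positions that starts before \<open>ms\<close> ends
  inside \<open>ms\<close>, which has at least \<open>k\<close> entries; any other window lies in
  \<open>ms @ ys\<close>.\<close>

lemma chain_glue:
  assumes "chain k E (xs @ ms)" "chain k E (ms @ ys)" "k \<le> length ms"
  shows "chain k E (xs @ ms @ ys)"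
  unfolding chain_def
proof (intro allI impI, elim conjE)
  fix i I assume I: "I \<subseteq> {i..i + k}" "I \<subseteq> {..<length (xs @ ms @ ys)}" "card I = k"
  show "(!) (xs @ ms @ ys) ` I \<in> E"
  proof (cases "i < length xs")
    case True
    have sub: "I \<subseteq> {..<length (xs @ ms)}" using I(1) True assms(3) by auto
    have "(!) (xs @ ms) ` I \<in> E"
      by (rule chainD[OF assms(1) I(1) sub]) (use I in auto)
    also have "(!) (xs @ ms) ` I = (!) ((xs @ ms) @ ys) ` I"
      using sub by (intro image_cong) (auto simp only: nth_append lessThan_iff if_True)
    finally show ?thesis by simp
  next
    case False
    define J where "J = (\<lambda>q. q - length xs) ` I"
    have ge: "length xs \<le> q" if "q \<in> I" for q using that I(1) False by auto
    have "inj_on (\<lambda>q. q - length xs) I"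
      using ge by (intro inj_onI) (metis eq_diff_iff)
    then have cJ: "card J = k" unfolding J_def using I(3) by (simp add: card_image)
    have "(!) (ms @ ys) ` J \<in> E"
    proof (rule chainD[OF assms(2) _ _ cJ])
      show "J \<subseteq> {i - length xs..i - length xs + k}" unfolding J_def using I(1) ge False by fastforce
      show "J \<subseteq> {..<length (ms @ ys)}" unfolding J_def using I(2) ge by fastforce
    qed
    also have "(!) (ms @ ys) ` J = (!) (xs @ ms @ ys) ` I"
      unfolding J_def image_image using ge by (intro image_cong) (auto simp: nth_append not_less[symmetric])
    finally show ?thesis .
  qed
qed

lemma chain_glue3:
  assumes "chain k E (xs @ ms)" "chain k E (ms @ ys @ ms')" "chain k E (ms' @ zs)"
    "k \<le> length ms" "k \<le> length ms'"
  shows "chain k E (xs @ ms @ ys @ ms' @ zs)"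
  using chain_glue[OF assms(1,2,4)] chain_glue[of k E "xs @ ms @ ys" ms' zs] assms by simp

lemma pigeonhole_fibre:
  fixes X :: "'x set"
  assumes "finite X" "finite C" "g ` X \<subseteq> C" "C \<noteq> {}"
  shows "\<exists>y\<in>C. real (card X) \<le> real (card C) * real (card {x\<in>X. g x = y})"
proof (rule ccontr)
  assume neg: "\<not> ?thesis"
  have "real (card X) = (\<Sum>y\<in>C. real (card {x\<in>X. g x = y}))"
    using sum.group[OF assms(1-3), of "\<lambda>_. 1::nat"] by (metis (no_types, lifting) card_eq_sum of_nat_sum sum.cong)
  moreover have "real (card C) * (\<Sum>y\<in>C. real (card {x\<in>X. g x = y})) < (\<Sum>y\<in>C. real (card X))"
    unfolding sum_distrib_left by (rule sum_strict_mono) (use assms neg in auto)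
  ultimately show False using assms by simp
qed

text \<open>The theorem of Erdos for families of functions: a positive proportion of all tuples
  contains a box with sides of any fixed size \<open>T\<close>. When a coordinate is split off, a
  bounded set \<open>D\<close> of its values with many extensions is kept; a positive proportion of
  the shorter tuples extend by at least \<open>T\<close> values of \<open>D\<close>, and
  pigeonholing a \<open>T\<close>-subset of \<open>D\<close> fixes one side of the box.\<close>

lemma box:
  assumes "finite I" "c > 0"
  shows "\<exists>N0. \<forall>(U :: 'a set) X. finite U \<longrightarrow> N0 \<le> card U \<longrightarrow> X \<subseteq> I \<rightarrow>\<^sub>E U \<longrightarrow>
      c * real (card U) ^ card I \<le> real (card X) \<longrightarrow>
      (\<exists>Y. (\<forall>i\<in>I. Y i \<subseteq> U \<and> card (Y i) = T) \<and> Pi\<^sub>E I Y \<subseteq> X)"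
  using assms
proof (induction I arbitrary: c)
  case empty
  show ?case
  proof (intro exI[of _ 0] allI impI exI)
    fix U :: "'a set" and X :: "('t \<Rightarrow> 'a) set"
    assume *: "X \<subseteq> {} \<rightarrow>\<^sub>E U" "c * real (card U) ^ card {} \<le> real (card X)"
    then have "X \<noteq> {}" using empty by auto
    with * show "(\<forall>i\<in>{}. undefined i \<subseteq> U \<and> card (undefined i :: 'a set) = T) \<and> Pi\<^sub>E {} undefined \<subseteq> X"
      by auto
  qed
next
  case (insert i I)
  \<comment> \<open>The tuples in \<open>B\<close> have on average at least \<open>c / 2 * m\<close>
    extensions in \<open>D\<close>; with \<open>T\<close> at most \<open>c / 4 * m\<close>, those
    with fewer than \<open>T\<close> extensions account for at most half of this.\<close>
  define m where "m = nat \<lceil>4 * real T / c\<rceil> + 1"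
  have m: "real T \<le> c / 4 * real m" "m > 0"
  proof -
    have "4 * real T / c \<le> real m" unfolding m_def by linarith
    then show "real T \<le> c / 4 * real m" using insert.prems by (simp add: field_simps)
  qed (simp add: m_def)
  \<comment> \<open>\<open>2 ^ m\<close> bounds the number of candidates for the common
    \<open>T\<close>-subset of \<open>D\<close>.\<close>
  define c' where "c' = c / 4 / 2 ^ m"
  have "c' > 0" using insert.prems by (simp add: c'_def)
  from insert.IH[OF this] obtain N1 where N1: "\<forall>(U :: 'a set) X. finite U \<longrightarrow> N1 \<le> card U \<longrightarrow> X \<subseteq> I \<rightarrow>\<^sub>E U \<longrightarrow>
      c' * real (card U) ^ card I \<le> real (card X) \<longrightarrow>
      (\<exists>Y. (\<forall>i\<in>I. Y i \<subseteq> U \<and> card (Y i) = T) \<and> Pi\<^sub>E I Y \<subseteq> X)" ..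
  note N1 = N1[rule_format (no_asm)]
  define N0 where "N0 = N1 + nat \<lceil>2 * real m / c\<rceil> + 1"
  show ?case
  proof (intro exI[of _ N0] allI impI)
    fix U :: "'a set" and X
    assume U: "finite U" "N0 \<le> card U" and X: "X \<subseteq> insert i I \<rightarrow>\<^sub>E U"
      and cX: "c * real (card U) ^ card (insert i I) \<le> real (card X)"
    let ?N = "real (card U)" let ?p = "card I"
    define B where "B = (I \<rightarrow>\<^sub>E U)"
    have finB: "finite B" unfolding B_def using U insert.hyps by (simp add: finite_PiE)
    have cardB: "real (card B) = ?N ^ ?p" unfolding B_def using insert.hyps by (simp add: card_PiE)
    have Npos: "?N > 0" using U(2) unfolding N0_def by simp
    define F where "F y = {z\<in>B. z(i := y) \<in> X}" for y
    have finF: "finite (F y)" for y unfolding F_def using finB by auto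
    have FB: "card (F y) \<le> card B" for y unfolding F_def using finB by (intro card_mono) auto
    have "X \<subseteq> (\<lambda>(y,z). z(i := y)) ` (Sigma U F)"
    proof
      fix x assume x: "x \<in> X"
      with X have xP: "x \<in> insert i I \<rightarrow>\<^sub>E U" by auto
      then have "restrict x I \<in> B" "(restrict x I)(i := x i) = x" "x i \<in> U"
        unfolding B_def using insert.hyps(2) by (auto simp: fun_eq_iff PiE_def extensional_def)
      then show "x \<in> (\<lambda>(y,z). z(i := y)) ` (Sigma U F)"
        using x by (intro image_eqI[of _ _ "(x i, restrict x I)"]) (auto simp: F_def)
    qed
    then have "card X \<le> card (Sigma U F)"
      using U finF by (intro surj_card_le) auto
    then have cXs: "real (card X) \<le> (\<Sum>y\<in>U. real (card (F y)))"
      using U finF by (simp flip: of_nat_sum)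
    \<comment> \<open>The values outside \<open>H\<close> account for at most half of the lower
      bound on \<open>card X\<close>, so \<open>H\<close> has linear size.\<close>
    define H where "H = {y\<in>U. c / 2 * ?N ^ ?p \<le> real (card (F y))}"
    have HU: "H \<subseteq> U" "finite H" using U unfolding H_def by auto
    have "(\<Sum>y\<in>U. real (card (F y))) = (\<Sum>y\<in>H. real (card (F y))) + (\<Sum>y\<in>U - H. real (card (F y)))"
      using HU U by (metis add.commute sum.subset_diff)
    also have "\<dots> \<le> (\<Sum>y\<in>H. ?N ^ ?p) + (\<Sum>y\<in>U - H. c / 2 * ?N ^ ?p)"
      using FB cardB by (intro add_mono sum_mono) (auto simp: H_def simp flip: cardB)
    also have "\<dots> \<le> real (card H) * ?N ^ ?p + ?N * (c / 2 * ?N ^ ?p)"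
      using insert.prems U HU by (auto intro!: mult_right_mono card_mono)
    finally have "c * (?N * ?N ^ ?p) \<le> real (card H) * ?N ^ ?p + ?N * (c / 2 * ?N ^ ?p)"
      using cX cXs insert.hyps by simp
    then have "(c / 2 * ?N) * ?N ^ ?p \<le> real (card H) * ?N ^ ?p" by (simp add: algebra_simps)
    then have "c / 2 * ?N \<le> real (card H)" using Npos by simp
    moreover have "2 * real m / c \<le> ?N" using U(2) unfolding N0_def by linarith
    ultimately have "real m \<le> real (card H)" using insert.prems by (simp add: field_simps)
    then obtain D where D: "D \<subseteq> H" "card D = m" "finite D"
      using HU by (metis obtain_subset_with_card_n of_nat_le_iff)
    define G where "G z = {y\<in>D. z(i := y) \<in> X}" for z
    define Zs where "Zs = {z\<in>B. T \<le> card (G z)}"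
    have finZ: "finite Zs" unfolding Zs_def using finB by auto
    have Gle: "card (G z) \<le> m" for z unfolding G_def using D by (metis (no_types, lifting) card_mono mem_Collect_eq subsetI)
    have "real m * (c / 2 * ?N ^ ?p) \<le> (\<Sum>y\<in>D. real (card (F y)))"
    proof -
      have "(\<Sum>y\<in>D. c / 2 * ?N ^ ?p) \<le> (\<Sum>y\<in>D. real (card (F y)))"
        using D(1) by (intro sum_mono) (auto simp: H_def)
      then show ?thesis using D(2) by simp
    qed
    also have "\<dots> = (\<Sum>y\<in>D. \<Sum>z\<in>B. if z(i := y) \<in> X then 1 else 0)"
      unfolding F_def using finB by (simp add: sum.If_cases Int_def)
    also have "\<dots> = (\<Sum>z\<in>B. \<Sum>y\<in>D. if z(i := y) \<in> X then 1 else 0)" by (rule sum.swap)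
    also have "\<dots> = (\<Sum>z\<in>B. real (card (G z)))"
      unfolding G_def using D by (simp add: sum.If_cases Int_def)
    also have "\<dots> = (\<Sum>z\<in>Zs. real (card (G z))) + (\<Sum>z\<in>B - Zs. real (card (G z)))"
      using finB by (subst add.commute, intro sum.subset_diff) (auto simp: Zs_def)
    also have "\<dots> \<le> (\<Sum>z\<in>Zs. real m) + (\<Sum>z\<in>B - Zs. real T)"
      using Gle by (intro add_mono sum_mono) (auto simp: Zs_def)
    also have "\<dots> \<le> real (card Zs) * real m + ?N ^ ?p * real T"
      using finB by (auto simp flip: cardB intro!: mult_right_mono card_mono)
    also have "\<dots> \<le> real (card Zs) * real m + ?N ^ ?p * (c / 4 * real m)"
      using m Npos by (intro add_left_mono mult_left_mono) auto
    finally have "(c / 4 * ?N ^ ?p) * real m \<le> real (card Zs) * real m" by (simp add: algebra_simps)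
    then have cZ: "c / 4 * ?N ^ ?p \<le> real (card Zs)" using m by simp
    define g where "g z = (SOME D'. D' \<subseteq> G z \<and> card D' = T)" for z
    have g: "g z \<subseteq> G z \<and> card (g z) = T" if "z \<in> Zs" for z
      unfolding g_def by (rule someI_ex) (use that in \<open>auto simp: Zs_def elim: obtain_subset_with_card_n\<close>)
    have gD: "g ` Zs \<subseteq> Pow D" using g unfolding G_def by blast
    from pigeonhole_fibre[OF finZ _ gD] D obtain D' where D':
      "real (card Zs) \<le> 2 ^ m * real (card {z\<in>Zs. g z = D'})"
      by (auto simp: card_Pow)
    define X' where "X' = {z\<in>Zs. g z = D'}"
    have "c / 4 * ?N ^ ?p \<le> 2 ^ m * real (card X')"
      using cZ D' unfolding X'_def by linarith
    then have cX': "c' * ?N ^ ?p \<le> real (card X')"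
      unfolding c'_def by (simp add: field_simps)
    have "0 < c' * ?N ^ ?p" by (rule mult_pos_pos[OF \<open>c' > 0\<close> zero_less_power[OF Npos]])
    with cX' have "0 < real (card X')" by linarith
    then have "X' \<noteq> {}" by auto
    then obtain z0 where "z0 \<in> Zs" "g z0 = D'" unfolding X'_def by blast
    with g[of z0] have D'p: "card D' = T" "D' \<subseteq> D" unfolding G_def by blast+
    have X'B: "X' \<subseteq> I \<rightarrow>\<^sub>E U" unfolding X'_def Zs_def B_def by auto
    have "N1 \<le> card U" using U(2) unfolding N0_def by simp
    from N1[OF U(1) this X'B cX'] obtain Y where Y: "\<forall>i\<in>I. Y i \<subseteq> U \<and> card (Y i) = T" "Pi\<^sub>E I Y \<subseteq> X'"
      using X'B by blast
    show "\<exists>Y. (\<forall>i\<in>insert i I. Y i \<subseteq> U \<and> card (Y i) = T) \<and> Pi\<^sub>E (insert i I) Y \<subseteq> X"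
    proof (intro exI[of _ "Y(i := D')"] conjI, goal_cases)
      case 1
      then show ?case
        using Y(1) D'p(1) subset_trans[OF D'p(2) subset_trans[OF D(1) HU(1)]] by auto
    next
      case 2
      show ?case
      proof
      fix x assume x: "x \<in> Pi\<^sub>E (insert i I) (Y(i := D'))"
      have "restrict x I \<in> Pi\<^sub>E I Y" using x insert.hyps(2) by (auto simp: PiE_iff split: if_splits)
      with Y(2) have "restrict x I \<in> X'" by (rule subsetD)
      moreover have "x i \<in> D'" using x by (auto simp: PiE_iff)
      ultimately have "(restrict x I)(i := x i) \<in> X" using g unfolding X'_def G_def by auto
      moreover have "(restrict x I)(i := x i) = x" using x by (auto simp: fun_eq_iff PiE_iff extensional_def)
      ultimately show "x \<in> X" by simp
      qed
    qed
  qed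
qed

section \<open>Templates and their blow-ups\<close>

definition common :: "'a set set \<Rightarrow> 'a set \<Rightarrow> 'a set set \<Rightarrow> 'a set" where
  "common E U F = {v\<in>U. \<forall>S\<in>F. insert v S \<in> E}"

definition rich :: "nat \<Rightarrow> 'a set \<Rightarrow> 'a set set \<Rightarrow> 'a set \<Rightarrow> nat \<Rightarrow> real \<Rightarrow> bool" where
  "rich k V E U d m \<longleftrightarrow> (\<forall>F. F \<subseteq> faces k V \<and> finite F \<and> card F \<le> d
     \<longrightarrow> m \<le> real (card (common E U F)))"

text \<open>A template lists new vertices \<open>t\<close>; \<open>Fam t\<close> contains the sets \<open>S\<close> of earlier vertices (or of the set
  \<open>J\<close> of vertices embedded in advance) for which \<open>insert t S\<close> has to become an edge.\<close>

fun admissible :: "nat \<Rightarrow> ('t \<Rightarrow> 't set set) \<Rightarrow> 't set \<Rightarrow> 't list \<Rightarrow> bool" where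
  "admissible k Fam J [] \<longleftrightarrow> True"
| "admissible k Fam J (t # ts) \<longleftrightarrow>
     t \<notin> J \<and> (\<forall>S\<in>Fam t. S \<subseteq> J \<and> card S = k - 1) \<and> admissible k Fam (insert t J) ts"

text \<open>\<open>\<phi>0\<close> prescribes the vertices of \<open>J\<close> and
  \<open>\<phi>\<close> only the new ones, so that embeddings can be counted as functions in
  \<open>set ts \<rightarrow>\<^sub>E U0\<close>, the form that \<open>box\<close> takes.\<close>

definition embeds ::
  "'a set set \<Rightarrow> ('t \<Rightarrow> 't set set) \<Rightarrow> 't set \<Rightarrow> ('t \<Rightarrow> 'a) \<Rightarrow> ('t \<Rightarrow> 'a set) \<Rightarrow> 't list \<Rightarrow> ('t \<Rightarrow> 'a) \<Rightarrow> bool"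
  where
  "embeds E Fam J \<phi>0 U ts \<phi> \<longleftrightarrow> inj_on (override_on \<phi> \<phi>0 J) (J \<union> set ts) \<and>
     (\<forall>t\<in>set ts. \<phi> t \<in> U t \<and> (\<forall>S\<in>Fam t. insert (\<phi> t) (override_on \<phi> \<phi>0 J ` S) \<in> E))"

lemma admissible_append:
  "admissible k Fam J (xs @ ys) \<longleftrightarrow> admissible k Fam J xs \<and> admissible k Fam (J \<union> set xs) ys"
  by (induction xs arbitrary: J) auto

text \<open>For vertices that see only \<open>J\<close> and not each other, the order among them
  does not matter.\<close>

lemma admissibleI_late:
  assumes "distinct ts" "set ts \<inter> J = {}" "\<And>t S. \<lbrakk>t \<in> set ts; S \<in> Fam t\<rbrakk> \<Longrightarrow> S \<subseteq> J \<and> card S = k - 1"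
  shows "admissible k Fam J ts"
  using assms
proof (induction ts arbitrary: J)
  case (Cons t ts)
  have "admissible k Fam (insert t J) ts"
    by (rule Cons.IH) (use Cons.prems in \<open>auto dest: Cons.prems(3)[rotated]\<close>)
  then show ?case using Cons.prems(1,2) Cons.prems(3)[of t] by auto
qed simp

lemma admissible_disjoint: "admissible k Fam J ts \<Longrightarrow> set ts \<inter> J = {}"
  by (induction ts arbitrary: J) auto

lemma admissible_distinct: "admissible k Fam J ts \<Longrightarrow> distinct ts"
  by (induction ts arbitrary: J) (use admissible_disjoint in fastforce)+

lemma admissible_Fam:
  "\<lbrakk>admissible k Fam J ts; t \<in> set ts; S \<in> Fam t\<rbrakk> \<Longrightarrow> S \<subseteq> J \<union> set ts \<and> t \<notin> S \<and> card S = k - 1"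
  by (induction ts arbitrary: J) auto

text \<open>Greedy choice with at least \<open>m\<close> options for each new vertex. The surplus
  \<open>card J + p\<close> in the richness hypothesis pays for the vertices already used, which
  injectivity excludes; \<open>p\<close> is a separate bound on the length so that the hypothesis is
  the same for every prefix in the induction.\<close>

lemma count_embeddings:
  fixes ts :: "'t list" and m :: real
  assumes fin: "finite V" "finite J" and \<phi>0: "\<phi>0 ` J \<subseteq> V" "inj_on \<phi>0 J"
    and U0: "U0 \<subseteq> V" and m: "m \<ge> 0"
    and "admissible k Fam J ts" "length ts \<le> p"
    and "\<And>t. t \<in> set ts \<Longrightarrow> U t \<subseteq> U0 \<and> rich k V E (U t) (card (Fam t)) (m + real (card J) + real p)"
  shows "m ^ length ts \<le> real (card {\<phi> \<in> set ts \<rightarrow>\<^sub>E U0. embeds E Fam J \<phi>0 U ts \<phi>})"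
  using assms(7-)
proof (induction ts rule: rev_induct)
  case Nil
  have "{\<phi> \<in> {} \<rightarrow>\<^sub>E U0. embeds E Fam J \<phi>0 U [] \<phi>} = {\<lambda>_. undefined}"
    using \<phi>0(2) by (auto simp: embeds_def inj_on_def override_on_def)
  then show ?case by simp
next
  case (snoc t ts)
  have Famt: "S \<subseteq> J \<union> set ts \<and> card S = k - 1" if "S \<in> Fam t" for S
    using snoc.prems(1) that by (auto simp: admissible_append)
  have adm: "admissible k Fam J ts" "t \<notin> J" "t \<notin> set ts"
    using snoc.prems(1) by (auto simp: admissible_append)
  define A where "A = {\<phi> \<in> set ts \<rightarrow>\<^sub>E U0. embeds E Fam J \<phi>0 U ts \<phi>}"
  define B where "B = {\<phi> \<in> set (ts @ [t]) \<rightarrow>\<^sub>E U0. embeds E Fam J \<phi>0 U (ts @ [t]) \<phi>}"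
  have finU: "finite U0" using U0 fin finite_subset by auto
  have Ut: "U t \<subseteq> U0" and rt: "rich k V E (U t) (card (Fam t)) (m + real (card J) + real p)"
    using snoc.prems(3) by auto
  have finAB: "finite A" "finite B" unfolding A_def B_def using finU by (auto intro!: finite_PiE)
  have IH: "m ^ length ts \<le> real (card A)" unfolding A_def using snoc adm by simp
  define C where "C \<phi> = common E (U t) ((`) (override_on \<phi> \<phi>0 J) ` Fam t)
      - override_on \<phi> \<phi>0 J ` (J \<union> set ts)" for \<phi>
  have finC: "finite (C \<phi>)" for \<phi> unfolding C_def common_def using finU Ut
    by (auto intro: finite_subset)
  have finF: "finite (Fam t)"
    by (rule finite_subset[of _ "Pow (J \<union> set ts)"]) (use Famt fin in auto)
  have cC: "m \<le> real (card (C \<phi>))" if "\<phi> \<in> A" for \<phi>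
  proof -
    let ?\<psi> = "override_on \<phi> \<phi>0 J"
    have inj: "inj_on ?\<psi> (J \<union> set ts)" using that unfolding A_def embeds_def by auto
    have im: "?\<psi> ` (J \<union> set ts) \<subseteq> V"
    proof
      fix x assume "x \<in> ?\<psi> ` (J \<union> set ts)"
      then obtain s where "s \<in> J \<union> set ts" "x = ?\<psi> s" by auto
      then show "x \<in> V" using \<phi>0(1) U0 that unfolding A_def
        by (cases "s \<in> J") (auto simp: override_on_def PiE_def Pi_def)
    qed
    have "?\<psi> ` S \<subseteq> V \<and> card (?\<psi> ` S) = k - 1" if "S \<in> Fam t" for S
      using Famt[OF that] im inj by (metis card_image image_mono inj_on_subset subset_trans)
    then have "(`) ?\<psi> ` Fam t \<subseteq> faces k V" by auto
    then have "m + real (card J) + real p \<le> real (card (common E (U t) ((`) ?\<psi> ` Fam t)))"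
      using rt finF unfolding rich_def by (simp add: card_image_le)
    moreover have "card (?\<psi> ` (J \<union> set ts)) \<le> card J + p"
    proof -
      have "card (?\<psi> ` (J \<union> set ts)) \<le> card (J \<union> set ts)" using fin by (intro card_image_le) auto
      also have "\<dots> \<le> card J + card (set ts)" by (rule card_Un_le)
      also have "\<dots> \<le> card J + p" using snoc.prems(2) card_length[of ts] by simp
      finally show ?thesis .
    qed
    moreover have "card (common E (U t) ((`) ?\<psi> ` Fam t)) - card (?\<psi> ` (J \<union> set ts)) \<le> card (C \<phi>)"
      unfolding C_def using fin by (intro diff_card_le_card_Diff) auto
    ultimately show ?thesis by linarith
  qed
  have "m ^ length (ts @ [t]) \<le> real (card A) * m" using mult_right_mono[OF IH m] by (simp add: mult.commute)
  also have "\<dots> \<le> (\<Sum>\<phi>\<in>A. real (card (C \<phi>)))" using sum_mono[of A "\<lambda>_. m", OF cC] by simp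
  also have "\<dots> = real (card (Sigma A C))" using finAB finC by simp
  also have "\<dots> \<le> real (card B)"
    unfolding of_nat_le_iff
  proof (rule card_inj_on_le[where f = "\<lambda>(\<phi>, y). \<phi>(t := y)"])
    show "inj_on (\<lambda>(\<phi>, y). \<phi>(t := y)) (Sigma A C)"
    proof (rule inj_onI, clarify)
      fix \<phi> y \<phi>' y' assume *: "\<phi> \<in> A" "\<phi>' \<in> A" "\<phi>(t := y) = \<phi>'(t := y')"
      then have "\<phi> t = undefined" "\<phi>' t = undefined"
        using adm unfolding A_def by (auto simp: PiE_def extensional_def)
      then show "\<phi> = \<phi>' \<and> y = y'" using *(3) by (metis fun_upd_same fun_upd_triv fun_upd_upd)
    qed
    show "(\<lambda>(\<phi>, y). \<phi>(t := y)) ` Sigma A C \<subseteq> B"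
    proof (clarify)
      fix \<phi> y assume \<phi>: "\<phi> \<in> A" and y: "y \<in> C \<phi>"
      let ?\<psi> = "override_on \<phi> \<phi>0 J"
      have up: "override_on (\<phi>(t := y)) \<phi>0 J = ?\<psi>(t := y)"
        using adm by (auto simp: override_on_def fun_eq_iff)
      have e: "embeds E Fam J \<phi>0 U ts \<phi>" and P: "\<phi> \<in> set ts \<rightarrow>\<^sub>E U0" using \<phi> unfolding A_def by auto
      have yU: "y \<in> U t" using y unfolding C_def common_def by auto
      have P': "\<phi>(t := y) \<in> set (ts @ [t]) \<rightarrow>\<^sub>E U0"
        using P yU Ut adm by (auto simp: PiE_def Pi_def extensional_def)
      have "inj_on (?\<psi>(t := y)) (J \<union> set (ts @ [t]))"
      proof -
        have "inj_on (?\<psi>(t := y)) (insert t (J \<union> set ts))"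
          using e y adm unfolding embeds_def C_def
          by (auto simp: inj_on_def)
        then show ?thesis by simp
      qed
      moreover have *: "(\<phi>(t := y)) s \<in> U s \<and> (\<forall>S\<in>Fam s. insert ((\<phi>(t := y)) s) ((?\<psi>(t := y)) ` S) \<in> E)"
        if s: "s \<in> set (ts @ [t])" for s
      proof (cases "s = t")
        case True
        have im: "(?\<psi>(t := y)) ` S = ?\<psi> ` S" if "S \<in> Fam t" for S
          using Famt[OF that] adm by (intro image_cong) auto
        show ?thesis using y True im unfolding C_def common_def by auto
      next
        case False
        then have s': "s \<in> set ts" using s by auto
        have im: "(?\<psi>(t := y)) ` S = ?\<psi> ` S" if "S \<in> Fam s" for S
          using admissible_Fam[OF adm(1) s' that] adm by (intro image_cong) auto
        show ?thesis using e s' False im unfolding embeds_def by auto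
      qed
      from this have "\<forall>s\<in>set (ts @ [t]). (\<phi>(t := y)) s \<in> U s \<and>
          (\<forall>S\<in>Fam s. insert ((\<phi>(t := y)) s) ((?\<psi>(t := y)) ` S) \<in> E)" by (rule ballI)
      ultimately have "embeds E Fam J \<phi>0 U (ts @ [t]) (\<phi>(t := y))"
        unfolding embeds_def up by (intro conjI)
      with P' show "\<phi>(t := y) \<in> B" unfolding B_def by (intro CollectI conjI)
    qed
  qed (rule finAB)
  finally show ?case unfolding B_def .
qed

text \<open>Different visits of a walk to a template vertex \<open>t\<close> can be sent to
  different vertices of \<open>Y t\<close>. A template edge has \<open>k\<close> elements, so
  \<open>k\<close> positions that map onto one visit \<open>k\<close> different template vertices;
  the vertices chosen for them belong to a transversal of the classes, and \<open>hom\<close>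
  applies.\<close>

lemma realize_chain:
  fixes w :: "'t list" and Y :: "'t \<Rightarrow> 'a set"
  assumes ch: "chain k T w" and T: "\<And>e. e \<in> T \<Longrightarrow> card e = k"
    and Y: "\<And>t. t \<in> set w \<Longrightarrow> finite (Y t) \<and> card {q. q < length w \<and> w ! q = t} \<le> card (Y t)"
    and disj: "disjoint_family_on Y (set w)"
    and hom: "\<And>\<phi> e. \<lbrakk>\<And>t. t \<in> set w \<Longrightarrow> \<phi> t \<in> Y t; e \<in> T; e \<subseteq> set w\<rbrakk> \<Longrightarrow> \<phi> ` e \<in> E"
  shows "\<exists>xs. length xs = length w \<and> distinct xs \<and> chain k E xs \<and> (\<forall>q<length w. xs ! q \<in> Y (w ! q))"
proof -
  let ?P = "\<lambda>t. {q. q < length w \<and> w ! q = t}"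
  have "\<exists>f. f ` ?P t \<subseteq> Y t \<and> inj_on f (?P t)" if "t \<in> set w" for t
    using card_le_inj[of "?P t" "Y t"] Y[OF that] by auto
  then obtain \<eta> where \<eta>: "\<And>t. t \<in> set w \<Longrightarrow> \<eta> t ` ?P t \<subseteq> Y t \<and> inj_on (\<eta> t) (?P t)" by metis
  define g where "g q = \<eta> (w ! q) q" for q
  define xs where "xs = map g [0..<length w]"
  have g: "g q \<in> Y (w ! q)" if "q < length w" for q
    using \<eta>[of "w ! q"] that unfolding g_def by auto
  have inj: "inj_on g {..<length w}"
  proof (rule inj_onI)
    fix p q assume pq: "p \<in> {..<length w}" "q \<in> {..<length w}" "g p = g q"
    then have "g p \<in> Y (w ! p) \<inter> Y (w ! q)" using g by (metis IntI lessThan_iff)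
    then have "w ! p = w ! q" using disj pq unfolding disjoint_family_on_def
      by (metis empty_iff lessThan_iff nth_mem)
    then show "p = q" using \<eta>[of "w ! q"] pq unfolding g_def
      by (auto simp: inj_on_def)
  qed
  have len: "length xs = length w" unfolding xs_def by simp
  have nth: "xs ! q = g q" if "q < length w" for q using that unfolding xs_def by simp
  have "distinct xs" unfolding xs_def using inj by (simp add: distinct_map atLeast0LessThan)
  moreover have "chain k E xs" unfolding chain_def
  proof (intro allI impI, elim conjE)
    fix i I assume I: "I \<subseteq> {i..i + k}" "I \<subseteq> {..<length xs}" "card I = k"
    have e: "(!) w ` I \<in> T" using chainD[OF ch I(1) _ I(3)] I(2) len by simp
    have "finite I" using I(1) finite_subset by auto
    then have inj: "inj_on ((!) w) I" using T[OF e] I(3) by (intro eq_card_imp_inj_on) auto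
    \<comment> \<open>The transversal sends the template vertex at a position of \<open>I\<close> to
      the vertex chosen for that very position; elsewhere any element of the class will do.\<close>
    define \<phi> where "\<phi> t = (if t \<in> (!) w ` I then g (the_inv_into I ((!) w) t) else (SOME y. y \<in> Y t))" for t
    have \<phi>I: "\<phi> (w ! q) = g q" if "q \<in> I" for q
      unfolding \<phi>_def using that inj by (simp add: the_inv_into_f_f)
    have "\<phi> t \<in> Y t" if t: "t \<in> set w" for t
    proof (cases "t \<in> (!) w ` I")
      case True
      then obtain q where "q \<in> I" "t = w ! q" by auto
      then show ?thesis using \<phi>I g I(2) len by auto
    next
      case False
      obtain q where "q < length w" "t = w ! q" using t by (metis in_set_conv_nth)
      then have "Y t \<noteq> {}" using g by auto
      then show ?thesis unfolding \<phi>_def using False by (simp add: some_in_eq)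
    qed
    moreover have "(!) w ` I \<subseteq> set w" using I(2) len by auto
    ultimately have "\<phi> ` ((!) w ` I) \<in> E" using hom[OF _ e] by blast
    moreover have "\<phi> ` ((!) w ` I) = (!) xs ` I"
      unfolding image_image using \<phi>I nth I(2) len by (intro image_cong) auto
    ultimately show "(!) xs ` I \<in> E" by simp
  qed
  ultimately show ?thesis using len nth g by (intro exI[of _ xs]) auto
qed

text \<open>Counting embeddings, finding a box among them and realizing a walk in the box. Vertices
  of \<open>J\<close> have fixed images and cannot be multiplied, so the walk may visit each of them
  only once. \<open>N0\<close> depends on the template, the walk and \<open>c\<close>, and on
  nothing in the host graph.\<close>

lemma blowup_path:
  fixes ts w :: "'t list" and c :: real
  assumes J: "finite J" "admissible k Fam J ts" and c: "c > 0" and k: "k \<ge> 1"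
    and T0: "\<And>e. e \<in> T0 \<Longrightarrow> e \<subseteq> J \<and> card e = k"
    and ch: "chain k (T0 \<union> template_edges Fam ts) w"
    and w: "set w \<subseteq> J \<union> set ts" "\<And>t. t \<in> J \<Longrightarrow> card {q. q < length w \<and> w ! q = t} \<le> 1"
  shows "\<exists>N0. \<forall>(V :: 'a set) E U0 U \<phi>0. finite V \<longrightarrow> U0 \<subseteq> V \<longrightarrow> N0 \<le> card U0 \<longrightarrow> \<phi>0 ` J \<subseteq> V \<longrightarrow> inj_on \<phi>0 J \<longrightarrow>
     (\<forall>e\<in>T0. \<phi>0 ` e \<in> E) \<longrightarrow>
     (\<forall>t\<in>set ts. U t \<subseteq> U0 \<and>
        rich k V E (U t) (card (Fam t)) (c * real (card U0) + real (card J) + real (length ts))) \<longrightarrow>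
     (\<exists>xs. length xs = length w \<and> distinct xs \<and> chain k E xs \<and>
        (\<forall>q<length w. xs ! q \<in> (if w ! q \<in> J then {\<phi>0 (w ! q)} else U (w ! q))))"
proof -
  let ?p = "length ts"
  have c': "c ^ ?p > 0" using c by simp
  \<comment> \<open>Classes of size \<open>Suc (length w)\<close> have room for all visits of the
    walk and are nonempty even if \<open>w\<close> is empty.\<close>
  from box[of "set ts" "c ^ ?p" "Suc (length w)", where 'a = 'a] c'
  obtain N0 where N0: "\<forall>(U :: 'a set) X. finite U \<longrightarrow> N0 \<le> card U \<longrightarrow> X \<subseteq> set ts \<rightarrow>\<^sub>E U \<longrightarrow>
      c ^ ?p * real (card U) ^ card (set ts) \<le> real (card X) \<longrightarrow>
      (\<exists>Y. (\<forall>i\<in>set ts. Y i \<subseteq> U \<and> card (Y i) = Suc (length w)) \<and> Pi\<^sub>E (set ts) Y \<subseteq> X)"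
    by auto
  note N0 = N0[rule_format (no_asm)]
  have dist: "distinct ts" using admissible_distinct[OF J(2)] by auto
  show ?thesis
  proof (intro exI[of _ N0] allI impI)
    fix V :: "'a set" and E U0 U \<phi>0
    assume V: "finite V" "U0 \<subseteq> V" "N0 \<le> card U0" "\<phi>0 ` J \<subseteq> V" "inj_on \<phi>0 J" "\<forall>e\<in>T0. \<phi>0 ` e \<in> E"
      and U: "\<forall>t\<in>set ts. U t \<subseteq> U0 \<and>
        rich k V E (U t) (card (Fam t)) (c * real (card U0) + real (card J) + real (length ts))"
    have finU0: "finite U0" using V finite_subset by auto
    define X where "X = {\<phi> \<in> set ts \<rightarrow>\<^sub>E U0. embeds E Fam J \<phi>0 U ts \<phi>}"
    have "(c * real (card U0)) ^ length ts \<le> real (card X)"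
      unfolding X_def using V U J c by (intro count_embeddings[where p = "length ts"]) auto
    then have "c ^ ?p * real (card U0) ^ card (set ts) \<le> real (card X)"
      using dist by (simp add: power_mult_distrib distinct_card)
    from N0[OF finU0 V(3) _ this] obtain Y where
      Y: "\<And>i. i \<in> set ts \<Longrightarrow> Y i \<subseteq> U0 \<and> card (Y i) = Suc (length w)" "Pi\<^sub>E (set ts) Y \<subseteq> X"
      unfolding X_def by auto
    have Yne: "Y t \<noteq> {}" if "t \<in> set ts" for t using Y(1)[OF that] by auto
    have dJ: "set ts \<inter> J = {}" using admissible_disjoint[OF J(2)] by auto
    define Y' where "Y' t = (if t \<in> J then {\<phi>0 t} else Y t)" for t
    have emb: "embeds E Fam J \<phi>0 U ts (restrict \<phi> (set ts))"
      if "\<And>t. t \<in> J \<union> set ts \<Longrightarrow> \<phi> t \<in> Y' t" for \<phi>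
    proof -
      have "\<phi> t \<in> Y t" if "t \<in> set ts" for t
        using \<open>\<And>t. t \<in> J \<union> set ts \<Longrightarrow> \<phi> t \<in> Y' t\<close>[of t] that dJ unfolding Y'_def
        by (auto split: if_splits)
      then have "restrict \<phi> (set ts) \<in> Pi\<^sub>E (set ts) Y" by auto
      with Y(2) show ?thesis unfolding X_def by blast
    qed
    have emb2: "override_on (restrict \<phi> (set ts)) \<phi>0 J t = \<phi> t"
      if "\<And>t. t \<in> J \<union> set ts \<Longrightarrow> \<phi> t \<in> Y' t" "t \<in> J \<union> set ts" for \<phi> t
      using that(1)[OF that(2)] that(2) unfolding Y'_def
      by (auto simp: override_on_def split: if_splits)
    define d where "d t = (SOME y. y \<in> Y' t)" for t
    have d: "d t \<in> Y' t" if "t \<in> J \<union> set ts" for t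
      unfolding d_def some_in_eq using that Yne unfolding Y'_def by auto
    \<comment> \<open>Every \<open>y\<close> in \<open>Y t\<close> occurs in some transversal of the
      box, and every transversal is an embedding, which puts \<open>y\<close> into
      \<open>U t\<close>.\<close>
    have YU: "Y t \<subseteq> U t" if "t \<in> set ts" for t
    proof
      fix y assume y: "y \<in> Y t"
      have tJ: "t \<notin> J" using that dJ by auto
      have "(d(t := y)) s \<in> Y' s" if "s \<in> J \<union> set ts" for s
      proof (cases "s = t")
        case True
        then show ?thesis using y tJ by (simp add: Y'_def)
      qed (use d[OF that] in simp)
      then have "embeds E Fam J \<phi>0 U ts (restrict (d(t := y)) (set ts))" by (rule emb)
      then have "restrict (d(t := y)) (set ts) t \<in> U t" using that unfolding embeds_def by blast
      then show "y \<in> U t" using that by simp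
    qed
    have disj: "disjoint_family_on Y' (J \<union> set ts)"
      unfolding disjoint_family_on_def
    proof (intro ballI impI)
      fix s t assume st: "s \<in> J \<union> set ts" "t \<in> J \<union> set ts" "s \<noteq> t"
      show "Y' s \<inter> Y' t = {}"
      proof (rule ccontr)
        assume "Y' s \<inter> Y' t \<noteq> {}"
        then obtain y where y: "y \<in> Y' s" "y \<in> Y' t" by auto
        \<comment> \<open>A vertex common to two classes yields a transversal that takes it twice,
          against the injectivity of embeddings.\<close>
        define \<phi> where "\<phi> = d(s := y, t := y)"
        have \<phi>: "\<phi> r \<in> Y' r" if "r \<in> J \<union> set ts" for r
          unfolding \<phi>_def using d[OF that] y by auto
        have o: "override_on (restrict \<phi> (set ts)) \<phi>0 J r = \<phi> r" if "r \<in> J \<union> set ts" for r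
          by (rule emb2[OF _ that]) (rule \<phi>)
        have "embeds E Fam J \<phi>0 U ts (restrict \<phi> (set ts))" by (rule emb) (rule \<phi>)
        then have "inj_on (override_on (restrict \<phi> (set ts)) \<phi>0 J) (J \<union> set ts)"
          unfolding embeds_def by blast
        moreover have "override_on (restrict \<phi> (set ts)) \<phi>0 J s = override_on (restrict \<phi> (set ts)) \<phi>0 J t"
          unfolding o[OF st(1)] o[OF st(2)] by (simp add: \<phi>_def)
        ultimately show False using st(3) inj_onD[OF _ _ st(1,2)] by blast
      qed
    qed
    let ?T = "T0 \<union> template_edges Fam ts"
    have "\<exists>xs. length xs = length w \<and> distinct xs \<and> chain k E xs \<and> (\<forall>q<length w. xs ! q \<in> Y' (w ! q))"
    proof (rule realize_chain[OF ch])
      fix e assume "e \<in> ?T"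
      then show "card e = k"
      proof
        assume "e \<in> template_edges Fam ts"
        then obtain t S where tS: "t \<in> set ts" "S \<in> Fam t" "e = insert t S" by auto
        from admissible_Fam[OF J(2) tS(1,2)] have "S \<subseteq> J \<union> set ts" "t \<notin> S" "card S = k - 1" by auto
        moreover from this have "finite S" using J(1) by (auto intro: finite_subset)
        ultimately show ?thesis using tS k by simp
      qed (use T0 in auto)
    next
      fix t assume t: "t \<in> set w"
      have fw: "finite {q. q < length w \<and> w ! q = t}" by auto
      show "finite (Y' t) \<and> card {q. q < length w \<and> w ! q = t} \<le> card (Y' t)"
      proof (cases "t \<in> J")
        case True
        then show ?thesis using w(2) unfolding Y'_def by auto
      next
        case False
        then have "t \<in> set ts" using w(1) t by auto
        moreover have "card {q. q < length w \<and> w ! q = t} \<le> card {..<length w}" by (intro card_mono) auto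
        ultimately show ?thesis using False Y(1)[of t] finU0 unfolding Y'_def by (auto intro: finite_subset)
      qed
    next
      show "disjoint_family_on Y' (set w)" using disj w(1) unfolding disjoint_family_on_def by blast
    next
      fix \<phi> e assume \<phi>: "\<And>t. t \<in> set w \<Longrightarrow> \<phi> t \<in> Y' t" and e: "e \<in> ?T" "e \<subseteq> set w"
      define \<psi> where "\<psi> t = (if t \<in> set w then \<phi> t else d t)" for t
      have \<psi>: "\<psi> t \<in> Y' t" if "t \<in> J \<union> set ts" for t
        unfolding \<psi>_def using d[OF that] \<phi>[of t] by auto
      have "\<psi> ` e \<in> E" using e(1)
      proof
        assume "e \<in> T0"
        moreover have "\<psi> ` e = \<phi>0 ` e"
        proof (rule image_cong[OF refl])
          fix t assume "t \<in> e"
          then have "t \<in> J" using T0[OF \<open>e \<in> T0\<close>] by blast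
          then show "\<psi> t = \<phi>0 t" using \<psi>[of t] by (simp add: Y'_def)
        qed
        ultimately show ?thesis using V by simp
      next
        assume "e \<in> template_edges Fam ts"
        then obtain t S where tS: "t \<in> set ts" "S \<in> Fam t" "e = insert t S" by auto
        have sub: "S \<subseteq> J \<union> set ts" using admissible_Fam[OF J(2) tS(1,2)] by auto
        let ?r = "restrict \<psi> (set ts)"
        have "embeds E Fam J \<phi>0 U ts ?r" by (rule emb) (rule \<psi>)
        then have "insert (?r t) (override_on ?r \<phi>0 J ` S) \<in> E"
          using tS(1,2) unfolding embeds_def by blast
        moreover have "override_on ?r \<phi>0 J ` S = \<psi> ` S"
        proof (rule image_cong[OF refl])
          fix r assume "r \<in> S"
          with sub have "r \<in> J \<union> set ts" by blast
          then show "override_on ?r \<phi>0 J r = \<psi> r" by (rule emb2[rotated]) (rule \<psi>)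
        qed
        ultimately show ?thesis using tS by simp
      qed
      moreover have "\<psi> ` e = \<phi> ` e" using e(2) unfolding \<psi>_def by (intro image_cong) auto
      ultimately show "\<phi> ` e \<in> E" by simp
    qed
    then obtain xs where xs: "length xs = length w" "distinct xs" "chain k E xs"
      "\<And>q. q < length w \<Longrightarrow> xs ! q \<in> Y' (w ! q)" by auto
    have "xs ! q \<in> (if w ! q \<in> J then {\<phi>0 (w ! q)} else U (w ! q))" if "q < length w" for q
    proof (cases "w ! q \<in> J")
      case False
      then have "w ! q \<in> set ts" using w(1) that by (metis Un_iff nth_mem subsetD)
      then show ?thesis using xs(4)[OF that] False YU unfolding Y'_def by auto
    qed (use xs(4)[OF that] in \<open>auto simp: Y'_def\<close>)
    then have "\<forall>q<length w. xs ! q \<in> (if w ! q \<in> J then {\<phi>0 (w ! q)} else U (w ! q))"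
      by (intro allI impI)
    with xs(1-3) show "\<exists>xs. length xs = length w \<and> distinct xs \<and> chain k E xs \<and>
        (\<forall>q<length w. xs ! q \<in> (if w ! q \<in> J then {\<phi>0 (w ! q)} else U (w ! q)))"
      by (intro exI[of _ xs] conjI)
  qed
qed

section \<open>Common neighbourhoods\<close>

definition dense :: "nat \<Rightarrow> 'a set \<Rightarrow> 'a set set \<Rightarrow> real \<Rightarrow> 'a set \<Rightarrow> bool" where
  "dense k V E \<beta> U \<longleftrightarrow> (\<forall>S. S \<subseteq> V \<and> card S = k - 1 \<longrightarrow>
     (1 - gap k + \<beta>) * real (card U) \<le> real (card (common E U {S})))"

text \<open>Union bound: a face has at most \<open>(gap k - \<beta>) * card U\<close> non-neighbours
  in \<open>U\<close>, hence at most that many in \<open>W\<close>.\<close>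

lemma dense_rich:
  assumes "dense k V E \<beta> U" "finite U" "W \<subseteq> U" "\<beta> \<le> gap k"
  shows "rich k V E W d (real (card W) - real d * ((gap k - \<beta>) * real (card U)))"
  unfolding rich_def
proof (intro allI impI, elim conjE)
  fix F assume F: "F \<subseteq> faces k V" "finite F" "card F \<le> d"
  let ?x = "(gap k - \<beta>) * real (card U)"
  have finW: "finite W" using assms finite_subset by auto
  have "real (card (W - common E W F)) \<le> real (card F) * ?x"
    using F(2,1)
  proof (induction F)
    case empty
    have "W - common E W {} = {}" by (auto simp: common_def)
    then show ?case unfolding \<open>W - common E W {} = {}\<close> by simp
  next
    case (insert S F)
    have sub: "common E U {S} \<subseteq> U" unfolding common_def by auto
    have "(1 - gap k + \<beta>) * real (card U) \<le> real (card (common E U {S}))"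
      using assms(1) insert.prems unfolding dense_def by auto
    moreover have "card (U - common E U {S}) = card U - card (common E U {S})"
      using assms(2) sub by (meson card_Diff_subset finite_subset)
    moreover have "card (common E U {S}) \<le> card U" using assms(2) sub by (rule card_mono)
    ultimately have 1: "real (card (U - common E U {S})) \<le> ?x" by (simp add: algebra_simps)
    have "W - common E W (insert S F) \<subseteq> (W - common E W F) \<union> (U - common E U {S})"
      using assms(3) unfolding common_def by auto
    then have "card (W - common E W (insert S F)) \<le> card ((W - common E W F) \<union> (U - common E U {S}))"
      using assms(2) finW by (intro card_mono) auto
    also have "\<dots> \<le> card (W - common E W F) + card (U - common E U {S})" by (rule card_Un_le)
    finally have "real (card (W - common E W (insert S F))) \<le> real (card F) * ?x + ?x"
      using 1 insert.IH insert.prems by simp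
    moreover have "real (card (insert S F)) * ?x = real (card F) * ?x + ?x"
      unfolding card_insert_disjoint[OF insert.hyps] of_nat_Suc distrib_right mult_1_left by (rule add.commute)
    ultimately show ?case by linarith
  qed
  also have "\<dots> \<le> real d * ?x" using F assms(4) by (intro mult_right_mono) auto
  finally have "real (card (W - common E W F)) \<le> real d * ?x" .
  moreover have "card (W - common E W F) = card W - card (common E W F)"
    using finW by (intro card_Diff_subset) (auto simp: common_def intro: finite_subset)
  moreover have "card (common E W F) \<le> card W" using finW by (intro card_mono) (auto simp: common_def)
  ultimately show "real (card W) - real d * ?x \<le> real (card (common E W F))" by simp
qed

lemma rich_mono: "\<lbrakk>rich k V E W d m; m' \<le> m; d' \<le> d\<rbrakk> \<Longrightarrow> rich k V E W d' m'"
  unfolding rich_def by (intro allI impI) (meson order_trans)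

text \<open>\<open>2k - 1\<close> faces leave at least \<open>(2k - 1) * \<beta> * card U\<close>
  common neighbours, and \<open>2k - 1\<close> is at least 3: one \<open>\<beta> * card U\<close> is
  the number of choices, another one pays for \<open>r\<close>.\<close>

lemma dense_rich_self:
  assumes "dense k V E \<beta> U" "finite U" "0 < \<beta>" "\<beta> \<le> gap k" "k \<ge> 2" "d \<le> 2 * k - 1"
    "real r \<le> \<beta> * real (card U)"
  shows "rich k V E U d (\<beta> * real (card U) + real r)"
proof (rule rich_mono[OF dense_rich[OF assms(1,2) subset_refl assms(4), of "2 * k - 1"]])
  have k: "real (2 * k - 1) = 2 * real k - 1" "2 * real k - 1 \<ge> 3" using assms(5) by auto
  have "real (2 * k - 1) * ((gap k - \<beta>) * real (card U))
      = (1 - (2 * real k - 1) * \<beta>) * real (card U)"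
    unfolding k(1) mult.assoc[symmetric] using k(2) by (simp add: right_diff_distrib)
  moreover have "3 * (\<beta> * real (card U)) \<le> (2 * real k - 1) * (\<beta> * real (card U))"
    using k(2) assms(3) by (intro mult_right_mono) auto
  moreover have "0 \<le> \<beta> * real (card U)" using assms(3) by auto
  ultimately show "\<beta> * real (card U) + real r
      \<le> real (card U) - real (2 * k - 1) * ((gap k - \<beta>) * real (card U))"
    using assms(7) by (simp add: algebra_simps)
qed (use assms in auto)

text \<open>Deleting a proportion \<open>\<gamma>\<close> of \<open>U\<close> costs a face at most
  \<open>\<gamma> * card U\<close> neighbours, while the total does not increase.\<close>

lemma dense_subset:
  assumes "dense k V E \<beta> U" "finite U" "U' \<subseteq> U" "real (card (U - U')) \<le> \<gamma> * real (card U)" "\<gamma> \<le> \<beta>" "k \<ge> 2"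
  shows "dense k V E (\<beta> - \<gamma>) U'"
  unfolding dense_def
proof (intro allI impI)
  fix S assume S: "S \<subseteq> V \<and> card S = k - 1"
  have "common E U {S} \<subseteq> common E U' {S} \<union> (U - U')" unfolding common_def by auto
  moreover have "finite (common E U' {S} \<union> (U - U'))"
    using assms by (auto simp: common_def intro: finite_subset)
  ultimately have "card (common E U {S}) \<le> card (common E U' {S}) + card (U - U')"
    by (meson card_Un_le card_mono le_trans)
  moreover have "(1 - gap k + \<beta>) * real (card U) \<le> real (card (common E U {S}))"
    using assms(1) S unfolding dense_def by auto
  ultimately have "(1 - gap k + (\<beta> - \<gamma>)) * real (card U) \<le> real (card (common E U' {S}))"
    using assms(4) by (simp add: algebra_simps)
  moreover have "(1 - gap k + (\<beta> - \<gamma>)) * real (card U')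
      \<le> (1 - gap k + (\<beta> - \<gamma>)) * real (card U)"
  proof (intro mult_left_mono)
    have "gap k \<le> 1" using assms(6) by simp
    then show "0 \<le> 1 - gap k + (\<beta> - \<gamma>)" using assms(5) by linarith
  qed (use assms in \<open>auto intro: card_mono\<close>)
  ultimately show "(1 - gap k + (\<beta> - \<gamma>)) * real (card U') \<le> real (card (common E U' {S}))"
    by linarith
qed

text \<open>The origin of \<open>2k - 1\<close>: each \<open>k\<close>-set has \<open>k\<close>
  faces, and a face inside the intersection is shared. With \<open>A = B\<close> the bound also
  covers a single \<open>k\<close>-set.\<close>

lemma card_two_families:
  assumes "finite A" "finite B" "card A = k" "card B = k" "k - 1 \<le> card (A \<inter> B)" "k \<ge> 2"
  shows "card (faces k A \<union> faces k B) \<le> 2 * k - 1"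
proof -
  let ?F = "\<lambda>A. faces k A"
  have c: "card (?F A) = k" "card (?F B) = k"
    using n_subsets[OF assms(1), of "k - 1"] n_subsets[OF assms(2), of "k - 1"] assms
      binomial_symmetric[of 1 k] by auto
  obtain S where "S \<subseteq> A \<inter> B" "card S = k - 1" using assms(5) by (metis obtain_subset_with_card_n)
  then have "?F A \<inter> ?F B \<noteq> {}" by auto
  moreover have fin: "finite (?F A)" "finite (?F B)" using assms by auto
  then have "finite (?F A \<inter> ?F B)" by blast
  ultimately have "0 < card (?F A \<inter> ?F B)" unfolding card_gt_0_iff by (intro conjI)
  moreover have "card (?F A) + card (?F B) = card (?F A \<union> ?F B) + card (?F A \<inter> ?F B)"
    by (rule card_Un_Int[OF fin])
  ultimately show ?thesis unfolding c by linarith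
qed

section \<open>Reversing chains, growing them greedily, changing one coordinate\<close>

lemma chain_rev:
  assumes "chain k E xs" shows "chain k E (rev xs)"
  unfolding chain_def
proof (intro allI impI, elim conjE)
  fix i I assume I: "I \<subseteq> {i..i + k}" "I \<subseteq> {..<length (rev xs)}" "card I = k"
  let ?f = "\<lambda>q. length xs - 1 - q"
  have "inj_on ?f I"
  proof (rule inj_onI)
    fix p q assume "p \<in> I" "q \<in> I" "?f p = ?f q"
    moreover from this have "p < length xs" "q < length xs" using I(2) by auto
    ultimately show "p = q" by linarith
  qed
  then have c: "card (?f ` I) = k" using I(3) by (simp add: card_image)
  have "(!) xs ` (?f ` I) \<in> E"
    \<comment> \<open>Subtraction is truncated: a window that sticks out at the end is reflected to
      the one that starts at 0.\<close>
    by (rule chainD[OF assms _ _ c, of "length xs - 1 - (i + k)"]) (use I in \<open>fastforce+\<close>)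
  moreover have "(!) xs ` (?f ` I) = (!) (rev xs) ` I"
    unfolding image_image using I(2) by (intro image_cong) (auto simp: rev_nth)
  ultimately show "(!) (rev xs) ` I \<in> E" by simp
qed

text \<open>Each edge is charged to its last position \<open>q\<close>; its other
  \<open>k - 1\<close> positions are among the \<open>k\<close> positions before \<open>q\<close>.
  Only the set of the first \<open>k\<close> positions ends too early for such a charge, and it is
  assumed to be an edge.\<close>

lemma chain_greedy:
  assumes "distinct l" "k \<ge> 1" "k \<le> length l" "(!) l ` {..<k} \<in> T"
    and step: "\<And>q S. \<lbrakk>k \<le> q; q < length l; S \<subseteq> (!) l ` {q - k..<q}; card S = k - 1\<rbrakk> \<Longrightarrow> insert (l ! q) S \<in> T"
  shows "chain k T l"
  unfolding chain_def
proof (intro allI impI, elim conjE)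
  fix i I assume I: "I \<subseteq> {i..i + k}" "I \<subseteq> {..<length l}" "card I = k"
  have fin: "finite I" and ne: "I \<noteq> {}" using I assms(2) by (auto intro: finite_subset)
  define q where "q = Max I"
  have q: "q \<in> I" "\<And>p. p \<in> I \<Longrightarrow> p \<le> q" unfolding q_def using fin ne by auto
  show "(!) l ` I \<in> T"
  proof (cases "q < k")
    case True
    then have "I \<subseteq> {..<k}" using q by force
    then have "I = {..<k}" using I(3) by (intro card_subset_eq) auto
    then show ?thesis using assms(4) by simp
  next
    case False
    have inj: "inj_on ((!) l) I" using inj_on_nth[OF assms(1)] I(2) by blast
    have "I - {q} \<subseteq> {q - k..<q}"
    proof
      fix p assume p: "p \<in> I - {q}"
      then have "p < q" using q(2)[of p] by auto
      moreover have "p \<in> {i..i + k}" "q \<in> {i..i + k}" using I(1) q(1) p by blast+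
      then have "q - k \<le> p" by auto
      ultimately show "p \<in> {q - k..<q}" by simp
    qed
    then have "(!) l ` (I - {q}) \<subseteq> (!) l ` {q - k..<q}" by auto
    moreover have "card ((!) l ` (I - {q})) = k - 1"
      using inj I(3) q(1) fin by (simp add: card_image inj_on_diff)
    ultimately have "insert (l ! q) ((!) l ` (I - {q})) \<in> T"
      using False q(1) I(2) by (intro step) auto
    moreover have "insert (l ! q) ((!) l ` (I - {q})) = (!) l ` I" using q(1) by auto
    ultimately show ?thesis by simp
  qed
qed

lemma mod_eq_near: "\<lbrakk>(p::nat) mod m = q mod m; p \<le> q; q < p + m\<rbrakk> \<Longrightarrow> p = q"
proof (rule ccontr)
  assume *: "p mod m = q mod m" "p \<le> q" "q < p + m" "p \<noteq> q"
  then have "m dvd q - p" using mod_eq_dvd_iff_nat[of p q m] by simp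
  then show False using * nat_dvd_not_less[of "q - p" m] by linarith
qed

text \<open>A coordinate and its repetition are \<open>k + 1\<close> positions apart, one more than
  a window can span. A window thus sees only the old or only the new value of coordinate
  \<open>r\<close>, and whether \<open>i \<le> r\<close> decides which. Hence all its entries come
  from \<open>e\<close> and \<open>v\<close> or from the modified edge and \<open>v\<close>, and
  \<open>v\<close> has to see the faces of just two \<open>k\<close>-sets.\<close>

lemma chain_switch:
  assumes len: "length e = k" "r < k" and d: "distinct (e @ [v])" "distinct (e[r := y] @ [v])"
    and T: "\<And>X. \<lbrakk>X \<subseteq> set (e @ [v]); card X = k\<rbrakk> \<Longrightarrow> X \<in> T"
      "\<And>X. \<lbrakk>X \<subseteq> set (e[r := y] @ [v]); card X = k\<rbrakk> \<Longrightarrow> X \<in> T"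
  shows "chain k T (e @ [v] @ e[r := y])"
  unfolding chain_def
proof (intro allI impI, elim conjE)
  fix i I assume I: "I \<subseteq> {i..i + k}" "I \<subseteq> {..<length (e @ [v] @ e[r := y])}" "card I = k"
  let ?w = "e @ [v] @ e[r := y]"
  define g where "g = (if i \<le> r then e else e[r := y]) @ [v]"
  have lg: "length g = Suc k" unfolding g_def using len by auto
  have dg: "distinct g" unfolding g_def using d by auto
  have eq: "?w ! p = g ! (p mod Suc k)" if "p \<in> I" for p
  proof -
    have p: "i \<le> p" "p \<le> i + k" "p < 2 * k + 1" using that I len by auto
    consider "p < k" | "p = k" | "k < p" by linarith
    then show ?thesis
    proof cases
      case 1
      then have "p mod Suc k = p" by simp
      then show ?thesis using 1 p(1) len by (simp add: g_def nth_append)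
    next
      case 2
      then have "p mod Suc k = p" by simp
      then show ?thesis using 2 len by (simp add: g_def nth_append)
    next
      case 3
      then have m: "p mod Suc k = p - Suc k" using p(3) by (simp add: mod_if)
      have "?w ! p = e[r := y] ! (p - Suc k)" using 3 len by (simp add: nth_append)
      moreover have "p - Suc k < k" "p - Suc k < i" using 3 p len by auto
      ultimately show ?thesis unfolding m using len by (simp add: g_def nth_append)
    qed
  qed
  have inj: "inj_on (\<lambda>p. g ! (p mod Suc k)) I"
  proof (rule inj_onI)
    fix p q assume pq: "p \<in> I" "q \<in> I" "g ! (p mod Suc k) = g ! (q mod Suc k)"
    then have "p mod Suc k = q mod Suc k" using dg lg by (simp add: nth_eq_iff_index_eq)
    moreover have "p \<in> {i..i + k}" "q \<in> {i..i + k}" using pq(1,2) I(1) by blast+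
    then have "p < q + Suc k" "q < p + Suc k" by auto
    ultimately show "p = q" using mod_eq_near[of p "Suc k" q] mod_eq_near[of q "Suc k" p] by linarith
  qed
  have im: "(!) ?w ` I = (\<lambda>p. g ! (p mod Suc k)) ` I" using eq by (rule image_cong[OF refl])
  have sub: "(!) ?w ` I \<subseteq> set g" unfolding im using lg by auto
  have c: "card ((!) ?w ` I) = k" unfolding im using inj I(3) by (simp add: card_image)
  show "(!) ?w ` I \<in> T"
  proof (cases "i \<le> r")
    case True
    then have "g = e @ [v]" by (simp add: g_def)
    with sub have "(!) ?w ` I \<subseteq> set (e @ [v])" by (simp only:)
    then show ?thesis by (rule T(1)) (rule c)
  next
    case False
    then have "g = e[r := y] @ [v]" by (simp add: g_def)
    with sub have "(!) ?w ` I \<subseteq> set (e[r := y] @ [v])" by (simp only:)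
    then show ?thesis by (rule T(2)) (rule c)
  qed
qed

section \<open>Connecting two ends\<close>

text \<open>The template for connecting two ends. \<open>CP 0, \<dots>, CP (2k - 1)\<close> is the first end followed by the first edge
  of the walk, \<open>CR 0, \<dots>, CR (2k - 1)\<close> is the last edge of the walk followed by the second end. The edge
  \<open>stage k j\<close> has first \<open>k - 1\<close> coordinates \<open>core_list k (j div 2)\<close>, which trade \<open>CP (k + r)\<close> for \<open>CR r\<close> one
  by one, and the vertices \<open>CD i\<close> of the last coordinate make this possible: \<open>CD i\<close> is a common neighbour of
  two consecutive cores. Finally \<open>CW j\<close> is a common neighbour of all faces of \<open>stage k j\<close> and
  \<open>stage k (j + 1)\<close>.\<close>

datatype cv = CP nat | CR nat | CD nat | CW nat

definition core_list :: "nat \<Rightarrow> nat \<Rightarrow> cv list" where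
  "core_list k i = map (\<lambda>r. if r < i then CR r else CP (k + r)) [0..<k - 1]"

definition pivot :: "nat \<Rightarrow> nat \<Rightarrow> cv" where
  "pivot k i = (if i = 0 then CP (2 * k - 1) else if i = k then CR (k - 1) else CD i)"

definition stage :: "nat \<Rightarrow> nat \<Rightarrow> cv list" where
  "stage k j = core_list k (j div 2) @ [pivot k ((j + 1) div 2)]"

text \<open>\<open>CP\<close> is grown forwards from the first end and \<open>CR\<close> backwards
  from the second, so each sees only \<open>k\<close> vertices of its own side. \<open>CD i\<close>
  is the last coordinate of exactly the stages \<open>2 * i - 1\<close> and \<open>2 * i\<close>,
  whose cores have the indices \<open>i - 1\<close> and \<open>i\<close>.\<close>

fun conn_fam :: "nat \<Rightarrow> cv \<Rightarrow> cv set set" where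
  "conn_fam k (CP q) = faces k (CP ` {q - k..<q})"
| "conn_fam k (CR q) = faces k (CR ` {q + 1..q + k})"
| "conn_fam k (CD i) = {set (core_list k (i - 1)), set (core_list k i)}"
| "conn_fam k (CW j) = faces k (set (stage k j)) \<union>
                        faces k (set (stage k (j + 1)))"

definition conn_ends :: "nat \<Rightarrow> cv set" where
  "conn_ends k = CP ` {..<k} \<union> CR ` {k..<2 * k}"

text \<open>In this order every family refers to earlier vertices: \<open>CR\<close> runs downwards
  from the second end, \<open>CD\<close> needs core vertices of both kinds, and \<open>CW\<close>
  needs the finished stages.\<close>

definition conn_new :: "nat \<Rightarrow> cv list" where
  "conn_new k = map CP [k..<2 * k] @ map CR (rev [0..<k]) @ map CD [1..<k] @ map CW [0..<2 * k - 1]"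

definition conn_edges :: "nat \<Rightarrow> cv set set" where
  "conn_edges k = {CP ` {..<k}, CR ` {k..<2 * k}} \<union>
     template_edges (conn_fam k) (conn_new k)"

fun conn_pre :: "nat \<Rightarrow> nat \<Rightarrow> cv list" where
  "conn_pre k 0 = []"
| "conn_pre k (Suc j) = conn_pre k j @ stage k j @ [CW j]"

definition conn_mid :: "nat \<Rightarrow> cv list" where
  "conn_mid k = conn_pre k (2 * k - 1) @ stage k (2 * k - 1)"

lemma length_core_list [simp]: "length (core_list k i) = k - 1"
  by (simp add: core_list_def)

lemma length_stage: "k \<ge> 1 \<Longrightarrow> length (stage k j) = k"
  by (simp add: stage_def)

lemma distinct_core_list: "distinct (core_list k i)"
  by (auto simp: core_list_def distinct_map inj_on_def)

lemma card_core: "card (set (core_list k i)) = k - 1"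
  using distinct_card[OF distinct_core_list] by simp

lemma set_core: "set (core_list k i) \<subseteq> CP ` {k..<2 * k - 1} \<union> CR ` {0..<k - 1}"
  by (auto simp: core_list_def image_iff)

lemma distinct_stage:
  assumes "k \<ge> 2" shows "distinct (stage k j)"
proof -
  have "pivot k i \<notin> CP ` {k..<2 * k - 1} \<union> CR ` {0..<k - 1}" for i
    using assms by (auto simp: pivot_def split: if_splits)
  then have "pivot k ((j + 1) div 2) \<notin> set (core_list k (j div 2))"
    using set_core[of k "j div 2"] by blast
  then show ?thesis unfolding stage_def using distinct_core_list by simp
qed

lemma set_stage:
  assumes "k \<ge> 2" "j \<le> 2 * k - 1"
  shows "set (stage k j) \<subseteq> CP ` {k..<2 * k} \<union> CR ` {0..<k} \<union> CD ` {1..<k}"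
proof -
  have "pivot k i \<in> CP ` {k..<2 * k} \<union> CR ` {0..<k} \<union> CD ` {1..<k}" if "i \<le> k" for i
    using assms that by (auto simp: pivot_def)
  from this[of "(j + 1) div 2"]
  have p: "pivot k ((j + 1) div 2) \<in> CP ` {k..<2 * k} \<union> CR ` {0..<k} \<union> CD ` {1..<k}"
    using assms by simp
  have "CP ` {k..<2 * k - 1} \<subseteq> CP ` {k..<2 * k}" "CR ` {0..<k - 1} \<subseteq> CR ` {0..<k}" by auto
  from order_trans[OF set_core Un_mono[OF this]]
  have c: "set (core_list k (j div 2)) \<subseteq> CP ` {k..<2 * k} \<union> CR ` {0..<k}" .
  show ?thesis unfolding stage_def set_append list.set
  proof (rule Un_least)
    show "set (core_list k (j div 2)) \<subseteq> CP ` {k..<2 * k} \<union> CR ` {0..<k} \<union> CD ` {1..<k}"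
      by (rule order_trans[OF c Un_upper1])
    show "{pivot k ((j + 1) div 2)} \<subseteq> CP ` {k..<2 * k} \<union> CR ` {0..<k} \<union> CD ` {1..<k}"
      using p by (simp only: insert_subset empty_subsetI simp_thms)
  qed
qed

lemma stage_0: "k \<ge> 2 \<Longrightarrow> stage k 0 = map CP [k..<2 * k]"
  by (rule nth_equalityI) (auto simp: stage_def core_list_def pivot_def nth_append le_less_Suc_eq not_less)

lemma stage_last: "k \<ge> 2 \<Longrightarrow> stage k (2 * k - 1) = map CR [0..<k]"
  by (rule nth_equalityI) (auto simp: stage_def core_list_def pivot_def nth_append not_less)

text \<open>After an even \<open>j\<close> the pivot changes; after an odd \<open>j\<close> the core
  trades one vertex, in position \<open>j div 2\<close>. One coordinate per step is what
  \<open>chain_switch\<close> and the bound on the faces seen by \<open>CW j\<close> rely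
  on.\<close>

lemma stage_Suc:
  assumes "k \<ge> 2" "j < 2 * k - 1"
  shows "\<exists>r y. r < k \<and> stage k (Suc j) = (stage k j)[r := y]"
proof (cases "even j")
  case True
  then have "stage k (Suc j) = (stage k j)[k - 1 := pivot k ((Suc j + 1) div 2)]"
    by (simp add: stage_def list_update_append)
  then show ?thesis using assms by (intro exI[of _ "k - 1"]) auto
next
  case False
  then obtain i where j: "j = 2 * i + 1" by (elim oddE)
  then have i: "i < k - 1" using assms by auto
  have c: "core_list k (Suc i) = (core_list k i)[i := CR i]"
    by (rule nth_equalityI) (use i in \<open>auto simp: core_list_def nth_list_update less_Suc_eq\<close>)
  have "stage k (Suc j) = (stage k j)[i := CR i]"
    using i c by (simp add: stage_def j list_update_append)
  then show ?thesis using i by (intro exI[of _ i]) auto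
qed

lemma set_conn_new: "set (conn_new k) = CP ` {k..<2 * k} \<union> CR ` {0..<k} \<union> CD ` {1..<k} \<union> CW ` {0..<2 * k - 1}"
  by (auto simp: conn_new_def)

lemma stage_edge:
  assumes k: "k \<ge> 2" and j: "j \<le> 2 * k - 1"
  shows "set (stage k j) \<in> conn_edges k"
proof -
  have edge: "insert t S \<in> conn_edges k" if "t \<in> set (conn_new k)" "S \<in> conn_fam k t" for t S
    using that unfolding conn_edges_def by blast
  consider "j = 0" | "j = 2 * k - 1" | "j > 0" "j < 2 * k - 1" using j by linarith
  then show ?thesis
  proof cases
    case 1
    have "CP ` {k..<2 * k - 1} \<in> conn_fam k (CP (2 * k - 1))"
      by (auto simp: card_image inj_on_def)
    with k have "insert (CP (2 * k - 1)) (CP ` {k..<2 * k - 1}) \<in> conn_edges k"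
      by (intro edge) (auto simp: set_conn_new)
    moreover have "insert (CP (2 * k - 1)) (CP ` {k..<2 * k - 1}) = set (stage k j)"
      unfolding 1 stage_0[OF k] using k by (auto simp: image_iff)
    ultimately show ?thesis by simp
  next
    case 2
    have "CR ` {1..<k} \<in> conn_fam k (CR 0)" by (auto simp: card_image inj_on_def)
    with k have "insert (CR 0) (CR ` {1..<k}) \<in> conn_edges k"
      by (intro edge) (auto simp: set_conn_new)
    moreover have "insert (CR 0) (CR ` {1..<k}) = set (stage k j)"
      unfolding 2 stage_last[OF k] using k by (auto simp: image_iff)
    ultimately show ?thesis by simp
  next
    case 3
    define i where "i = (j + 1) div 2"
    have i: "1 \<le> i" "i < k" using 3 unfolding i_def by linarith+
    have "j div 2 = i - 1 \<or> j div 2 = i" unfolding i_def by linarith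
    then have "set (core_list k (j div 2)) \<in> conn_fam k (CD i)" by auto
    with i have "insert (CD i) (set (core_list k (j div 2))) \<in> conn_edges k"
      by (intro edge) (auto simp: set_conn_new)
    moreover have "set (stage k j) = insert (CD i) (set (core_list k (j div 2)))"
      using i unfolding stage_def i_def[symmetric] by (simp add: pivot_def)
    ultimately show ?thesis by simp
  qed
qed

text \<open>A \<open>k\<close>-set through \<open>CW j\<close> is \<open>CW j\<close> with a face of
  the stage, and one that avoids \<open>CW j\<close> is the stage itself.\<close>

lemma stage_window:
  assumes k: "k \<ge> 2" and j: "j < 2 * k - 1"
    and i: "i = j \<or> i = Suc j" and X: "X \<subseteq> set (stage k i @ [CW j])" "card X = k"
  shows "X \<in> conn_edges k"
proof (cases "CW j \<in> X")
  case True
  have "finite X" using X(1) by (rule finite_subset) simp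
  then have "card (X - {CW j}) = k - 1" using True X(2) by simp
  moreover have "X - {CW j} \<subseteq> set (stage k i)" using X(1) by auto
  ultimately have "X - {CW j} \<in> conn_fam k (CW j)" using i by auto
  moreover have "CW j \<in> set (conn_new k)" using j by (simp add: set_conn_new)
  ultimately have "insert (CW j) (X - {CW j}) \<in> conn_edges k" unfolding conn_edges_def by blast
  then show ?thesis using True by (simp add: insert_absorb)
next
  case False
  then have sub: "X \<subseteq> set (stage k i)" using X(1) by auto
  have "card (set (stage k i)) = k" using distinct_card[OF distinct_stage] k by (simp add: length_stage)
  then have "X = set (stage k i)" using sub X(2) by (intro card_subset_eq) auto
  then show ?thesis using stage_edge[OF k, of i] i j by auto
qed

lemma chain_stages:
  assumes k: "k \<ge> 2" and j: "j < 2 * k - 1"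
  shows "chain k (conn_edges k) (stage k j @ [CW j] @ stage k (Suc j))"
proof -
  obtain r y where ry: "r < k" "stage k (Suc j) = (stage k j)[r := y]" using stage_Suc[OF k j] by blast
  have CW: "CW j \<notin> set (stage k i)" if "i \<le> 2 * k - 1" for i using set_stage[OF k that] by auto
  show ?thesis unfolding ry(2)
  proof (rule chain_switch)
    show "length (stage k j) = k" "r < k" using k ry by (auto simp: length_stage)
    show "distinct (stage k j @ [CW j])" "distinct ((stage k j)[r := y] @ [CW j])"
      unfolding ry(2)[symmetric] using CW[of j] CW[of "Suc j"] distinct_stage[OF k] j by auto
    show "X \<in> conn_edges k" if "X \<subseteq> set (stage k j @ [CW j])" "card X = k" for X
      using stage_window[OF k j _ that] by simp
    show "X \<in> conn_edges k" if "X \<subseteq> set ((stage k j)[r := y] @ [CW j])" "card X = k" for X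
      using stage_window[OF k j _ that[folded ry(2)]] by simp
  qed
qed

lemma chain_start:
  assumes k: "k \<ge> 2" shows "chain k (conn_edges k) (map CP [0..<2 * k])"
proof (rule chain_greedy)
  have "(!) (map CP [0..<2 * k]) ` {..<k} = CP ` {..<k}" using k by (intro image_cong) auto
  then show "(!) (map CP [0..<2 * k]) ` {..<k} \<in> conn_edges k" by (simp add: conn_edges_def)
  fix q S assume q: "k \<le> q" "q < length (map CP [0..<2 * k])"
    and S: "S \<subseteq> (!) (map CP [0..<2 * k]) ` {q - k..<q}" "card S = k - 1"
  have "(!) (map CP [0..<2 * k]) ` {q - k..<q} = CP ` {q - k..<q}" using q by (intro image_cong) auto
  then have "S \<in> conn_fam k (CP q)" using S by simp
  moreover have "CP q \<in> set (conn_new k)" using q by (auto simp: set_conn_new)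
  ultimately have "insert (CP q) S \<in> conn_edges k" unfolding conn_edges_def by blast
  then show "insert (map CP [0..<2 * k] ! q) S \<in> conn_edges k" using q by simp
qed (use k in \<open>auto simp: distinct_map inj_on_def\<close>)

lemma chain_end:
  assumes k: "k \<ge> 2" shows "chain k (conn_edges k) (map CR [0..<2 * k])"
proof -
  let ?l = "rev (map CR [0..<2 * k])"
  have nth: "?l ! q = CR (2 * k - 1 - q)" if "q < 2 * k" for q using that by (simp add: rev_nth)
  have "chain k (conn_edges k) ?l"
  proof (rule chain_greedy)
    have "(!) ?l ` {..<k} = (\<lambda>q. CR (2 * k - 1 - q)) ` {..<k}" using nth k by (intro image_cong) auto
    also have "\<dots> = CR ` {k..<2 * k}"
    proof -
      have "(\<lambda>q. 2 * k - 1 - q) ` {..<k} = {k..<2 * k}"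
      proof safe
        fix x assume "x \<in> {k..<2 * k}"
        then show "x \<in> (\<lambda>q. 2 * k - 1 - q) ` {..<k}" by (intro image_eqI[of _ _ "2 * k - 1 - x"]) auto
      qed auto
      then show ?thesis by (metis image_image)
    qed
    finally show "(!) ?l ` {..<k} \<in> conn_edges k" by (simp add: conn_edges_def)
    fix q S assume q: "k \<le> q" "q < length ?l" and S: "S \<subseteq> (!) ?l ` {q - k..<q}" "card S = k - 1"
    have "(!) ?l ` {q - k..<q} \<subseteq> CR ` {2 * k - 1 - q + 1..2 * k - 1 - q + k}"
    proof
      fix x assume "x \<in> (!) ?l ` {q - k..<q}"
      then obtain p where p: "p \<in> {q - k..<q}" "x = ?l ! p" by auto
      then have "x = CR (2 * k - 1 - p)" using nth[of p] q by auto
      then show "x \<in> CR ` {2 * k - 1 - q + 1..2 * k - 1 - q + k}"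
        by (rule image_eqI) (use p(1) q in auto)
    qed
    then have "S \<in> conn_fam k (CR (2 * k - 1 - q))" using S by simp
    moreover have "CR (2 * k - 1 - q) \<in> set (conn_new k)" using q by (auto simp: set_conn_new)
    ultimately have "insert (CR (2 * k - 1 - q)) S \<in> conn_edges k" unfolding conn_edges_def by blast
    then show "insert (?l ! q) S \<in> conn_edges k" using nth q by simp
  qed (use k in \<open>auto simp: distinct_map inj_on_def\<close>)
  from chain_rev[OF this] show ?thesis by simp
qed

text \<open>Consecutive pieces overlap in a whole stage, whose \<open>k\<close> vertices are the
  overlap that gluing requires.\<close>

lemma conn_chain:
  assumes k: "k \<ge> 2"
  shows "chain k (conn_edges k) (map CP [0..<k] @ conn_mid k @ map CR [k..<2 * k])"
proof -
  have len: "k \<le> length (stage k j)" for j using k by (simp add: length_stage)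
  have "chain k (conn_edges k) ((map CP [0..<k] @ conn_pre k j) @ stage k j)" if "j \<le> 2 * k - 1" for j
    using that
  proof (induction j)
    case 0
    have "map CP [0..<k] @ map CP [k..<2 * k] = map CP [0..<2 * k]"
      by (simp flip: map_append add: upt_add_eq_append[symmetric] mult_2)
    then show ?case using chain_start[OF k] stage_0[OF k] by simp
  next
    case (Suc j)
    from chain_glue[OF Suc.IH chain_stages[OF k] len] Suc.prems show ?case by simp
  qed
  from this[of "2 * k - 1"]
  have 1: "chain k (conn_edges k) ((map CP [0..<k] @ conn_pre k (2 * k - 1)) @ stage k (2 * k - 1))" by simp
  have "map CR [0..<k] @ map CR [k..<2 * k] = map CR [0..<2 * k]"
    by (simp flip: map_append add: upt_add_eq_append[symmetric] mult_2)
  then have 2: "chain k (conn_edges k) (stage k (2 * k - 1) @ map CR [k..<2 * k])"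
    using chain_end[OF k] stage_last[OF k] by simp
  from chain_glue[OF 1 2 len] show ?thesis by (simp add: conn_mid_def)
qed

section \<open>Greedy embedding of the connecting template\<close>

lemma admissible_CP:
  assumes "k \<ge> 2" "q \<le> 2 * k"
  shows "admissible k (conn_fam k) (conn_ends k) (map CP [k..<q])"
  using assms(2)
proof (induction q)
  case (Suc q)
  show ?case
  proof (cases "k \<le> q")
    case True
    have "S \<subseteq> conn_ends k \<union> CP ` {k..<q}" if "S \<subseteq> CP ` {q - k..<q}" for S
      using that unfolding conn_ends_def by force
    then show ?thesis using Suc True by (auto simp: admissible_append conn_ends_def)
  qed simp
qed simp

lemma admissible_CR:
  assumes "k \<ge> 2" "b \<le> k"
  shows "admissible k (conn_fam k) (conn_ends k \<union> CP ` {k..<2 * k}) (map CR (rev [k - b..<k]))"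
  using assms(2)
proof (induction b)
  case (Suc b)
  define q where "q = k - Suc b"
  have e: "[q..<k] = q # [k - b..<k]" using Suc.prems unfolding q_def
    by (simp add: upt_conv_Cons Suc_diff_Suc)
  have "S \<subseteq> conn_ends k \<union> CP ` {k..<2 * k} \<union> CR ` {k - b..<k}" if "S \<subseteq> CR ` {q + 1..q + k}" for S
  proof
    fix x assume "x \<in> S"
    then have "x \<in> CR ` {q + 1..q + k}" using that by (rule rev_subsetD)
    then obtain p where p: "x = CR p" "q + 1 \<le> p" "p \<le> q + k" by auto
    then have "p < 2 * k" "k - b \<le> p" using Suc.prems unfolding q_def by auto
    then show "x \<in> conn_ends k \<union> CP ` {k..<2 * k} \<union> CR ` {k - b..<k}"
      unfolding p(1) conn_ends_def by (cases "p < k") auto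
  qed
  moreover have "CR q \<notin> conn_ends k \<union> CP ` {k..<2 * k} \<union> CR ` {k - b..<k}"
    using Suc.prems unfolding conn_ends_def q_def by auto
  ultimately show ?case using Suc unfolding q_def[symmetric] e
    by (simp add: admissible_append)
qed simp

lemma conn_admissible:
  assumes k: "k \<ge> 2"
  shows "admissible k (conn_fam k) (conn_ends k) (conn_new k)"
proof -
  let ?J = "conn_ends k \<union> CP ` {k..<2 * k} \<union> CR ` {0..<k}"
  have core: "set (core_list k i) \<subseteq> ?J" for i
    using set_core[of k i] by force
  have 1: "admissible k (conn_fam k) ?J (map CD [1..<k])"
  proof (rule admissibleI_late)
    fix t S assume "t \<in> set (map CD [1..<k])" "S \<in> conn_fam k t"
    then obtain i where "S = set (core_list k i)" by auto
    then show "S \<subseteq> ?J \<and> card S = k - 1" using core[of i] card_core[of k i] by metis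
  qed (auto simp: distinct_map inj_on_def conn_ends_def)
  have st: "set (stage k j) \<subseteq> ?J \<union> CD ` {1..<k}" if "j \<le> 2 * k - 1" for j
    using set_stage[OF k that] by auto
  have 2: "admissible k (conn_fam k) (?J \<union> CD ` {1..<k}) (map CW [0..<2 * k - 1])"
  proof (rule admissibleI_late)
    fix t S assume "t \<in> set (map CW [0..<2 * k - 1])" "S \<in> conn_fam k t"
    then obtain j where j: "j < 2 * k - 1" "S \<in> conn_fam k (CW j)" by auto
    then show "S \<subseteq> ?J \<union> CD ` {1..<k} \<and> card S = k - 1"
      using st[of j] st[of "Suc j"] by auto
  qed (auto simp: distinct_map inj_on_def conn_ends_def)
  show ?thesis
    using admissible_CP[OF k, of "2 * k"] admissible_CR[OF k, of k] 1 2
    by (simp add: conn_new_def admissible_append Un_assoc)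
qed

text \<open>Only \<open>CW j\<close> can reach \<open>2k - 1\<close>, because two consecutive stages
  share all but one vertex; \<open>CP\<close> and \<open>CR\<close> see the \<open>k\<close> faces
  of one set, and \<open>CD\<close> at most two faces.\<close>

lemma conn_fam_card:
  assumes k: "k \<ge> 2" and t: "t \<in> set (conn_new k)"
  shows "card (conn_fam k t) \<le> 2 * k - 1"
proof (cases t)
  case (CP q)
  have "card (CP ` {q - k..<q}) = k" using t CP by (auto simp: set_conn_new card_image inj_on_def)
  then show ?thesis using card_two_families[of "CP ` {q - k..<q}" "CP ` {q - k..<q}" k] k CP by simp
next
  case (CR q)
  have "card (CR ` {q + 1..q + k}) = k" by (auto simp: card_image inj_on_def)
  then show ?thesis using card_two_families[of "CR ` {q + 1..q + k}" "CR ` {q + 1..q + k}" k] k CR by simp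
next
  case (CD i)
  have "card (conn_fam k t) \<le> 2" unfolding CD by (simp add: card_insert_if)
  then show ?thesis using k by simp
next
  case (CW j)
  then have j: "j < 2 * k - 1" using t by (auto simp: set_conn_new)
  obtain r y where ry: "r < k" "stage k (Suc j) = (stage k j)[r := y]" using stage_Suc[OF k j] by blast
  have c: "card (set (stage k i)) = k" for i
    using distinct_card[OF distinct_stage] k by (simp add: length_stage)
  have "set (stage k j) - {stage k j ! r} \<subseteq> set (stage k j) \<inter> set (stage k (Suc j))"
  proof
    fix x assume x: "x \<in> set (stage k j) - {stage k j ! r}"
    then obtain q where q: "q < k" "x = stage k j ! q" using k by (auto simp: in_set_conv_nth length_stage)
    then have "q \<noteq> r" using x by auto
    then have "x = stage k (Suc j) ! q" using ry q by simp
    moreover have "q < length (stage k (Suc j))" using q k by (simp add: length_stage)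
    ultimately show "x \<in> set (stage k j) \<inter> set (stage k (Suc j))" using x by auto
  qed
  then have "card (set (stage k j) - {stage k j ! r}) \<le> card (set (stage k j) \<inter> set (stage k (Suc j)))"
    by (intro card_mono) auto
  then have "k - 1 \<le> card (set (stage k j) \<inter> set (stage k (Suc j)))"
    using c ry k by (simp add: length_stage)
  then show ?thesis unfolding CW using card_two_families[OF _ _ c c _ k] by simp
qed

lemma chain_length_edge: "\<lbrakk>chain k E a; length a = k\<rbrakk> \<Longrightarrow> set a \<in> E"
  using chainD[of k E a "{..<k}" 0] nth_image[of k a] by (simp add: lessThan_atLeast0 subset_eq)

lemma set_conn_mid:
  assumes "k \<ge> 2" shows "set (conn_mid k) \<subseteq> set (conn_new k)"
proof -
  have st: "set (stage k j) \<subseteq> set (conn_new k)" if "j \<le> 2 * k - 1" for j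
    by (rule order_trans[OF set_stage[OF assms that]]) (simp add: set_conn_new)
  have "set (conn_pre k j) \<subseteq> set (conn_new k)" if "j \<le> 2 * k - 1" for j
    using that
  proof (induction j)
    case (Suc j)
    have "CW j \<in> set (conn_new k)" using Suc.prems by (simp add: set_conn_new)
    then show ?case using Suc st[of j] by simp
  qed simp
  then show ?thesis using st unfolding conn_mid_def by simp
qed

abbreviation (input) joins :: "nat \<Rightarrow> 'a set set \<Rightarrow> 'a set \<Rightarrow> 'a list \<Rightarrow> 'a list \<Rightarrow> 'a list \<Rightarrow> bool" where
  "joins k E U a b c \<equiv>
     length c = length (conn_mid k) \<and> distinct (a @ c @ b) \<and> set c \<subseteq> U \<and> chain k E (a @ c @ b)"

text \<open>The connector has the same length for all ends, host graphs and sets \<open>U\<close>.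
  The ends may meet \<open>U\<close>: they are prescribed vertices of the embedding, so injectivity
  keeps the connector off them. An end is a single edge in a given order.\<close>

lemma connect:
  fixes \<beta> :: real
  assumes k: "k \<ge> 2" and \<beta>: "0 < \<beta>" "\<beta> \<le> gap k"
  shows "\<exists>N0. \<forall>(V :: 'a set) E U a b. finite V \<longrightarrow> U \<subseteq> V \<longrightarrow> N0 \<le> card U \<longrightarrow> dense k V E \<beta> U \<longrightarrow>
     set a \<subseteq> V \<longrightarrow> set b \<subseteq> V \<longrightarrow> length a = k \<longrightarrow> length b = k \<longrightarrow> distinct (a @ b) \<longrightarrow>
     chain k E a \<longrightarrow> chain k E b \<longrightarrow>
     (\<exists>c. joins k E U a b c)"
proof -
  define J where "J = conn_ends k"
  define ts where "ts = conn_new k"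
  define T0 where "T0 = {CP ` {..<k}, CR ` {k..<2 * k}}"
  define w where "w = map CP [0..<k] @ conn_mid k @ map CR [k..<2 * k]"
  have finJ: "finite J" unfolding J_def conn_ends_def by simp
  have adm: "admissible k (conn_fam k) J ts" unfolding J_def ts_def by (rule conn_admissible[OF k])
  have dis: "set ts \<inter> J = {}" by (rule admissible_disjoint[OF adm])
  have T0: "e \<subseteq> J \<and> card e = k" if "e \<in> T0" for e
    using that unfolding T0_def J_def conn_ends_def by (auto simp: card_image inj_on_def)
  have ch: "chain k (T0 \<union> template_edges (conn_fam k) ts) w"
    using conn_chain[OF k] unfolding T0_def ts_def w_def conn_edges_def .
  have wJ: "set w \<subseteq> J \<union> set ts"
    unfolding w_def J_def ts_def conn_ends_def using set_conn_mid[OF k] by auto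
  have occ: "card {q. q < length w \<and> w ! q = t} \<le> 1" if t: "t \<in> J" for t
  proof -
    have "t \<notin> set (conn_mid k)" using set_conn_mid[OF k] dis t unfolding ts_def by auto
    then have "filter (\<lambda>x. x = t) w = filter (\<lambda>x. x = t) (map CP [0..<k] @ map CR [k..<2 * k])"
      unfolding w_def by (auto simp: filter_empty_conv)
    moreover have "distinct (map CP [0..<k] @ map CR [k..<2 * k])" by (auto simp: distinct_map inj_on_def)
    then have "length (filter (\<lambda>x. x = t) (map CP [0..<k] @ map CR [k..<2 * k])) \<le> 1"
      by (simp only: flip: distinct_card[OF distinct_filter] set_filter)
         (rule order_trans[OF card_mono[of "{t}"]], auto)
    ultimately have "length (filter (\<lambda>x. x = t) w) \<le> 1" by (simp only:)
    then show ?thesis unfolding length_filter_conv_card .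
  qed
  from blowup_path[where J = J and Fam = "conn_fam k" and ts = ts and c = \<beta> and ?T0.0 = T0 and w = w and 'a = 'a,
      OF finJ adm \<beta>(1) _ T0 ch wJ occ] k
  obtain N1 where N1: "\<forall>(V :: 'a set) E U0 U \<phi>0. finite V \<longrightarrow> U0 \<subseteq> V \<longrightarrow> N1 \<le> card U0 \<longrightarrow> \<phi>0 ` J \<subseteq> V \<longrightarrow> inj_on \<phi>0 J \<longrightarrow>
     (\<forall>e\<in>T0. \<phi>0 ` e \<in> E) \<longrightarrow>
     (\<forall>t\<in>set ts. U t \<subseteq> U0 \<and>
        rich k V E (U t) (card (conn_fam k t)) (\<beta> * real (card U0) + real (card J) + real (length ts))) \<longrightarrow>
     (\<exists>xs. length xs = length w \<and> distinct xs \<and> chain k E xs \<and>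
        (\<forall>q<length w. xs ! q \<in> (if w ! q \<in> J then {\<phi>0 (w ! q)} else U (w ! q))))"
    by auto
  note N1 = N1[rule_format (no_asm)]
  \<comment> \<open>The second summand makes \<open>\<beta> * card U\<close> at least the surplus
    \<open>card J + length ts\<close> demanded by \<open>blowup_path\<close>.\<close>
  define N0 where "N0 = N1 + nat \<lceil>real (card J + length ts) / \<beta>\<rceil>"
  show ?thesis
  proof (intro exI[of _ N0] allI impI)
    fix V :: "'a set" and E U a b
    assume V: "finite V" "U \<subseteq> V" "N0 \<le> card U" and d: "dense k V E \<beta> U"
      and ab: "set a \<subseteq> V" "set b \<subseteq> V" "length a = k" "length b = k" "distinct (a @ b)"
      and cab: "chain k E a" "chain k E b"
    define \<phi> where "\<phi> t = (case t of CP q \<Rightarrow> a ! q | CR q \<Rightarrow> b ! (q - k) | _ \<Rightarrow> undefined)" for t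
    have P: "\<phi> ` CP ` {..<k} = set a"
      unfolding image_image \<phi>_def using ab(3) by (auto simp: set_conv_nth)
    have R: "\<phi> ` CR ` {k..<2 * k} = set b"
    proof -
      have "{k..<2 * k} = (+) k ` {..<k}" 
        using image_add_atLeastLessThan[of k 0 k] by (simp add: lessThan_atLeast0 mult_2)
      then have "\<phi> ` CR ` {k..<2 * k} = (\<lambda>q. b ! q) ` {..<k}"
        by (simp add: image_image \<phi>_def)
      then show ?thesis using ab(4) by (auto simp: set_conv_nth)
    qed
    have im: "\<phi> ` J = set a \<union> set b" unfolding J_def conn_ends_def image_Un P R ..
    have "card (\<phi> ` J) = 2 * k" unfolding im using distinct_card[OF ab(5)] ab by simp
    moreover have "card J = 2 * k" unfolding J_def conn_ends_def
      by (subst card_Un_disjoint) (auto simp: card_image inj_on_def)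
    ultimately have inj: "inj_on \<phi> J" using finJ by (intro eq_card_imp_inj_on) auto
    have finU: "finite U" using V finite_subset by auto
    have big: "N1 \<le> card U" "real (card J + length ts) \<le> \<beta> * real (card U)"
    proof -
      have "real (card J + length ts) / \<beta> \<le> real (card U)" using V(3) unfolding N0_def by linarith
      then show "real (card J + length ts) \<le> \<beta> * real (card U)" using \<beta> by (simp add: field_simps)
    qed (use V(3) in \<open>simp add: N0_def\<close>)
    have rich: "rich k V E U (card (conn_fam k t)) (\<beta> * real (card U) + real (card J) + real (length ts))"
      if "t \<in> set ts" for t
      using dense_rich_self[OF d finU \<beta> k conn_fam_card[OF k] big(2)] that unfolding ts_def
      by (simp add: add.assoc)
    have "\<exists>xs. length xs = length w \<and> distinct xs \<and> chain k E xs \<and>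
        (\<forall>q<length w. xs ! q \<in> (if w ! q \<in> J then {\<phi> (w ! q)} else U))"
      by (rule N1[OF V(1,2) big(1)])
         (use ab im inj P R rich chain_length_edge[OF cab(1)] chain_length_edge[OF cab(2)] in
          \<open>auto simp: T0_def\<close>)
    then obtain xs where xs: "length xs = length w" "distinct xs" "chain k E xs"
      and nth: "\<And>q. q < length w \<Longrightarrow> xs ! q \<in> (if w ! q \<in> J then {\<phi> (w ! q)} else U)" by auto
    let ?m = "length (conn_mid k)"
    have lw: "length w = k + ?m + k" unfolding w_def by simp
    define c where "c = take ?m (drop k xs)"
    have "take k xs = a"
    proof (rule nth_equalityI)
      fix q assume "q < length (take k xs)"
      then have q: "q < k" by simp
      then have "w ! q = CP q" unfolding w_def by (simp add: nth_append)
      then show "take k xs ! q = a ! q"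
        using nth[of q] q lw unfolding J_def conn_ends_def by (simp add: \<phi>_def)
    qed (use lw xs ab in simp)
    moreover have "drop (k + ?m) xs = b"
    proof (rule nth_equalityI)
      fix q assume "q < length (drop (k + ?m) xs)"
      then have q: "q < k" using lw xs by simp
      then have "w ! (k + ?m + q) = CR (k + q)" unfolding w_def by (simp add: nth_append)
      then show "drop (k + ?m) xs ! q = b ! q"
        using nth[of "k + ?m + q"] q lw xs(1) unfolding J_def conn_ends_def by (simp add: \<phi>_def)
    qed (use lw xs ab in simp)
    ultimately have split: "xs = a @ c @ b"
      unfolding c_def by (metis append_take_drop_id drop_drop add.commute)
    have lc: "length c = ?m" using lw xs(1) unfolding c_def by simp
    have "set c \<subseteq> U"
    proof
      fix x assume "x \<in> set c"
      then obtain q where q: "q < ?m" "x = c ! q" using lc by (metis in_set_conv_nth)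
      have "w ! (k + q) = conn_mid k ! q" unfolding w_def using q by (simp add: nth_append)
      then have "w ! (k + q) \<notin> J" using set_conn_mid[OF k] dis q(1) nth_mem unfolding ts_def by fastforce
      then have "xs ! (k + q) \<in> U" using nth[of "k + q"] q lw by simp
      moreover have "xs ! (k + q) = c ! q" unfolding split using q lc ab by (simp add: nth_append)
      ultimately show "x \<in> U" using q by simp
    qed
    then show "\<exists>c. length c = ?m \<and> distinct (a @ c @ b) \<and> set c \<subseteq> U \<and> chain k E (a @ c @ b)"
      using lc xs split by (intro exI[of _ c] conjI) simp_all
  qed
qed

section \<open>Absorbing\<close>

text \<open>For \<open>length xs = 2 * k\<close> both orders have the same first and last
  \<open>k\<close> vertices, so the choice between them can be made after the path is complete. That
  \<open>v\<close> lies outside \<open>xs\<close> is left to the application, where the absorbed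
  vertices avoid the whole path.\<close>

definition absorbs :: "nat \<Rightarrow> 'a set set \<Rightarrow> 'a \<Rightarrow> 'a list \<Rightarrow> bool" where
  "absorbs k E v xs \<longleftrightarrow> distinct xs \<and> chain k E xs \<and> chain k E (take k xs @ [v] @ drop k xs)"

text \<open>In the absorber template the index \<open>2 * k\<close> stands for the absorbed vertex; for \<open>q < k\<close> the truncated
  differences make both intervals start at \<open>0\<close>.\<close>

definition abs_fam :: "nat \<Rightarrow> nat \<Rightarrow> nat set set" where
  "abs_fam k q = faces k {q - k..<q} \<union>
     faces k (insert (2 * k) {q + 1 - k..<q})"

section \<open>Many absorbers for each vertex\<close>

lemma chain_map:
  assumes "chain k T l" "\<And>e. e \<in> T \<Longrightarrow> \<psi> ` e \<in> E"
  shows "chain k E (map \<psi> l)"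
  unfolding chain_def
proof (intro allI impI, elim conjE)
  fix i I assume I: "I \<subseteq> {i..i + k}" "I \<subseteq> {..<length (map \<psi> l)}" "card I = k"
  have "(!) l ` I \<in> T" using chainD[OF assms(1) I(1) _ I(3)] I(2) by simp
  then have "\<psi> ` ((!) l ` I) \<in> E" by (rule assms(2))
  moreover have "\<psi> ` ((!) l ` I) = (!) (map \<psi> l) ` I"
    unfolding image_image using I(2) by (intro image_cong) auto
  ultimately show "(!) (map \<psi> l) ` I \<in> E" by simp
qed

lemma abs_admissible: "q \<le> 2 * k \<Longrightarrow> admissible k (abs_fam k) {2 * k} [0..<q]"
proof (induction q)
  case (Suc q)
  have "S \<subseteq> {2 * k} \<union> {0..<q} \<and> card S = k - 1" if "S \<in> abs_fam k q" for S
  proof -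
    have "{q - k..<q} \<subseteq> {2 * k} \<union> {0..<q}" "insert (2 * k) {q + 1 - k..<q} \<subseteq> {2 * k} \<union> {0..<q}" by auto
    then show ?thesis using that unfolding abs_fam_def by blast
  qed
  then show ?case using Suc by (simp add: admissible_append)
qed simp

text \<open>For \<open>q\<close> at least \<open>k\<close> the two \<open>k\<close>-sets differ by
  trading \<open>q - k\<close> for the absorbed vertex. For smaller \<open>q\<close> everything seen
  lies in one \<open>k\<close>-set, the absorbed vertex together with
  \<open>{..<k - 1}\<close>.\<close>

lemma abs_fam_card:
  assumes k: "k \<ge> 2" and q: "q < 2 * k"
  shows "card (abs_fam k q) \<le> 2 * k - 1"
proof (cases "k \<le> q")
  case True
  show ?thesis unfolding abs_fam_def
  proof (rule card_two_families)
    show "card {q - k..<q} = k" "card (insert (2 * k) {q + 1 - k..<q}) = k" using True q k by auto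
    have "{q + 1 - k..<q} \<subseteq> {q - k..<q} \<inter> insert (2 * k) {q + 1 - k..<q}" by auto
    from card_mono[OF _ this] show "k - 1 \<le> card ({q - k..<q} \<inter> insert (2 * k) {q + 1 - k..<q})"
      using True by simp
  qed (use k in auto)
next
  case False
  let ?X = "insert (2 * k) {..<k - 1}"
  have "{q - k..<q} \<subseteq> ?X" "insert (2 * k) {q + 1 - k..<q} \<subseteq> ?X" using False by auto
  then have "abs_fam k q \<subseteq> faces k ?X \<union> faces k ?X"
    unfolding abs_fam_def by blast
  moreover have "finite (faces k ?X \<union> faces k ?X)" by simp
  moreover have "card (faces k ?X \<union> faces k ?X) \<le> 2 * k - 1"
    using k by (intro card_two_families) auto
  ultimately show ?thesis by (meson card_mono le_trans)
qed

definition abs_edges :: "nat \<Rightarrow> nat set set" where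
  "abs_edges k = {insert t S | t S. t < 2 * k \<and> S \<in> abs_fam k t}"

lemma abs_edgesI: "\<lbrakk>t < 2 * k; S \<in> abs_fam k t\<rbrakk> \<Longrightarrow> insert t S \<in> abs_edges k"
  unfolding abs_edges_def by blast

lemma abs_first:
  assumes "k \<ge> 2" shows "{..<k} \<in> abs_edges k"
proof -
  have "{..<k - 1} \<in> abs_fam k (k - 1)" unfolding abs_fam_def by auto
  then have "insert (k - 1) {..<k - 1} \<in> abs_edges k" using assms by (intro abs_edgesI) auto
  moreover have "insert (k - 1) {..<k - 1} = {..<k}" using assms by auto
  ultimately show ?thesis by simp
qed

lemma abs_chain_without:
  assumes "k \<ge> 2" shows "chain k (abs_edges k) [0..<2 * k]"
proof (rule chain_greedy)
  have "(!) [0..<2 * k] ` {..<k} = (\<lambda>q. q) ` {..<k}" by (rule image_cong) auto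
  then show "(!) [0..<2 * k] ` {..<k} \<in> abs_edges k" using abs_first[OF assms] by simp
  fix q S assume q: "k \<le> q" "q < length [0..<2 * k]" and S: "S \<subseteq> (!) [0..<2 * k] ` {q - k..<q}" "card S = k - 1"
  have "(!) [0..<2 * k] ` {q - k..<q} = (\<lambda>q. q) ` {q - k..<q}" using q by (intro image_cong) auto
  then have "S \<in> abs_fam k q" using S unfolding abs_fam_def by simp
  then show "insert ([0..<2 * k] ! q) S \<in> abs_edges k" using q by (auto intro: abs_edgesI)
qed (use assms in auto)

lemma abs_chain_with:
  assumes k: "k \<ge> 2" shows "chain k (abs_edges k) ([0..<k] @ [2 * k] @ [k..<2 * k])"
proof (rule chain_greedy)
  let ?l = "[0..<k] @ [2 * k] @ [k..<2 * k]"
  have n1: "?l ! q = q" if "q < k" for q using that by (simp add: nth_append)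
  have n2: "?l ! k = 2 * k" by (simp add: nth_append)
  have n3: "?l ! q = q - 1" if "k < q" "q \<le> 2 * k" for q using that by (simp add: nth_append)
  have "(!) ?l ` {..<k} = (\<lambda>q. q) ` {..<k}" using n1 by (intro image_cong) auto
  then show "(!) ?l ` {..<k} \<in> abs_edges k" using abs_first[OF k] by simp
  fix q S assume q: "k \<le> q" "q < length ?l" and S: "S \<subseteq> (!) ?l ` {q - k..<q}" "card S = k - 1"
  have finS: "finite S" using S(1) by (rule finite_subset) simp
  show "insert (?l ! q) S \<in> abs_edges k"
  proof (cases "q = k")
    case True
    have "(!) ?l ` {q - k..<q} = (\<lambda>q. q) ` {0..<k}" using n1 True by (intro image_cong) auto
    then have Sk: "S \<subseteq> {0..<k}" using S(1) by simp
    have ne: "S \<noteq> {}" using S(2) k by auto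
    \<comment> \<open>Position \<open>k\<close> holds the absorbed vertex, which is embedded before
      all others; an edge through it and earlier positions is therefore charged to the largest index
      in \<open>S\<close>.\<close>
    define p where "p = Max S"
    have p: "p \<in> S" "\<And>x. x \<in> S \<Longrightarrow> x \<le> p" using finS ne unfolding p_def by auto
    have pk: "p < k" using p(1) Sk by auto
    have "x \<in> {p + 1 - k..<p}" if "x \<in> S - {p}" for x using that p(2)[of x] pk by auto
    then have "insert (2 * k) (S - {p}) \<subseteq> insert (2 * k) {p + 1 - k..<p}" by blast
    moreover have "2 * k \<notin> S - {p}" using Sk by auto
    then have "card (insert (2 * k) (S - {p})) = k - 1" using finS p(1) S(2) k by simp
    ultimately have "insert (2 * k) (S - {p}) \<in> abs_fam k p" unfolding abs_fam_def by blast
    then have "insert p (insert (2 * k) (S - {p})) \<in> abs_edges k" using pk by (intro abs_edgesI) auto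
    moreover have "insert p (insert (2 * k) (S - {p})) = insert (?l ! q) S"
      using p(1) True n2 by auto
    ultimately show ?thesis by simp
  next
    case False
    then have q': "k < q" "q \<le> 2 * k" using q by auto
    have "(!) ?l ` {q - k..<q} \<subseteq> insert (2 * k) {q - 1 + 1 - k..<q - 1}"
    proof
      fix x assume "x \<in> (!) ?l ` {q - k..<q}"
      then obtain p where p: "p \<in> {q - k..<q}" "x = ?l ! p" by auto
      consider "p < k" | "p = k" | "k < p" by linarith
      then show "x \<in> insert (2 * k) {q - 1 + 1 - k..<q - 1}"
        by cases (use p q' n1[of p] n2 n3[of p] in auto)
    qed
    then have "S \<in> abs_fam k (q - 1)" using S unfolding abs_fam_def by blast
    then show ?thesis using n3[OF q'] q' by (auto intro: abs_edgesI)
  qed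
qed (use k in auto)

lemma count_absorbers:
  fixes \<beta> :: real
  assumes k: "k \<ge> 2" and \<beta>: "0 < \<beta>" "\<beta> \<le> gap k" and V: "finite V" "U \<subseteq> V" "v \<in> V"
    and d: "dense k V E \<beta> U" and big: "real (2 * k + 1) \<le> \<beta> * real (card U)"
  shows "(\<beta> * real (card U)) ^ (2 * k) \<le> real (card {xs. set xs \<subseteq> U \<and> length xs = 2 * k \<and> absorbs k E v xs})"
proof -
  define X where "X = {\<phi> \<in> set [0..<2 * k] \<rightarrow>\<^sub>E U. embeds E (abs_fam k) {2 * k} (\<lambda>_. v) (\<lambda>_. U) [0..<2 * k] \<phi>}"
  define L where "L = {xs. set xs \<subseteq> U \<and> length xs = 2 * k \<and> absorbs k E v xs}"
  have finU: "finite U" using V finite_subset by auto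
  have "(\<beta> * real (card U)) ^ length [0..<2 * k] \<le> real (card X)"
    unfolding X_def
  proof (rule count_embeddings[where p = "2 * k"])
    show "admissible k (abs_fam k) {2 * k} [0..<2 * k]" by (rule abs_admissible) simp
    show "U \<subseteq> U \<and> rich k V E U (card (abs_fam k t)) (\<beta> * real (card U) + real (card {2 * k}) + real (2 * k))"
      if "t \<in> set [0..<2 * k]" for t
      using dense_rich_self[OF d finU \<beta> k abs_fam_card[OF k] big, of t] that by (simp add: algebra_simps)
  qed (use V \<beta> in auto)
  moreover have "card X \<le> card L"
  proof (rule card_inj_on_le[where f = "\<lambda>\<phi>. map \<phi> [0..<2 * k]"])
    show "inj_on (\<lambda>\<phi>. map \<phi> [0..<2 * k]) X"
    proof (rule inj_onI)
      fix \<phi> \<phi>' assume *: "\<phi> \<in> X" "\<phi>' \<in> X" "map \<phi> [0..<2 * k] = map \<phi>' [0..<2 * k]"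
      then have "\<phi> \<in> set [0..<2 * k] \<rightarrow>\<^sub>E U" "\<phi>' \<in> set [0..<2 * k] \<rightarrow>\<^sub>E U" unfolding X_def by blast+
      then show "\<phi> = \<phi>'" using *(3) by (intro PiE_ext) (auto simp: map_eq_conv)
    qed
    show "finite L"
      by (rule finite_subset[OF _ finite_lists_length_eq[OF finU, of "2 * k"]]) (auto simp: L_def)
    show "(\<lambda>\<phi>. map \<phi> [0..<2 * k]) ` X \<subseteq> L"
    proof
      fix xs assume "xs \<in> (\<lambda>\<phi>. map \<phi> [0..<2 * k]) ` X"
      then obtain \<phi> where \<phi>: "\<phi> \<in> set [0..<2 * k] \<rightarrow>\<^sub>E U" "xs = map \<phi> [0..<2 * k]"
        and e: "embeds E (abs_fam k) {2 * k} (\<lambda>_. v) (\<lambda>_. U) [0..<2 * k] \<phi>" unfolding X_def by auto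
      define \<psi> where "\<psi> = override_on \<phi> (\<lambda>_. v) {2 * k}"
      have \<psi>: "\<psi> q = \<phi> q" if "q < 2 * k" for q using that unfolding \<psi>_def by (simp add: override_on_def)
      have \<psi>v: "\<psi> (2 * k) = v" unfolding \<psi>_def by simp
      have inj: "inj_on \<psi> ({2 * k} \<union> set [0..<2 * k])" using e unfolding embeds_def \<psi>_def by blast
      have edge: "\<psi> ` ed \<in> E" if ed: "ed \<in> abs_edges k" for ed
      proof -
        obtain t S where tS: "t < 2 * k" "S \<in> abs_fam k t" "ed = insert t S"
          using ed unfolding abs_edges_def by blast
        have "insert (\<phi> t) (\<psi> ` S) \<in> E" using e tS unfolding embeds_def \<psi>_def by auto
        then show ?thesis using tS \<psi> by simp
      qed
      have xs: "xs = map \<psi> [0..<2 * k]" unfolding \<phi>(2) using \<psi> by simp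
      have "distinct xs" unfolding xs distinct_map by (rule conjI[OF distinct_upt inj_on_subset[OF inj]]) auto
      moreover have "chain k E xs" unfolding xs by (rule chain_map[OF abs_chain_without[OF k] edge])
      moreover have "chain k E (take k xs @ [v] @ drop k xs)"
        using chain_map[OF abs_chain_with[OF k] edge] \<psi>v unfolding xs by (simp add: take_map drop_map)
      moreover have "set xs \<subseteq> U" unfolding \<phi>(2) using \<phi>(1) by auto
      ultimately show "xs \<in> L" unfolding L_def absorbs_def using xs by simp
    qed
  qed
  ultimately show ?thesis unfolding L_def by simp
qed

text \<open>Averaging over all \<open>card U ^ (2 * k)\<close> sequences: each vertex is absorbed by
  at least a proportion \<open>\<beta> ^ (2 * k)\<close> of them, so some sequence absorbs at least
  that proportion of the total weight.\<close>

lemma pick_absorber: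
  fixes \<beta> :: real and w :: "'a \<Rightarrow> real"
  assumes k: "k \<ge> 2" and \<beta>: "0 < \<beta>" "\<beta> \<le> gap k" and V: "finite V" "U \<subseteq> V" "V \<noteq> {}"
    and d: "dense k V E \<beta> U" and big: "real (2 * k + 1) \<le> \<beta> * real (card U)"
    and w: "\<And>v. v \<in> V \<Longrightarrow> w v > 0"
  shows "\<exists>xs. set xs \<subseteq> U \<and> length xs = 2 * k \<and> distinct xs \<and> chain k E xs \<and>
     \<beta> ^ (2 * k) * (\<Sum>v\<in>V. w v) \<le> (\<Sum>v\<in>{v\<in>V. absorbs k E v xs}. w v)"
proof -
  define L where "L = {xs. set xs \<subseteq> U \<and> length xs = 2 * k}"
  define g where "g xs = (\<Sum>v\<in>{v\<in>V. absorbs k E v xs}. w v)" for xs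
  have finU: "finite U" using V finite_subset by auto
  have finL: "finite L" unfolding L_def by (rule finite_lists_length_eq[OF finU])
  have cL: "real (card L) = real (card U) ^ (2 * k)" unfolding L_def using card_lists_length_eq[OF finU] by simp
  have Wpos: "(\<Sum>v\<in>V. w v) > 0" using V w by (intro sum_pos) auto
  have Upos: "real (card U) > 0" using big by (cases "card U = 0") auto
  have "(\<Sum>xs\<in>L. g xs) = (\<Sum>xs\<in>L. \<Sum>v\<in>V. if absorbs k E v xs then w v else 0)"
    unfolding g_def using V(1) by (simp add: sum.If_cases Int_def)
  also have "\<dots> = (\<Sum>v\<in>V. \<Sum>xs\<in>L. if absorbs k E v xs then w v else 0)" by (rule sum.swap)
  also have "\<dots> = (\<Sum>v\<in>V. real (card {xs\<in>L. absorbs k E v xs}) * w v)"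
    using finL by (simp add: sum.If_cases Int_def)
  also have "\<dots> \<ge> (\<Sum>v\<in>V. (\<beta> * real (card U)) ^ (2 * k) * w v)"
  proof (intro sum_mono mult_right_mono)
    fix v assume v: "v \<in> V"
    have "{xs\<in>L. absorbs k E v xs} = {xs. set xs \<subseteq> U \<and> length xs = 2 * k \<and> absorbs k E v xs}"
      unfolding L_def by auto
    then show "(\<beta> * real (card U)) ^ (2 * k) \<le> real (card {xs\<in>L. absorbs k E v xs})"
      using count_absorbers[OF k \<beta> V(1,2) v d big] by simp
    show "0 \<le> w v" using w[OF v] by simp
  qed
  finally have tot: "(\<Sum>v\<in>V. (\<beta> * real (card U)) ^ (2 * k) * w v) \<le> (\<Sum>xs\<in>L. g xs)" .
  have "\<exists>xs\<in>L. \<beta> ^ (2 * k) * (\<Sum>v\<in>V. w v) \<le> g xs"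
  proof (rule ccontr)
    assume "\<not> ?thesis"
    then have *: "\<And>xs. xs \<in> L \<Longrightarrow> g xs < \<beta> ^ (2 * k) * (\<Sum>v\<in>V. w v)" by force
    have "L \<noteq> {}" using cL Upos by auto
    then have "(\<Sum>xs\<in>L. g xs) < (\<Sum>xs\<in>L. \<beta> ^ (2 * k) * (\<Sum>v\<in>V. w v))"
      using finL * by (intro sum_strict_mono) auto
    also have "\<dots> = (\<Sum>v\<in>V. (\<beta> * real (card U)) ^ (2 * k) * w v)"
      unfolding sum_distrib_left[symmetric] using cL by (simp add: power_mult_distrib)
    finally show False using tot by simp
  qed
  then obtain xs where xs: "xs \<in> L" "\<beta> ^ (2 * k) * (\<Sum>v\<in>V. w v) \<le> g xs" by blast
  \<comment> \<open>Positive weight means that some vertex is absorbed, and this makes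
    \<open>xs\<close> distinct and a chain.\<close>
  have "0 < g xs" using xs(2) \<beta> Wpos by (meson less_le_trans mult_pos_pos zero_less_power)
  then have "{v\<in>V. absorbs k E v xs} \<noteq> {}" unfolding g_def by (metis less_irrefl sum.empty)
  then obtain v where "absorbs k E v xs" by blast
  then show ?thesis using xs unfolding L_def g_def absorbs_def by blast
qed

text \<open>A block \<open>(T, C)\<close> is an absorber \<open>T\<close> with the sequence \<open>C\<close> connecting it to the next absorber.\<close>

definition path_of :: "('a list \<times> 'a list) list \<Rightarrow> 'a list" where
  "path_of bl = concat (map (\<lambda>(T, C). T @ C) bl)"

definition insert_mid :: "nat \<Rightarrow> 'a option \<Rightarrow> 'a list \<Rightarrow> 'a list" where
  "insert_mid k x T = (case x of None \<Rightarrow> T | Some v \<Rightarrow> take k T @ [v] @ drop k T)"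

text \<open>\<open>\<sigma>\<close> names the vertex, if any, that is inserted into an absorber. It
  can be a function of the list \<open>T\<close>, because the absorbers on a path are disjoint and
  nonempty, hence different as lists.\<close>

definition path_with :: "nat \<Rightarrow> ('a list \<Rightarrow> 'a option) \<Rightarrow> ('a list \<times> 'a list) list \<Rightarrow> 'a list" where
  "path_with k \<sigma> bl = path_of (map (\<lambda>(T, C). (insert_mid k (\<sigma> T) T, C)) bl)"

lemma path_of_simps [simp]:
  "path_of [] = []" "path_of ((T, C) # bl) = T @ C @ path_of bl"
  by (simp_all add: path_of_def)

lemma path_with_simps [simp]:
  "path_with k \<sigma> [] = []" "path_with k \<sigma> ((T, C) # bl) = insert_mid k (\<sigma> T) T @ C @ path_with k \<sigma> bl"
  by (simp_all add: path_with_def)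

lemma set_insert_mid: "set (insert_mid k x T) = set T \<union> set_option x"
proof -
  have "set T = set (take k T) \<union> set (drop k T)" by (metis append_take_drop_id set_append)
  then show ?thesis by (cases x) (auto simp: insert_mid_def)
qed

lemma set_path_with: "set (path_with k \<sigma> bl) = set (path_of bl) \<union> (\<Union>T\<in>fst ` set bl. set_option (\<sigma> T))"
  by (induction bl) (auto simp: set_insert_mid)

text \<open>Inserting a vertex in the middle of \<open>T\<close> keeps its first \<open>k\<close> and last \<open>k\<close> vertices, so the blocks can be
  changed independently of each other.\<close>

lemma chain_path_with:
  assumes "chain k E (path_of bl @ R)" "k \<le> length R"
    "\<And>T C. (T, C) \<in> set bl \<Longrightarrow> length T = 2 * k \<and> chain k E (insert_mid k (\<sigma> T) T)"
  shows "chain k E (path_with k \<sigma> bl @ R) \<and> take k (path_with k \<sigma> bl @ R) = take k (path_of bl @ R)"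
  using assms(1,3)
proof (induction bl)
  case (Cons b bl)
  obtain T C where b: "b = (T, C)" by (cases b)
  have lT: "length T = 2 * k" and cT: "chain k E (insert_mid k (\<sigma> T) T)" using Cons.prems(2) b by auto
  let ?P = "path_of bl @ R" and ?P' = "path_with k \<sigma> bl @ R"
  have c0: "chain k E (T @ C @ ?P)" using Cons.prems(1) b by simp
  then have "chain k E ?P" by (metis append_assoc chain_appendD2)
  then have "chain k E ?P' \<and> take k ?P' = take k ?P" by (rule Cons.IH) (rule Cons.prems(2), erule list.set_intros(2))
  then have IH: "chain k E ?P'" "take k ?P' = take k ?P" by (simp_all only:)
  have len: "k \<le> length (take k ?P')" using assms(2) by simp
  have "chain k E ((T @ C @ take k ?P) @ drop k ?P)" using c0 by (simp only: append_assoc append_take_drop_id)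
  then have "chain k E (T @ C @ take k ?P')" unfolding IH(2) by (rule chain_appendD1)
  then have "chain k E ((T @ C) @ take k ?P')" by (simp only: append_assoc)
  from chain_glue[OF this _ len, of "drop k ?P'"] IH(1)
  have c1: "chain k E (T @ C @ ?P')" by (simp only: append_assoc append_take_drop_id)
  have ins: "\<exists>Y. insert_mid k (\<sigma> T) T = take k T @ Y @ drop k T"
    by (cases "\<sigma> T") (auto simp: insert_mid_def intro: exI[of _ "[]"])
  then obtain Y where Y: "insert_mid k (\<sigma> T) T = take k T @ Y @ drop k T" by blast
  have "chain k E (take k T @ drop k T @ C @ ?P')" using c1 by (metis append_assoc append_take_drop_id)
  then have c2: "chain k E (drop k T @ C @ ?P')" by (rule chain_appendD2)
  have "chain k E ((take k T @ Y) @ drop k T)" using cT unfolding Y by simp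
  from chain_glue[OF this c2] lT have c3: "chain k E ((take k T @ Y) @ drop k T @ C @ ?P')" by simp
  have "take k (take k T @ Y @ drop k T @ C @ ?P') = take k (T @ C @ ?P)" using lT by simp
  with c3 show ?case unfolding b by (simp add: Y)
qed simp

lemma distinct_path_with:
  assumes "distinct (path_of bl)" "\<And>T C. (T, C) \<in> set bl \<Longrightarrow> T \<noteq> []"
    "\<And>T v. \<lbrakk>T \<in> fst ` set bl; \<sigma> T = Some v\<rbrakk> \<Longrightarrow> v \<notin> set (path_of bl)"
    "\<And>T T' v. \<lbrakk>\<sigma> T = Some v; \<sigma> T' = Some v\<rbrakk> \<Longrightarrow> T = T'"
  shows "distinct (path_with k \<sigma> bl)"
  using assms(1-3)
proof (induction bl)
  case (Cons b bl)
  obtain T C where b: "b = (T, C)" by (cases b)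
  have d: "distinct (T @ C @ path_of bl)" using Cons.prems(1) b by simp
  have sub: "set T' \<subseteq> set (path_of bl)" if "T' \<in> fst ` set bl" for T'
    using that unfolding path_of_def by force
  have Tn: "T \<noteq> []" using Cons.prems(2) b by auto
  have T_notin: "T \<notin> fst ` set bl"
  proof
    assume "T \<in> fst ` set bl"
    with sub have "set T \<subseteq> set (path_of bl)" by blast
    with d Tn show False by (cases T) auto
  qed
  have vout: "v \<notin> set (T @ C @ path_of bl)" if "T' \<in> insert T (fst ` set bl)" "\<sigma> T' = Some v" for T' v
    using Cons.prems(3)[of T' v] that b by auto
  have IH: "distinct (path_with k \<sigma> bl)"
  proof (rule Cons.IH)
    show "distinct (path_of bl)" using d by simp
    show "T' \<noteq> []" if "(T', C') \<in> set bl" for T' C' using Cons.prems(2)[of T' C'] that by simp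
    show "v \<notin> set (path_of bl)" if "T' \<in> fst ` set bl" "\<sigma> T' = Some v" for T' v
      using vout[of T' v] that by auto
  qed
  have notin: "v \<notin> set C" "v \<notin> set (path_with k \<sigma> bl)" "v \<notin> set T" if v: "\<sigma> T = Some v" for v
  proof -
    have *: "v \<notin> set (T @ C @ path_of bl)" using vout[OF _ v] by simp
    then show "v \<notin> set C" "v \<notin> set T" by auto
    have "\<sigma> T' \<noteq> Some v" if "T' \<in> fst ` set bl" for T' using assms(4)[OF v, of T'] T_notin that by auto
    then show "v \<notin> set (path_with k \<sigma> bl)" unfolding set_path_with using * by (auto simp: elem_set)
  qed
  have "x \<notin> set (path_with k \<sigma> bl)" if x: "x \<in> set T \<union> set C" for x
  proof -
    have "\<sigma> T' \<noteq> Some x" if "T' \<in> fst ` set bl" for T' using vout[of T' x] that x by auto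
    then show ?thesis unfolding set_path_with using x d by (auto simp: elem_set)
  qed
  then have Cd: "distinct C" "set C \<inter> set (path_with k \<sigma> bl) = {}" "set T \<inter> set (path_with k \<sigma> bl) = {}"
    using d by auto
  have "distinct (insert_mid k (\<sigma> T) T)"
  proof (cases "\<sigma> T")
    case (Some v)
    have "distinct (take k T @ drop k T)" using d by simp
    moreover have "v \<notin> set (take k T) \<union> set (drop k T)"
      using notin(3)[OF Some] by (meson Un_iff in_set_dropD in_set_takeD)
    moreover have "set (take k T) \<inter> set (drop k T) = {}" using d by (intro set_take_disj_set_drop_if_distinct) auto
    ultimately show ?thesis unfolding insert_mid_def Some by (auto simp del: append_take_drop_id)
  qed (use d in \<open>simp add: insert_mid_def\<close>)
  moreover have "set (insert_mid k (\<sigma> T) T) \<inter> (set C \<union> set (path_with k \<sigma> bl)) = {}"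
    unfolding set_insert_mid using notin Cd d by (cases "\<sigma> T") auto
  ultimately show ?case unfolding b using Cd IH by auto
qed simp

text \<open>When a value is chosen for \<open>w\<close>, fewer than \<open>card W\<close> values are
  taken, so the greedy choice never gets stuck.\<close>

lemma greedy_sdr:
  assumes "finite W" "\<And>w. w \<in> W \<Longrightarrow> finite (D w) \<and> card W \<le> card (D w)"
  shows "\<exists>g. inj_on g W \<and> (\<forall>w\<in>W. g w \<in> D w)"
  using assms
proof (induction W)
  case (insert w W)
  have "finite (D u) \<and> card W \<le> card (D u)" if "u \<in> W" for u
    using insert.prems[of u] that insert.hyps by auto
  with insert.IH obtain g where g: "inj_on g W" "\<forall>u\<in>W. g u \<in> D u" by blast
  have "card (g ` W) < card (D w)"
    using insert.prems[of w] insert.hyps card_image_le[OF insert.hyps(1), of g] by simp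
  then have "\<not> D w \<subseteq> g ` W" using insert.hyps(1) by (meson card_mono finite_imageI not_le)
  then obtain x where x: "x \<in> D w" "x \<notin> g ` W" by blast
  have im: "g(w := x) ` W = g ` W" using insert.hyps(2) by (intro image_cong) auto
  have "inj_on (g(w := x)) (insert w W)"
    using g(1) x(2) insert.hyps(2) im by (simp add: inj_on_fun_updI)
  moreover have "\<forall>u\<in>insert w W. (g(w := x)) u \<in> D u" using g(2) x(1) by auto
  ultimately show ?case by blast
qed simp

text \<open>Each vertex of \<open>W\<close> receives an absorber of its own. \<open>R\<close> is an
  arbitrary continuation; as the first \<open>k\<close> vertices stay the same, a path that was
  closed to a cycle through \<open>R\<close> remains closed.\<close>

lemma absorb_into_path:
  assumes k: "k \<ge> 2" and bl: "distinct (path_of bl)" "\<And>T C. (T, C) \<in> set bl \<Longrightarrow> length T = 2 * k"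
    and W: "finite W" "W \<inter> set (path_of bl) = {}"
      "\<And>w. w \<in> W \<Longrightarrow> card W \<le> card {T \<in> fst ` set bl. absorbs k E w T}"
    and R: "k \<le> length R" "chain k E (path_of bl @ R)"
  shows "\<exists>A'. set A' = set (path_of bl) \<union> W \<and> distinct A' \<and> chain k E (A' @ R) \<and>
     take k (A' @ R) = take k (path_of bl @ R)"
proof -
  have "\<exists>g. inj_on g W \<and> (\<forall>w\<in>W. g w \<in> {T \<in> fst ` set bl. absorbs k E w T})"
    by (rule greedy_sdr) (use W in auto)
  then obtain g where g: "inj_on g W" "\<And>w. w \<in> W \<Longrightarrow> g w \<in> fst ` set bl \<and> absorbs k E w (g w)" by auto
  define \<sigma> where "\<sigma> T = (if T \<in> g ` W then Some (the_inv_into W g T) else None)" for T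
  have \<sigma>D: "v \<in> W \<and> T = g v" if "\<sigma> T = Some v" for T v
    using that g(1) unfolding \<sigma>_def by (auto simp: the_inv_into_f_f split: if_splits)
  have \<sigma>g: "\<sigma> (g w) = Some w" if "w \<in> W" for w
    using that g(1) unfolding \<sigma>_def by (simp add: the_inv_into_f_f)
  have chT: "chain k E T" if TC: "(T, C) \<in> set bl" for T C
  proof -
    obtain bl1 bl2 where "bl = bl1 @ (T, C) # bl2" using split_list[OF TC] by blast
    then have "path_of bl @ R = path_of bl1 @ T @ C @ path_of bl2 @ R" by (simp add: path_of_def)
    then show ?thesis using R(2) by (metis chain_appendD1 chain_appendD2)
  qed
  have "chain k E (path_with k \<sigma> bl @ R) \<and> take k (path_with k \<sigma> bl @ R) = take k (path_of bl @ R)"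
  proof (rule chain_path_with[OF R(2,1)])
    fix T C assume TC: "(T, C) \<in> set bl"
    show "length T = 2 * k \<and> chain k E (insert_mid k (\<sigma> T) T)"
    proof (cases "\<sigma> T")
      case None
      then show ?thesis using bl(2) chT TC by (auto simp: insert_mid_def)
    next
      case (Some v)
      then have "absorbs k E v T" using \<sigma>D g(2) by blast
      then show ?thesis using bl(2) TC Some by (auto simp: insert_mid_def absorbs_def)
    qed
  qed
  moreover have "distinct (path_with k \<sigma> bl)"
  proof (rule distinct_path_with[OF bl(1)])
    show "T \<noteq> []" if "(T, C) \<in> set bl" for T C using bl(2)[OF that] k by auto
    show "v \<notin> set (path_of bl)" if "\<sigma> T = Some v" for T v using \<sigma>D[OF that] W(2) by blast
    show "T = T'" if "\<sigma> T = Some v" "\<sigma> T' = Some v" for T T' v using \<sigma>D[OF that(1)] \<sigma>D[OF that(2)] by simp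
  qed
  moreover have "(\<Union>T\<in>fst ` set bl. set_option (\<sigma> T)) = W"
  proof (intro equalityI subsetI)
    fix v assume "v \<in> (\<Union>T\<in>fst ` set bl. set_option (\<sigma> T))"
    then show "v \<in> W" using \<sigma>D by (auto simp: elem_set)
  next
    fix v assume "v \<in> W"
    then show "v \<in> (\<Union>T\<in>fst ` set bl. set_option (\<sigma> T))" using \<sigma>g[of v] g(2)[of v]
      by (intro UN_I[of "g v"]) auto
  qed
  ultimately show ?thesis by (intro exI[of _ "path_with k \<sigma> bl"]) (simp add: set_path_with)
qed

section \<open>Few absorbers that serve every vertex\<close>

lemma linear_less_exp:
  assumes "(a :: real) > 0"
  shows "\<exists>N::nat. \<forall>n\<ge>N. K * real n < exp (a * real n)"
proof (intro exI allI impI)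
  fix n :: nat assume n: "nat \<lceil>2 * \<bar>K\<bar> / a\<^sup>2\<rceil> + 1 \<le> n"
  then have "2 * \<bar>K\<bar> / a\<^sup>2 < real n" by linarith
  then have "\<bar>K\<bar> < a\<^sup>2 / 2 * real n" using assms by (simp add: field_simps)
  then have "\<bar>K\<bar> * real n \<le> a\<^sup>2 / 2 * real n * real n" by (intro mult_right_mono) auto
  moreover have "K * real n \<le> \<bar>K\<bar> * real n" by (intro mult_right_mono) auto
  moreover have "a\<^sup>2 / 2 * real n * real n = (a * real n)\<^sup>2 / 2" by (simp add: power2_eq_square)
  moreover have "1 + a * real n + (a * real n)\<^sup>2 / 2 \<le> exp (a * real n)"
    using assms by (intro exp_lower_Taylor_quadratic) auto
  moreover have "0 \<le> a * real n" using assms by auto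
  ultimately show "K * real n < exp (a * real n)" by linarith
qed

lemma set_fst_subset_path: "T \<in> fst ` set bl \<Longrightarrow> set T \<subseteq> set (path_of bl)"
  unfolding path_of_def by force

lemma distinct_map_fst:
  assumes "distinct (path_of bl)" "\<And>T C. (T, C) \<in> set bl \<Longrightarrow> T \<noteq> []"
  shows "distinct (map fst bl)"
  using assms
proof (induction bl)
  case (Cons b bl)
  obtain T C where b: "b = (T, C)" by (cases b)
  have d: "distinct (T @ C @ path_of bl)" using Cons.prems(1) b by simp
  have Tn: "T \<noteq> []" using Cons.prems(2) b by auto
  have "T \<notin> fst ` set bl"
  proof
    assume "T \<in> fst ` set bl"
    from set_fst_subset_path[OF this] d Tn show False by (cases T) auto
  qed
  moreover have "distinct (map fst bl)"
    by (rule Cons.IH) (use d Cons.prems(2) in auto)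
  ultimately show ?case using b by simp
qed simp

text \<open>A vertex has weight \<open>1 / 2\<close> to the power of the number of its absorbers so
  far. The next absorber halves the weight of vertices that carry at least a proportion
  \<open>(\<beta> / 2) ^ (2 * k)\<close> of the total, whence the factor per block. Blocks are put
  in front: a connector leads from the last \<open>k\<close> vertices of the new absorber to the
  first \<open>k\<close> of the existing path.\<close>

lemma build_blocks:
  fixes \<beta> :: real
  assumes k: "k \<ge> 2" and \<beta>: "0 < \<beta>" "\<beta> \<le> gap k"
  shows "\<exists>N0. \<forall>(V :: 'a set) E j. finite V \<longrightarrow> N0 \<le> card V \<longrightarrow> dense k V E \<beta> V \<longrightarrow>
     real (j * (2 * k + length (conn_mid k))) \<le> \<beta> / 2 * real (card V) \<longrightarrow>
     (\<exists>bl. length bl = j \<and> (\<forall>(T, C)\<in>set bl. length T = 2 * k) \<and> distinct (path_of bl) \<and>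
        set (path_of bl) \<subseteq> V \<and> chain k E (path_of bl) \<and>
        length (path_of bl) \<le> j * (2 * k + length (conn_mid k)) \<and>
        (\<Sum>v\<in>V. (1 / 2) ^ length (filter (absorbs k E v) (map fst bl)))
          \<le> real (card V) * (1 - (\<beta> / 2) ^ (2 * k) / 2) ^ j)"
proof -
  let ?L = "length (conn_mid k)"
  define c where "c = (\<beta> / 2) ^ (2 * k)"
  have "gap k \<le> 1 / 3" using k by (intro divide_left_mono) auto
  then have \<beta>3: "\<beta> \<le> 1 / 3" using \<beta>(2) by linarith
  have \<beta>2: "0 < \<beta> / 2" "\<beta> / 2 \<le> gap k" using \<beta> by auto
  have c01: "0 < c" "c \<le> 1" unfolding c_def using \<beta>2(1) \<beta>3 by (auto intro: power_le_one)
  from connect[OF k \<beta>2, where 'a = 'a] obtain N1 where N1: "\<forall>(V :: 'a set) E U a b. finite V \<longrightarrow> U \<subseteq> V \<longrightarrow> N1 \<le> card U \<longrightarrow> dense k V E (\<beta> / 2) U \<longrightarrow>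
     set a \<subseteq> V \<longrightarrow> set b \<subseteq> V \<longrightarrow> length a = k \<longrightarrow> length b = k \<longrightarrow> distinct (a @ b) \<longrightarrow>
     chain k E a \<longrightarrow> chain k E b \<longrightarrow>
     (\<exists>c. length c = ?L \<and> distinct (a @ c @ b) \<and> set c \<subseteq> U \<and> chain k E (a @ c @ b))" ..
  note N1 = N1[rule_format (no_asm)]
  define N0 where "N0 = 2 * N1 + nat \<lceil>4 * real (2 * k + 1) / \<beta>\<rceil> + 1"
  show ?thesis unfolding c_def[symmetric]
  proof (intro exI[of _ N0] allI impI)
    fix V :: "'a set" and E j
    assume V: "finite V" "N0 \<le> card V" "dense k V E \<beta> V"
      and j: "real (j * (2 * k + ?L)) \<le> \<beta> / 2 * real (card V)"
    have Vne: "V \<noteq> {}" using V(2) unfolding N0_def by auto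
    \<comment> \<open>The path has at most \<open>\<beta> / 2 * card V\<close> vertices throughout,
      so its complement keeps density \<open>\<beta> / 2\<close>; new absorbers and connectors are
      taken from there.\<close>
    have remove: "dense k V E (\<beta> / 2) (V - X) \<and> N1 \<le> card (V - X) \<and>
        real (2 * k + 1) \<le> \<beta> / 2 * real (card (V - X))"
      if X: "X \<subseteq> V" "real (card X) \<le> \<beta> / 2 * real (card V)" for X
    proof -
      have VX: "V - (V - X) = X" using X by auto
      have "dense k V E (\<beta> - \<beta> / 2) (V - X)"
        by (rule dense_subset[OF V(3,1)]) (use X VX k \<beta> in auto)
      then have d: "dense k V E (\<beta> / 2) (V - X)" by (simp add: field_simps)
      have "\<beta> / 2 * real (card V) \<le> 1 / 2 * real (card V)" using \<beta>3 by (intro mult_right_mono) auto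
      then have X2: "real (card X) \<le> 1 / 2 * real (card V)" using X(2) by linarith
      have "card (V - X) = card V - card X" using V(1) X(1) by (meson card_Diff_subset finite_subset)
      then have half: "real (card V) / 2 \<le> real (card (V - X))" using X2 by linarith
      have "2 * N1 \<le> card V" using V(2) unfolding N0_def by linarith
      then have N1X: "N1 \<le> card (V - X)" using half by linarith
      have "4 * real (2 * k + 1) / \<beta> \<le> real (card V)" using V(2) unfolding N0_def by linarith
      then have "4 * real (2 * k + 1) \<le> \<beta> * real (card V)" using \<beta>(1) by (simp add: field_simps)
      moreover have "\<beta> * (real (card V) / 2) \<le> \<beta> * real (card (V - X))"
        using half \<beta>(1) by (intro mult_left_mono) auto
      ultimately have "real (2 * k + 1) \<le> \<beta> / 2 * real (card (V - X))" by (simp add: field_simps)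
      then show ?thesis using d N1X by blast
    qed
    show "\<exists>bl. length bl = j \<and> (\<forall>(T, C)\<in>set bl. length T = 2 * k) \<and> distinct (path_of bl) \<and>
        set (path_of bl) \<subseteq> V \<and> chain k E (path_of bl) \<and>
        length (path_of bl) \<le> j * (2 * k + ?L) \<and>
        (\<Sum>v\<in>V. (1 / 2) ^ length (filter (absorbs k E v) (map fst bl))) \<le> real (card V) * (1 - c / 2) ^ j"
      using j
    proof (induction j)
      case 0
      then show ?case using k by (intro exI[of _ "[]"]) (auto simp: chain_def)
    next
      case (Suc j)
      have "real (j * (2 * k + ?L)) \<le> real (Suc j * (2 * k + ?L))" by simp
      then have "real (j * (2 * k + ?L)) \<le> \<beta> / 2 * real (card V)" using Suc.prems by linarith
      from Suc.IH[OF this] obtain bl where bl: "length bl = j" "\<forall>(T, C)\<in>set bl. length T = 2 * k"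
        "distinct (path_of bl)" "set (path_of bl) \<subseteq> V" "chain k E (path_of bl)"
        "length (path_of bl) \<le> j * (2 * k + ?L)"
        and sum: "(\<Sum>v\<in>V. (1 / 2) ^ length (filter (absorbs k E v) (map fst bl))) \<le> real (card V) * (1 - c / 2) ^ j"
        by blast
      let ?P = "path_of bl"
      define w :: "'a \<Rightarrow> real" where "w v = (1 / 2) ^ length (filter (absorbs k E v) (map fst bl))" for v
      have "card (set ?P) \<le> length ?P" by (rule card_length)
      also have "\<dots> \<le> Suc j * (2 * k + ?L)" using bl(6) by simp
      finally have "real (card (set ?P)) \<le> real (Suc j * (2 * k + ?L))" by (simp only: of_nat_le_iff)
      then have "real (card (set ?P)) \<le> \<beta> / 2 * real (card V)" using Suc.prems by linarith
      note rP = remove[OF bl(4) this]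
      have "\<exists>T. set T \<subseteq> V - set ?P \<and> length T = 2 * k \<and> distinct T \<and> chain k E T \<and>
          (\<beta> / 2) ^ (2 * k) * (\<Sum>v\<in>V. w v) \<le> (\<Sum>v\<in>{v\<in>V. absorbs k E v T}. w v)"
        by (rule pick_absorber[OF k \<beta>2 V(1) _ Vne]) (use rP in \<open>auto simp: w_def\<close>)
      then obtain T where T: "set T \<subseteq> V - set ?P" "length T = 2 * k" "distinct T" "chain k E T"
        and Tw: "c * (\<Sum>v\<in>V. w v) \<le> (\<Sum>v\<in>{v\<in>V. absorbs k E v T}. w v)" unfolding c_def by blast
      \<comment> \<open>The first block has nothing to be connected to and gets an empty
        \<open>C\<close>, hence an inequality for the length.\<close>
      have "\<exists>C. length C \<le> ?L \<and> set C \<subseteq> V \<and> distinct (T @ C @ ?P) \<and> chain k E (T @ C @ ?P)"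
      proof (cases "bl = []")
        case True
        then show ?thesis using T by (intro exI[of _ "[]"]) auto
      next
        case False
        then obtain T0 C0 bl0 where b0: "bl = (T0, C0) # bl0" by (metis neq_Nil_conv surj_pair)
        then have lP: "2 * k \<le> length ?P" using bl(2) by auto
        have TP: "distinct (T @ ?P)" using T bl(3) by auto
        have "card (set (T @ ?P)) \<le> length (T @ ?P)" by (rule card_length)
        also have "\<dots> \<le> Suc j * (2 * k + ?L)" using bl(6) T(2) by simp
        finally have "real (card (set (T @ ?P))) \<le> real (Suc j * (2 * k + ?L))" by (simp only: of_nat_le_iff)
        then have "real (card (set (T @ ?P))) \<le> \<beta> / 2 * real (card V)" using Suc.prems by linarith
        moreover have "set (T @ ?P) \<subseteq> V" using T(1) bl(4) by auto
        ultimately have rT: "dense k V E (\<beta> / 2) (V - set (T @ ?P))" "N1 \<le> card (V - set (T @ ?P))"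
          using remove[of "set (T @ ?P)"] by blast+
        have Ts: "T = take k T @ drop k T" and Ps: "?P = take k ?P @ drop k ?P" by simp_all
        have sub: "set (drop k T) \<subseteq> set T" "set (take k ?P) \<subseteq> set ?P" by (rule set_drop_subset, rule set_take_subset)
        have "\<exists>C. length C = ?L \<and> distinct (drop k T @ C @ take k ?P) \<and> set C \<subseteq> V - set (T @ ?P) \<and>
            chain k E (drop k T @ C @ take k ?P)"
        proof (rule N1[OF V(1) _ rT(2,1)])
          show "set (drop k T) \<subseteq> V" "set (take k ?P) \<subseteq> V" using sub T(1) bl(4) by blast+
          show "length (drop k T) = k" "length (take k ?P) = k" using T(2) lP by auto
          show "distinct (drop k T @ take k ?P)" using TP sub by (auto simp: distinct_append)
          show "chain k E (drop k T)" using T(4) by (metis Ts chain_appendD2)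
          show "chain k E (take k ?P)" using bl(5) by (metis Ps chain_appendD1)
        qed auto
        then obtain C where C: "length C = ?L" "distinct (drop k T @ C @ take k ?P)"
          "set C \<subseteq> V - set (T @ ?P)" "chain k E (drop k T @ C @ take k ?P)" by blast
        have "chain k E (take k T @ drop k T @ C @ take k ?P @ drop k ?P)"
          by (rule chain_glue3[OF _ C(4)]) (use T bl(5) lP in auto)
        then have "chain k E (T @ C @ ?P)" by (metis append_assoc append_take_drop_id)
        moreover have "distinct (T @ C @ ?P)" using TP C(2,3) by auto
        ultimately show ?thesis using C by (intro exI[of _ C]) auto
      qed
      then obtain C where C: "length C \<le> ?L" "set C \<subseteq> V" "distinct (T @ C @ ?P)" "chain k E (T @ C @ ?P)" by blast
      have "(\<Sum>v\<in>V. (1 / 2) ^ length (filter (absorbs k E v) (map fst ((T, C) # bl)))) =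
          (\<Sum>v\<in>V. w v - (if absorbs k E v T then w v / 2 else 0))"
        unfolding w_def by (intro sum.cong) auto
      also have "\<dots> = (\<Sum>v\<in>V. w v) - (\<Sum>v\<in>{v\<in>V. absorbs k E v T}. w v / 2)"
        using V(1) by (simp add: sum_subtractf sum.If_cases Int_def)
      also have "\<dots> = (\<Sum>v\<in>V. w v) - (\<Sum>v\<in>{v\<in>V. absorbs k E v T}. w v) / 2"
        by (simp add: sum_divide_distrib)
      also have "\<dots> \<le> (\<Sum>v\<in>V. w v) - c * (\<Sum>v\<in>V. w v) / 2" using Tw by simp
      also have "\<dots> = (1 - c / 2) * (\<Sum>v\<in>V. w v)" by (simp add: algebra_simps)
      also have "\<dots> \<le> (1 - c / 2) * (real (card V) * (1 - c / 2) ^ j)"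
        using sum c01 unfolding w_def by (intro mult_left_mono) auto
      finally have "(\<Sum>v\<in>V. (1 / 2) ^ length (filter (absorbs k E v) (map fst ((T, C) # bl))))
          \<le> real (card V) * (1 - c / 2) ^ Suc j" by (simp only: power_Suc mult.left_commute)
      moreover have "length (path_of ((T, C) # bl)) \<le> Suc j * (2 * k + ?L)" using bl(6) C(1) T(2) by simp
      moreover have "set (path_of ((T, C) # bl)) \<subseteq> V" using T(1) C(2) bl(4) by auto
      moreover have "\<forall>(T, C)\<in>set ((T, C) # bl). length T = 2 * k" using bl(2) T(2) by auto
      moreover have "length ((T, C) # bl) = Suc j" using bl(1) by simp
      moreover have "distinct (path_of ((T, C) # bl))" "chain k E (path_of ((T, C) # bl))" using C by simp_all
      ultimately show ?case by (intro exI[of _ "(T, C) # bl"] conjI)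
    qed
  qed
qed

text \<open>A vertex with fewer than \<open>\<rho> * card V\<close> absorbers would alone have
  weight above \<open>exp (- \<rho> * card V)\<close>, more than the total weight left after
  linearly many blocks. \<open>R\<close> stands for the rest of the cycle: absorption takes place
  when everything else is in position.\<close>

lemma absorbing_path:
  fixes \<beta> :: real
  assumes k: "k \<ge> 2" and \<beta>: "0 < \<beta>" "\<beta> \<le> gap k"
  shows "\<exists>\<rho>>0. \<exists>N0. \<forall>(V :: 'a set) E. finite V \<longrightarrow> N0 \<le> card V \<longrightarrow> dense k V E \<beta> V \<longrightarrow>
    (\<exists>A. set A \<subseteq> V \<and> distinct A \<and> chain k E A \<and> 2 * k \<le> length A \<and> real (length A) \<le> \<beta> / 2 * real (card V) \<and>
      (\<forall>W R. W \<subseteq> V - set A \<and> real (card W) \<le> \<rho> * real (card V) \<and> chain k E (A @ R @ take k A) \<longrightarrow>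
        (\<exists>A'. set A' = set A \<union> W \<and> distinct A' \<and> k \<le> length A' \<and> chain k E (A' @ R @ take k A'))))"
proof -
  define L where "L = 2 * k + length (conn_mid k)"
  define c where "c = (\<beta> / 2) ^ (2 * k)"
  \<comment> \<open>About \<open>\<theta> * card V\<close> blocks of at most \<open>L\<close>
    vertices fill the permitted \<open>\<beta> / 2 * card V\<close>.\<close>
  define \<theta> where "\<theta> = \<beta> / (2 * real L)"
  have L: "real L > 0" unfolding L_def using k by simp
  have c: "c > 0" unfolding c_def using \<beta> by simp
  have c1: "c \<le> 1"
  proof -
    have "gap k \<le> 1" using k by simp
    then have "\<beta> / 2 \<le> 1" using \<beta> by linarith
    then show ?thesis unfolding c_def using \<beta> by (intro power_le_one) auto
  qed
  have \<theta>: "\<theta> > 0" unfolding \<theta>_def using \<beta> L by simp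
  \<comment> \<open>The factor \<open>(1 - c / 2) ^ j\<close> is roughly
    \<open>exp (- c / 2 * \<theta> * card V)\<close>, that is
    \<open>exp (- 2 * \<rho> * card V)\<close>: half of the exponent beats the linear factor
    \<open>card V\<close>, half is left for a single vertex.\<close>
  define \<rho> where "\<rho> = c * \<theta> / 4"
  have \<rho>: "\<rho> > 0" unfolding \<rho>_def using c \<theta> by simp
  from build_blocks[OF k \<beta>, where 'a = 'a] obtain N1 where N1: "\<forall>(V :: 'a set) E j. finite V \<longrightarrow> N1 \<le> card V \<longrightarrow> dense k V E \<beta> V \<longrightarrow>
     real (j * L) \<le> \<beta> / 2 * real (card V) \<longrightarrow>
     (\<exists>bl. length bl = j \<and> (\<forall>(T, C)\<in>set bl. length T = 2 * k) \<and> distinct (path_of bl) \<and>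
        set (path_of bl) \<subseteq> V \<and> chain k E (path_of bl) \<and> length (path_of bl) \<le> j * L \<and>
        (\<Sum>v\<in>V. (1 / 2) ^ length (filter (absorbs k E v) (map fst bl)))
          \<le> real (card V) * (1 - c / 2) ^ j)" unfolding L_def c_def ..
  note N1 = N1[rule_format (no_asm)]
  \<comment> \<open>The constant \<open>exp (c / 2)\<close> makes up for rounding the number of
    blocks down.\<close>
  obtain N2 where N2: "\<And>n. N2 \<le> n \<Longrightarrow> exp (c / 2) * real n < exp (\<rho> * real n)"
    using linear_less_exp[OF \<rho>] by blast
  define N0 where "N0 = N1 + N2 + nat \<lceil>1 / \<theta>\<rceil>"
  show ?thesis
  proof (intro exI[of _ \<rho>] conjI \<rho> exI[of _ N0] allI impI)
    fix V :: "'a set" and E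
    assume V: "finite V" "N0 \<le> card V" "dense k V E \<beta> V"
    let ?n = "real (card V)"
    define j where "j = nat \<lfloor>\<theta> * ?n\<rfloor>"
    have "1 / \<theta> \<le> ?n" using V(2) unfolding N0_def by linarith
    then have "1 \<le> \<theta> * ?n" using \<theta> by (simp add: field_simps)
    then have j: "real j \<le> \<theta> * ?n" "\<theta> * ?n - 1 \<le> real j" "j \<ge> 1"
      unfolding j_def by linarith+
    have "real (j * L) \<le> \<theta> * ?n * real L" using j(1) by (simp add: mult_right_mono)
    also have "\<dots> = \<beta> / 2 * ?n" unfolding \<theta>_def using L by simp
    finally have jL: "real (j * L) \<le> \<beta> / 2 * ?n" .
    have "N1 \<le> card V" using V(2) unfolding N0_def by simp
    from N1[OF V(1) this V(3) jL] obtain bl where bl: "length bl = j" "\<forall>(T, C)\<in>set bl. length T = 2 * k"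
        "distinct (path_of bl)" "set (path_of bl) \<subseteq> V" "chain k E (path_of bl)"
        "length (path_of bl) \<le> j * L"
        and sum: "(\<Sum>v\<in>V. (1 / 2) ^ length (filter (absorbs k E v) (map fst bl))) \<le> ?n * (1 - c / 2) ^ j"
      by blast
    let ?A = "path_of bl"
    have lT: "length T = 2 * k" if "(T, C) \<in> set bl" for T C using bl(2) that by auto
    have many: "\<rho> * ?n \<le> real (card {T \<in> fst ` set bl. absorbs k E v T})" if v: "v \<in> V" for v
    proof (rule ccontr)
      assume neg: "\<not> ?thesis"
      let ?m = "length (filter (absorbs k E v) (map fst bl))"
      have "distinct (map fst bl)" by (rule distinct_map_fst[OF bl(3)]) (use lT k in fastforce)
      then have "distinct (filter (absorbs k E v) (map fst bl))" by (rule distinct_filter)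
      from distinct_card[OF this] have m: "?m = card {T \<in> fst ` set bl. absorbs k E v T}" by simp
      have "(1 / 2) ^ ?m \<le> (\<Sum>v\<in>V. (1 / 2 :: real) ^ length (filter (absorbs k E v) (map fst bl)))"
        using member_le_sum[of v V "\<lambda>v. (1 / 2 :: real) ^ length (filter (absorbs k E v) (map fst bl))"] v V(1)
        by simp
      also have "\<dots> \<le> ?n * (1 - c / 2) ^ j" by (rule sum)
      also have "\<dots> \<le> ?n * exp (- (c / 2)) ^ j"
        using exp_ge_add_one_self[of "- (c / 2)"] c1 by (intro mult_left_mono power_mono) auto
      also have "\<dots> = ?n * exp (- (c / 2) * real j)" 
        by (simp only: exp_of_nat_mult[symmetric] mult.commute)
      also have "\<dots> \<le> ?n * exp (- (c / 2) * (\<theta> * ?n - 1))"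
        using j(2) c by (intro mult_left_mono) auto
      also have "\<dots> = exp (c / 2) * ?n * exp (- (2 * \<rho> * ?n))"
        unfolding \<rho>_def by (simp add: exp_add[symmetric] algebra_simps)
      also have "\<dots> < exp (\<rho> * ?n) * exp (- (2 * \<rho> * ?n))"
        using N2[of "card V"] V(2) unfolding N0_def by (intro mult_strict_right_mono) auto
      also have "\<dots> = exp (- (\<rho> * ?n))" by (simp add: exp_add[symmetric])
      finally have 1: "(1 / 2) ^ ?m < exp (- (\<rho> * ?n))" .
      have "exp (- 1) \<le> (1 / 2 :: real)"
        using exp_ge_add_one_self[of 1] by (simp add: exp_minus field_simps)
      then have "exp (- 1) ^ ?m \<le> (1 / 2 :: real) ^ ?m" by (intro power_mono) auto
      moreover have "exp (- 1 :: real) ^ ?m = exp (- real ?m)" by (simp add: exp_of_nat_mult[symmetric])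
      ultimately have "exp (- real ?m) < exp (- (\<rho> * ?n))" using 1 by linarith
      then have "\<rho> * ?n < real ?m" by simp
      with neg m show False by simp
    qed
    have lA: "2 * k \<le> length ?A"
    proof -
      obtain T C bl0 where "bl = (T, C) # bl0" using bl(1) j(3) by (cases bl) auto
      then show ?thesis using lT[of T C] by simp
    qed
    show "\<exists>A. set A \<subseteq> V \<and> distinct A \<and> chain k E A \<and> 2 * k \<le> length A \<and> real (length A) \<le> \<beta> / 2 * ?n \<and>
      (\<forall>W R. W \<subseteq> V - set A \<and> real (card W) \<le> \<rho> * ?n \<and> chain k E (A @ R @ take k A) \<longrightarrow>
        (\<exists>A'. set A' = set A \<union> W \<and> distinct A' \<and> k \<le> length A' \<and> chain k E (A' @ R @ take k A')))"
    proof (rule exI[of _ ?A], intro conjI allI impI; (elim conjE)?)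
      show "real (length ?A) \<le> \<beta> / 2 * ?n" using bl(6) jL by (meson of_nat_le_iff order_trans)
      show "2 * k \<le> length ?A" by (rule lA)
      fix W R assume W: "W \<subseteq> V - set ?A" "real (card W) \<le> \<rho> * ?n" and R: "chain k E (?A @ R @ take k ?A)"
      have "\<exists>A'. set A' = set ?A \<union> W \<and> distinct A' \<and> chain k E (A' @ R @ take k ?A) \<and>
          take k (A' @ R @ take k ?A) = take k (?A @ R @ take k ?A)"
      proof (rule absorb_into_path[OF k bl(3) lT _ _ _ _ R])
        show "finite W" using W(1) V(1) by (auto intro: finite_subset)
        show "W \<inter> set ?A = {}" using W(1) by auto
        show "card W \<le> card {T \<in> fst ` set bl. absorbs k E w T}" if "w \<in> W" for w
        proof -
          have "real (card W) \<le> real (card {T \<in> fst ` set bl. absorbs k E w T})"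
            using many[of w] W that by (meson DiffD1 order_trans subsetD)
          then show ?thesis by (simp only: of_nat_le_iff)
        qed
        show "k \<le> length (R @ take k ?A)" using lA by simp
      qed
      then obtain A' where A': "set A' = set ?A \<union> W" "distinct A'" "chain k E (A' @ R @ take k ?A)"
        "take k (A' @ R @ take k ?A) = take k (?A @ R @ take k ?A)" by blast
      have "length ?A = card (set ?A)" using distinct_card[OF bl(3)] by simp
      also have "\<dots> \<le> card (set A')" unfolding A'(1) using W(1) V(1) by (intro card_mono) (auto intro: finite_subset)
      also have "\<dots> = length A'" using distinct_card[OF A'(2)] by simp
      finally have lA': "k \<le> length A'" using lA by simp
      then have "take k A' = take k ?A" using A'(4) lA by simp
      then show "\<exists>A'. set A' = set ?A \<union> W \<and> distinct A' \<and> k \<le> length A' \<and> chain k E (A' @ R @ take k A')"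
        using A' lA' by (intro exI[of _ A']) simp
    qed (use bl in auto)
  qed
qed

section \<open>Light blocks\<close>

text \<open>The template is the complete \<open>k\<close>-graph on \<open>{..k}\<close>. Its first
  \<open>k - 1\<close> vertices see no face, the next one sees one face and the last one
  \<open>k\<close> faces.\<close>

definition clique_fam :: "nat \<Rightarrow> nat \<Rightarrow> nat set set" where
  "clique_fam k q = faces k {..<q}"

lemma clique_admissible: "admissible k (clique_fam k) {} [0..<q]"
  by (induction q) (auto simp: admissible_append clique_fam_def)

lemma card_clique_fam:
  assumes "k \<ge> 2"
  shows "q < k - 1 \<Longrightarrow> card (clique_fam k q) = 0" "card (clique_fam k (k - 1)) = 1" "card (clique_fam k k) = k"
proof -
  have c: "card (clique_fam k q) = q choose (k - 1)" for q
    unfolding clique_fam_def using n_subsets[of "{..<q}" "k - 1"] by simp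
  show "q < k - 1 \<Longrightarrow> card (clique_fam k q) = 0" "card (clique_fam k (k - 1)) = 1" "card (clique_fam k k) = k"
    unfolding c using assms binomial_symmetric[of 1 k] by auto
qed

text \<open>Any \<open>k + 1\<close> consecutive positions of this cyclic walk visit each vertex of
  the clique once. The number \<open>T\<close> of rounds is free, so one small template yields
  blocks of any length divisible by \<open>k + 1\<close>.\<close>

lemma clique_chain:
  assumes k: "k \<ge> 2"
  shows "chain k ({} \<union> template_edges (clique_fam k) [0..<Suc k])
    (map (\<lambda>q. q mod Suc k) [0..<Suc k * T])"
  unfolding chain_def
proof (intro allI impI, elim conjE)
  fix i I assume I: "I \<subseteq> {i..i + k}" "I \<subseteq> {..<length (map (\<lambda>q. q mod Suc k) [0..<Suc k * T])}" "card I = k"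
  let ?w = "map (\<lambda>q. q mod Suc k) [0..<Suc k * T]"
  define X where "X = (!) ?w ` I"
  have X: "X = (\<lambda>q. q mod Suc k) ` I" unfolding X_def using I(2) by (intro image_cong) auto
  have "inj_on (\<lambda>q. q mod Suc k) I"
  proof (rule inj_onI)
    fix p q assume pq: "p \<in> I" "q \<in> I" "p mod Suc k = q mod Suc k"
    then have "p \<in> {i..i + k}" "q \<in> {i..i + k}" using I(1) by blast+
    then have "p < q + Suc k" "q < p + Suc k" by auto
    then show "p = q" using pq(3) mod_eq_near[of p "Suc k" q] mod_eq_near[of q "Suc k" p] by linarith
  qed
  then have cX: "card X = k" unfolding X using I(3) by (simp add: card_image)
  then have fX: "finite X" "X \<noteq> {}" using k by (auto intro: card_ge_0_finite)
  define t where "t = Max X"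
  have t: "t \<in> X" "\<And>x. x \<in> X \<Longrightarrow> x \<le> t" unfolding t_def using fX by auto
  have "X - {t} \<subseteq> {..<t}" using t(2) by force
  moreover have "card (X - {t}) = k - 1" using t(1) cX fX by simp
  ultimately have "X - {t} \<in> clique_fam k t" unfolding clique_fam_def by simp
  moreover have "t < Suc k" using t(1) unfolding X by (elim imageE) (simp only: mod_less_divisor zero_less_Suc)
  then have "t \<in> set [0..<Suc k]" by (simp only: set_upt atLeast0LessThan lessThan_iff)
  moreover have "insert t (X - {t}) = X" using t(1) by auto
  ultimately show "(!) ?w ` I \<in> {} \<union> template_edges (clique_fam k) [0..<Suc k]"
    unfolding X_def[symmetric] by blast
qed

lemma sum_mod_periodic:
  fixes h :: "nat \<Rightarrow> real"
  shows "(\<Sum>q<m * T. h (q mod m)) = real T * (\<Sum>r<m. h r)"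
proof (induction T)
  case (Suc T)
  have "(\<Sum>q<m * Suc T. h (q mod m)) = (\<Sum>q<m * T. h (q mod m)) + (\<Sum>q = m * T..<m * T + m. h (q mod m))"
    by (subst sum.atLeastLessThan_concat[of 0, symmetric, of "m * T" "m * Suc T" "\<lambda>q. h (q mod m)", simplified lessThan_atLeast0[symmetric]]) (auto simp: add.commute)
  also have "(\<Sum>q = m * T..<m * T + m. h (q mod m)) = (\<Sum>r<m. h r)"
    using sum.shift_bounds_nat_ivl[of "\<lambda>q. h (q mod m)" 0 "m * T" m]
    by (simp add: add.commute lessThan_atLeast0)
  finally show ?case using Suc by (simp add: algebra_simps)
qed simp

text \<open>The sorted weights are at least the step function that jumps at \<open>i0\<close>,
  \<open>i1\<close>, \<open>i2\<close>. It is summed by its increments because these are nonnegative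
  and can be compared coefficient by coefficient.\<close>

lemma quantile_sum:
  fixes F :: "nat \<Rightarrow> real"
  assumes mono: "\<And>i j. \<lbrakk>i \<le> j; j < N\<rbrakk> \<Longrightarrow> F i \<le> F j" and pos: "\<And>i. i < N \<Longrightarrow> 0 \<le> F i"
    and i: "i0 \<le> i1" "i1 \<le> i2" "i2 < N"
  shows "real (N - i0) * F i0 + real (N - i1) * (F i1 - F i0) + real (N - i2) * (F i2 - F i1) \<le> (\<Sum>i<N. F i)"
proof -
  have blk: "real (b - a) * F a \<le> (\<Sum>i = a..<b. F i)" if "b \<le> N" for a b
  proof -
    have "(\<Sum>i = a..<b. F a) \<le> (\<Sum>i = a..<b. F i)" using that by (intro sum_mono mono) auto
    then show ?thesis by simp
  qed
  have "(\<Sum>i<N. F i) = (\<Sum>i = 0..<i0. F i) + (\<Sum>i = i0..<i1. F i) + (\<Sum>i = i1..<i2. F i) + (\<Sum>i = i2..<N. F i)"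
    using i by (simp add: sum.atLeastLessThan_concat lessThan_atLeast0)
  moreover have "0 \<le> (\<Sum>i = 0..<i0. F i)" using pos i by (intro sum_nonneg) auto
  moreover have "real (i1 - i0) * F i0 \<le> (\<Sum>i = i0..<i1. F i)" "real (i2 - i1) * F i1 \<le> (\<Sum>i = i1..<i2. F i)"
      "real (N - i2) * F i2 \<le> (\<Sum>i = i2..<N. F i)" using i blk[of i1 i0] blk[of i2 i1] blk[of N i2] by simp_all
  moreover have "real (N - i0) * F i0 + real (N - i1) * (F i1 - F i0) + real (N - i2) * (F i2 - F i1)
      = real (i1 - i0) * F i0 + real (i2 - i1) * F i1 + real (N - i2) * F i2"
    using i by (simp add: of_nat_diff algebra_simps)
  ultimately show ?thesis by linarith
qed

text \<open>A clique can be built greedily from \<open>k - 1\<close> vertices of almost minimal weight, one below the quantile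
  \<open>1 / (2k - 1)\<close> and one below the quantile \<open>k / (2k - 1)\<close>; these inequalities say that the weight above each
  quantile pays for the corresponding vertex.\<close>

lemma quantile_coeffs:
  fixes x :: real
  assumes k: "k \<ge> 2" and x: "x \<ge> 0"
  shows "2 * x \<le> (real k + 1) * (x - x / (2 * real k - 1))"
    "x \<le> (real k + 1) * (x - real k * x / (2 * real k - 1))"
proof -
  define y where "y = x / (2 * real k - 1)"
  have kk: "real k \<ge> 2" using k by simp
  have y: "y \<ge> 0" "x = (2 * real k - 1) * y" unfolding y_def using x kk by auto
  have q: "0 \<le> (real k - 2) * real k" using kk by simp
  have "0 \<le> 2 * ((real k - 2) * real k)" using q by linarith
  then have "0 \<le> (2 * ((real k - 2) * real k)) * y" using y(1) by (rule mult_nonneg_nonneg)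
  then show "2 * x \<le> (real k + 1) * (x - x / (2 * real k - 1))"
    unfolding y_def[symmetric] unfolding y(2) by (simp add: algebra_simps)
  have "0 \<le> ((real k - 2) * real k) * y" using q y(1) by (rule mult_nonneg_nonneg)
  moreover have "real k * x / (2 * real k - 1) = real k * y" unfolding y_def by simp
  ultimately show "x \<le> (real k + 1) * (x - real k * x / (2 * real k - 1))"
    unfolding y(2) by (simp add: algebra_simps y_def[symmetric])
qed

text \<open>A vertex that has to see \<open>d > 0\<close> faces can be found among the lightest
  \<open>d / (2 * k - 1)\<close> proportion of \<open>U\<close>, with room to spare because of
  \<open>\<beta>\<close>. A block repeats one blown-up clique, so its mean weight is bounded by the
  mean of \<open>k + 1\<close> quantiles. The weights are arbitrary and enter only after
  \<open>N0\<close> has been fixed.\<close>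

lemma light_block:
  fixes \<beta> \<gamma> :: real
  assumes k: "k \<ge> 2" and \<beta>: "0 < \<beta>" "\<beta> \<le> gap k" and \<gamma>: "\<gamma> > 0"
  shows "\<exists>N0. \<forall>(V :: 'a set) E U (c :: 'a \<Rightarrow> real). finite V \<longrightarrow> U \<subseteq> V \<longrightarrow> N0 \<le> card U \<longrightarrow> dense k V E \<beta> U \<longrightarrow>
     (\<forall>v\<in>U. 0 \<le> c v) \<longrightarrow>
     (\<exists>B. set B \<subseteq> U \<and> distinct B \<and> chain k E B \<and> length B = Suc k * T \<and>
        real (card U) * (\<Sum>v\<in>set B. c v) \<le> (1 + \<gamma>) * real (length B) * (\<Sum>v\<in>U. c v))"
proof -
  \<comment> \<open>\<open>\<delta> \<le> \<beta>\<close> makes the sets below all three quantiles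
    rich enough, and \<open>\<delta> \<le> \<gamma> / (1 + \<gamma>)\<close> lets the factor
    \<open>1 + \<gamma>\<close> pay for the weight below the lowest quantile.\<close>
  define \<delta> where "\<delta> = min \<beta> (\<gamma> / (1 + \<gamma>))"
  have \<delta>: "0 < \<delta>" "\<delta> \<le> \<beta>" "\<delta> \<le> \<gamma> / (1 + \<gamma>)" unfolding \<delta>_def using \<beta> \<gamma> by auto
  have \<gamma>\<delta>: "1 \<le> (1 + \<gamma>) * (1 - \<delta>)"
  proof -
    have "(1 + \<gamma>) * \<delta> \<le> \<gamma>" using \<delta>(3) \<gamma> by (simp add: field_simps)
    then show ?thesis by (simp add: algebra_simps)
  qed
  let ?w = "map (\<lambda>q. q mod Suc k) [0..<Suc k * T]"
  have wsub: "set ?w \<subseteq> {} \<union> set [0..<Suc k]"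
  proof
    fix x assume "x \<in> set ?w"
    then obtain q where "x = q mod Suc k" by auto
    then have "x < Suc k" by (simp only: mod_less_divisor zero_less_Suc)
    then show "x \<in> {} \<union> set [0..<Suc k]" by (simp only: set_upt atLeast0LessThan lessThan_iff Un_empty_left)
  qed
  from blowup_path[where J = "{}" and Fam = "clique_fam k" and ts = "[0..<Suc k]" and c = "\<delta> / 2" and ?T0.0 = "{}"
      and w = ?w and 'a = 'a, OF _ clique_admissible _ _ _ clique_chain[OF k] wsub] \<delta>(1) k
  obtain N1 where N1': "\<forall>(V :: 'a set) E U0 U (\<phi>0 :: nat \<Rightarrow> 'a). finite V \<longrightarrow> U0 \<subseteq> V \<longrightarrow> N1 \<le> card U0 \<longrightarrow> \<phi>0 ` {} \<subseteq> V \<longrightarrow>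
     inj_on \<phi>0 {} \<longrightarrow> (\<forall>e\<in>{}. \<phi>0 ` e \<in> E) \<longrightarrow>
     (\<forall>t\<in>set [0..<Suc k]. U t \<subseteq> U0 \<and> rich k V E (U t) (card (clique_fam k t))
        (\<delta> / 2 * real (card U0) + real (card ({} :: nat set)) + real (length [0..<Suc k]))) \<longrightarrow>
     (\<exists>xs. length xs = length ?w \<and> distinct xs \<and> chain k E xs \<and>
        (\<forall>q<length ?w. xs ! q \<in> (if ?w ! q \<in> {} then {\<phi>0 (?w ! q)} else U (?w ! q))))"
    by auto
  have N1: "\<exists>xs. length xs = Suc k * T \<and> distinct xs \<and> chain k E xs \<and>
        (\<forall>q<Suc k * T. xs ! q \<in> U (q mod Suc k))"
    if "finite V" "U0 \<subseteq> V" "N1 \<le> card U0" "\<And>t. t \<le> k \<Longrightarrow> U t \<subseteq> U0"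
      "\<And>t. t \<le> k \<Longrightarrow> rich k V E (U t) (card (clique_fam k t)) (\<delta> / 2 * real (card U0) + real (Suc k))"
    for V :: "'a set" and E U0 U
  proof -
    have "\<forall>t\<in>set [0..<Suc k]. U t \<subseteq> U0 \<and> rich k V E (U t) (card (clique_fam k t))
        (\<delta> / 2 * real (card U0) + real (card ({} :: nat set)) + real (length [0..<Suc k]))"
    proof
      fix t assume "t \<in> set [0..<Suc k]"
      then have "t \<le> k" by (simp only: set_upt atLeast0LessThan lessThan_iff less_Suc_eq_le)
      then show "U t \<subseteq> U0 \<and> rich k V E (U t) (card (clique_fam k t))
          (\<delta> / 2 * real (card U0) + real (card ({} :: nat set)) + real (length [0..<Suc k]))"
        using that(4,5)[of t] by simp
    qed
    then show ?thesis
      using N1'[THEN spec[of _ V], THEN spec[of _ E], THEN spec[of _ U0], THEN spec[of _ U], THEN spec[of _ "\<lambda>_. undefined"]]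
        that(1-3) by simp
  qed
  define N0 where "N0 = N1 + nat \<lceil>2 * (real k + 2) / \<delta>\<rceil> + 1"
  show ?thesis
  proof (intro exI[of _ N0] allI impI)
    fix V :: "'a set" and E U and c :: "'a \<Rightarrow> real"
    assume V: "finite V" "U \<subseteq> V" "N0 \<le> card U" and d: "dense k V E \<beta> U" and c: "\<forall>v\<in>U. 0 \<le> c v"
    define N where "N = card U"
    let ?n = "real N" and ?K = "2 * real k - 1"
    have finU: "finite U" using V finite_subset by auto
    have K3: "?K \<ge> 3" using k by simp
    have N: "N1 \<le> N" "2 * (real k + 2) / \<delta> \<le> ?n" "N > 0" using V(3) unfolding N0_def N_def by linarith+
    have big: "real k + 2 \<le> \<delta> / 2 * ?n" using N(2) \<delta>(1) by (simp add: field_simps)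
    obtain xs where xs: "set xs = U" "distinct xs" using finite_distinct_list[OF finU] by blast
    define us where "us = sort_key c xs"
    have us: "set us = U" "distinct us" "sorted (map c us)" unfolding us_def using xs by simp_all
    have lus: "length us = N" using distinct_card[OF us(2)] us(1) unfolding N_def by simp
    define F where "F i = c (us ! i)" for i
    have Fmono: "F i \<le> F j" if "i \<le> j" "j < N" for i j
      using sorted_nth_mono[OF us(3) that(1)] that lus unfolding F_def by simp
    have Fpos: "0 \<le> F i" if "i < N" for i
      using c us(1) lus that nth_mem[of i us] unfolding F_def by auto
    have Fsum: "(\<Sum>i<N. F i) = (\<Sum>v\<in>U. c v)"
    proof -
      have "(\<Sum>v\<in>U. c v) = sum_list (map c us)" using sum.distinct_set_conv_list[OF us(2), of c] us(1) by simp
      then show ?thesis unfolding F_def using lus by (simp add: sum_list_sum_nth atLeast0LessThan)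
    qed
    \<comment> \<open>The unconstrained vertices only need linearly many choices. One face misses at
      least \<open>\<beta> * ?n\<close> fewer than \<open>?n / ?K\<close> vertices, and
      \<open>k\<close> faces miss at least that many fewer than
      \<open>real k * ?n / ?K\<close>.\<close>
    define i0 where "i0 = nat \<lfloor>\<delta> * ?n\<rfloor>"
    define i1 where "i1 = nat \<lfloor>?n / ?K\<rfloor>"
    define i2 where "i2 = nat \<lfloor>real k * ?n / ?K\<rfloor>"
    have r: "real i0 \<le> \<delta> * ?n" "\<delta> * ?n - 1 \<le> real i0" "real i1 \<le> ?n / ?K" "?n / ?K - 1 \<le> real i1"
      "real i2 \<le> real k * ?n / ?K" "real k * ?n / ?K - 1 \<le> real i2"
      unfolding i0_def i1_def i2_def using \<delta>(1) K3 by (simp_all add: of_nat_nat)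
    have "\<delta> * ?n \<le> (1 / ?K) * ?n" using \<delta>(2) \<beta>(2) by (intro mult_right_mono) auto
    then have i01: "i0 \<le> i1" unfolding i0_def i1_def by (intro nat_mono floor_mono) simp
    have "1 * (?n / ?K) \<le> real k * (?n / ?K)" using k K3 by (intro mult_right_mono) auto
    then have i12: "i1 \<le> i2" unfolding i1_def i2_def by (intro nat_mono floor_mono) simp
    have "real k * ?n < ?K * ?n" using N(3) k by (intro mult_strict_right_mono) auto
    then have "real k * ?n / ?K < ?n" using K3 by (simp add: field_simps)
    then have i2N: "i2 < N" using r(5) by linarith
    define W where "W t = set (take (if t < k - 1 then i0 else if t = k - 1 then i1 else i2) us)" for t
    \<comment> \<open>The weight just after the positions used for \<open>t\<close>, hence an upper
      bound on all of \<open>W t\<close>; the index is in range because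
      \<open>i2 < N\<close>.\<close>
    define h where "h t = F (if t < k - 1 then i0 else if t = k - 1 then i1 else i2)" for t
    have WU: "W t \<subseteq> U" for t unfolding W_def using us(1) set_take_subset by metis
    have low: "c v \<le> h t" if v: "v \<in> W t" for v t
    proof -
      let ?i = "if t < k - 1 then i0 else if t = k - 1 then i1 else i2"
      obtain q where q: "q < length (take ?i us)" "v = take ?i us ! q"
        using v unfolding W_def by (metis in_set_conv_nth)
      then have "v = us ! q" "q \<le> ?i" by auto
      moreover have "?i < N" using i01 i12 i2N by auto
      ultimately show ?thesis unfolding h_def using Fmono[of q ?i] F_def by simp
    qed
    have cW: "card (set (take i us)) = i" if "i \<le> N" for i
      using distinct_card[OF distinct_take[OF us(2)], of i] that lus by simp
    let ?x = "(1 / ?K - \<beta>) * ?n"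
    have x: "?x = ?n / ?K - \<beta> * ?n" by (simp add: algebra_simps)
    have \<beta>\<delta>: "\<delta> * ?n \<le> \<beta> * ?n" using \<delta>(2) by (intro mult_right_mono) auto
    have rich: "rich k V E (W t) (card (clique_fam k t)) (\<delta> / 2 * ?n + real (Suc k))" if tk: "t \<le> k" for t
    proof (rule rich_mono[OF dense_rich[OF d finU WU \<beta>(2), of t "card (clique_fam k t)"]])
      let ?goal = "\<delta> / 2 * ?n + real (Suc k)
        \<le> real (card (W t)) - real (card (clique_fam k t)) * ((1 / ?K - \<beta>) * real (card U))"
      have mult: "1 * (\<beta> * ?n) \<le> real k * (\<beta> * ?n)" using k \<beta>(1) by (intro mult_right_mono) auto
      consider "t < k - 1" | "t = k - 1" | "t = k" using tk by linarith
      then show ?goal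
      proof cases
        case 1
        have "card (W t) = i0" using 1 cW[of i0] i01 i12 i2N unfolding W_def by simp
        then show ?thesis using card_clique_fam(1)[OF k 1] big r(2) by simp
      next
        case 2
        have "card (W t) = i1" using 2 cW[of i1] i12 i2N unfolding W_def by simp
        moreover have "real (card (clique_fam k t)) * ?x = ?n / ?K - \<beta> * ?n"
          unfolding 2 card_clique_fam(2)[OF k] x by simp
        ultimately show ?thesis unfolding N_def[symmetric] using big r(4) \<beta>\<delta> by simp
      next
        case 3
        have "\<not> t < k - 1" "t \<noteq> k - 1" using 3 k by auto
        then have "card (W t) = i2" using cW[of i2] i2N unfolding W_def by simp
        moreover have "real (card (clique_fam k t)) * ?x = real k * ?n / ?K - real k * (\<beta> * ?n)"
          unfolding 3 card_clique_fam(3)[OF k] x by (simp add: right_diff_distrib)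
        ultimately show ?thesis unfolding N_def[symmetric] using big r(6) \<beta>\<delta> mult by simp
      qed
    qed simp
    have "\<exists>xs. length xs = Suc k * T \<and> distinct xs \<and> chain k E xs \<and> (\<forall>q<Suc k * T. xs ! q \<in> W (q mod Suc k))"
      by (rule N1[OF V(1,2)]) (use N(1) WU rich in \<open>simp_all add: N_def\<close>)
    then obtain B where B: "length B = Suc k * T" "distinct B" "chain k E B"
      and BW: "\<And>q. q < Suc k * T \<Longrightarrow> B ! q \<in> W (q mod Suc k)" by blast
    have BU: "set B \<subseteq> U"
    proof
      fix v assume "v \<in> set B"
      then obtain q where "q < Suc k * T" "v = B ! q" using B(1) by (metis in_set_conv_nth)
      then show "v \<in> U" using BW WU by blast
    qed
    define f0 d1 d2 where "f0 = F i0" and "d1 = F i1 - F i0" and "d2 = F i2 - F i1"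
    have f: "0 \<le> f0" "0 \<le> d1" "0 \<le> d2"
      unfolding f0_def d1_def d2_def using Fpos[of i0] Fmono[of i0 i1] Fmono[of i1 i2] i01 i12 i2N by auto
    have "(\<Sum>v\<in>set B. c v) = (\<Sum>q<Suc k * T. c (B ! q))"
      using sum.distinct_set_conv_list[OF B(2), of c] B(1) by (simp add: sum_list_sum_nth atLeast0LessThan)
    also have "\<dots> \<le> (\<Sum>q<Suc k * T. h (q mod Suc k))" using BW low by (intro sum_mono) auto
    also have "\<dots> = real T * (\<Sum>r<Suc k. h r)" by (rule sum_mod_periodic)
    also have "(\<Sum>r<Suc k. h r) = (\<Sum>r<k - 1. h r) + h (k - 1) + h k"
      using k sum.lessThan_Suc[of h "k - 1"] by simp
    also have "(\<Sum>r<k - 1. h r) = real (k - 1) * F i0" by (simp add: h_def)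
    also have "h (k - 1) = F i1" by (simp add: h_def)
    also have "h k = F i2"
    proof -
      have "\<not> k < k - 1" "k \<noteq> k - 1" using k by auto
      then show ?thesis by (simp add: h_def)
    qed
    finally have cB: "(\<Sum>v\<in>set B. c v) \<le> real T * (real (k - 1) * F i0 + F i1 + F i2)" .
    \<comment> \<open>All \<open>k + 1\<close> vertices of the clique pay \<open>f0\<close>, the
      last two also pay \<open>d1\<close>, and the very last also pays \<open>d2\<close>.\<close>
    have F: "real (k - 1) * F i0 + F i1 + F i2 = (real k + 1) * f0 + 2 * d1 + d2"
      using k unfolding f0_def d1_def d2_def by (simp add: of_nat_diff algebra_simps)
    have S: "real (N - i0) * f0 + real (N - i1) * d1 + real (N - i2) * d2 \<le> (\<Sum>v\<in>U. c v)"
      using quantile_sum[of N F i0 i1 i2, OF Fmono Fpos i01 i12 i2N] Fsum unfolding f0_def d1_def d2_def by simp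
    have Spos: "0 \<le> (\<Sum>v\<in>U. c v)" using c by (intro sum_nonneg) auto
    have a0: "?n \<le> (1 + \<gamma>) * real (N - i0)"
    proof -
      have "1 * ?n \<le> (1 + \<gamma>) * (1 - \<delta>) * ?n" using \<gamma>\<delta> by (intro mult_right_mono) auto
      also have "\<dots> = (1 + \<gamma>) * (?n - \<delta> * ?n)" by (simp add: algebra_simps)
      also have "\<dots> \<le> (1 + \<gamma>) * real (N - i0)"
        using r(1) \<gamma> i01 i12 i2N by (intro mult_left_mono) (auto simp: of_nat_diff)
      finally show ?thesis by simp
    qed
    \<comment> \<open>Here and in \<open>a2\<close> no factor \<open>1 + \<gamma>\<close> is spent;
      for \<open>k = 2\<close> both inequalities of \<open>quantile_coeffs\<close> hold with
      equality.\<close>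
    have a1: "2 * ?n \<le> (real k + 1) * real (N - i1)"
    proof -
      have "(real k + 1) * (?n - ?n / ?K) \<le> (real k + 1) * real (N - i1)"
        using r(3) i12 i2N by (intro mult_left_mono) (auto simp: of_nat_diff)
      then show ?thesis by (rule order_trans[OF quantile_coeffs(1)[OF k of_nat_0_le_iff]])
    qed
    have a2: "?n \<le> (real k + 1) * real (N - i2)"
    proof -
      have "(real k + 1) * (?n - real k * ?n / ?K) \<le> (real k + 1) * real (N - i2)"
        using r(5) i2N by (intro mult_left_mono) (auto simp: of_nat_diff)
      then show ?thesis by (rule order_trans[OF quantile_coeffs(2)[OF k of_nat_0_le_iff]])
    qed
    have up: "1 * y \<le> (1 + \<gamma>) * y" if "0 \<le> y" for y using \<gamma> that by (intro mult_right_mono) auto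
    have b0: "?n * ((real k + 1) * f0) \<le> (1 + \<gamma>) * (real k + 1) * (real (N - i0) * f0)"
      using mult_right_mono[OF a0, of "(real k + 1) * f0"] f(1) by (simp add: mult_ac)
    have b1: "?n * (2 * d1) \<le> (1 + \<gamma>) * (real k + 1) * (real (N - i1) * d1)"
      using mult_right_mono[OF a1 f(2)] up[of "(real k + 1) * real (N - i1) * d1"] f(2) by (simp add: mult_ac)
    have b2: "?n * d2 \<le> (1 + \<gamma>) * (real k + 1) * (real (N - i2) * d2)"
      using mult_right_mono[OF a2 f(3)] up[of "(real k + 1) * real (N - i2) * d2"] f(3) by (simp add: mult_ac)
    have "?n * ((real k + 1) * f0 + 2 * d1 + d2)
        \<le> (1 + \<gamma>) * (real k + 1) * (real (N - i0) * f0 + real (N - i1) * d1 + real (N - i2) * d2)"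
      using b0 b1 b2 by (simp only: distrib_left)
    also have "\<dots> \<le> (1 + \<gamma>) * (real k + 1) * (\<Sum>v\<in>U. c v)"
      using S \<gamma> by (intro mult_left_mono) auto
    finally have "real T * (?n * ((real k + 1) * f0 + 2 * d1 + d2)) \<le> real T * ((1 + \<gamma>) * (real k + 1) * (\<Sum>v\<in>U. c v))"
      by (rule mult_left_mono) simp
    moreover have "?n * (\<Sum>v\<in>set B. c v) \<le> ?n * (real T * (real (k - 1) * F i0 + F i1 + F i2))"
      using cB by (rule mult_left_mono) simp
    moreover have "real T * ((1 + \<gamma>) * (real k + 1) * (\<Sum>v\<in>U. c v)) = (1 + \<gamma>) * real (length B) * (\<Sum>v\<in>U. c v)"
      unfolding B(1) by (simp add: algebra_simps)
    ultimately have "?n * (\<Sum>v\<in>set B. c v) \<le> (1 + \<gamma>) * real (length B) * (\<Sum>v\<in>U. c v)"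
      unfolding F by (simp only: mult.left_commute)
    then show "\<exists>B. set B \<subseteq> U \<and> distinct B \<and> chain k E B \<and> length B = Suc k * T \<and>
        real (card U) * (\<Sum>v\<in>set B. c v) \<le> (1 + \<gamma>) * real (length B) * (\<Sum>v\<in>U. c v)"
      using BU B unfolding N_def by (intro exI[of _ B] conjI)
  qed
qed

section \<open>Covering almost all vertices\<close>

definition ratio :: "'a set set \<Rightarrow> 'a set \<Rightarrow> 'a set \<Rightarrow> real" where
  "ratio E U S = real (card (common E U {S})) / real (card U)"

text \<open>A soft minimum of the codegree ratios: a single face with a small ratio makes the sum
  large, so an upper bound on the sum bounds every ratio from below.\<close>

definition potential :: "nat \<Rightarrow> 'a set \<Rightarrow> 'a set set \<Rightarrow> real \<Rightarrow> 'a set \<Rightarrow> real" where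
  "potential k V E \<kappa> U = (\<Sum>S\<in>faces k V. exp (- \<kappa> * ratio E U S))"

lemma exp_le_quadratic:
  fixes y :: real
  assumes "\<bar>y\<bar> \<le> 1" shows "exp y \<le> 1 + y + y\<^sup>2"
proof (cases "0 \<le> y")
  case True
  then show ?thesis using exp_bound[of y] assms by simp
next
  case False
  define z where "z = - y"
  have z: "z > 0" using False z_def by simp
  have "1 \<le> (1 + z) * (1 - z + z\<^sup>2)"
  proof -
    have "(1 + z) * (1 - z + z\<^sup>2) = 1 + z ^ 3" by (simp add: algebra_simps power2_eq_square power3_eq_cube)
    then show ?thesis using z by simp
  qed
  also have "\<dots> \<le> exp z * (1 - z + z\<^sup>2)"
  proof (rule mult_right_mono)
    show "1 + z \<le> exp z" by (rule exp_ge_add_one_self)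
    have "0 \<le> (1 - z)\<^sup>2" by simp
    then have "2 * z \<le> 1 + z\<^sup>2" by (simp add: power2_eq_square algebra_simps)
    then show "0 \<le> 1 - z + z\<^sup>2" using z by linarith
  qed
  finally have "exp (- z) \<le> 1 - z + z\<^sup>2" by (simp add: exp_minus field_simps)
  then show ?thesis by (simp add: z_def)
qed

lemma finite_common: "finite U \<Longrightarrow> finite (common E U F)"
  unfolding common_def by simp

lemma card_common_le: "finite U \<Longrightarrow> card (common E U F) \<le> card U"
  unfolding common_def by (intro card_mono) auto

lemma card_common_diff:
  assumes "finite U" "B \<subseteq> U"
  shows "real (card (common E (U - B) F)) = real (card (common E U F)) - real (card (common E B F))"
proof -
  have "common E (U - B) F = common E U F - common E B F" "common E B F \<subseteq> common E U F"
    unfolding common_def using assms by auto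
  then show ?thesis
    using card_Diff_subset[of "common E B F" "common E U F"] finite_common[OF assms(1)]
      card_mono[OF finite_common[OF assms(1)], of "common E B F" E F]
    by (simp add: finite_subset of_nat_diff)
qed

lemma ratio_bounds:
  assumes "finite U" shows "0 \<le> ratio E U S" "ratio E U S \<le> 1"
  unfolding ratio_def using card_common_le[OF assms, of E "{S}"] by (auto simp: divide_le_eq_1)

text \<open>The ratio of a face drops by
  \<open>(b S - card B * ratio E U S) / (card U - card B)\<close>, where \<open>b S\<close> counts
  its neighbours in \<open>B\<close>. Weighted by the terms of the potential, these drops sum to the
  quantity controlled by \<open>light\<close>, with error \<open>\<gamma> * \<eta>\<close>. Every
  exponent moves by at most \<open>\<eta>\<close>, so second-order effects contribute
  \<open>\<eta>\<^sup>2\<close>.\<close>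

lemma potential_block:
  fixes \<gamma> \<eta> \<kappa> :: real
  assumes fin: "finite V" and U: "U \<subseteq> V" "B \<subseteq> U" "2 * card B \<le> card U" "card U > 0"
    and par: "0 \<le> \<kappa>" "\<kappa> * (2 * real (card B) / real (card U)) \<le> \<eta>" "\<eta> \<le> 1" "0 \<le> \<gamma>"
    and light: "real (card U) * (\<Sum>v\<in>B. \<Sum>S\<in>faces k V. if insert v S \<in> E then exp (- \<kappa> * ratio E U S) else 0)
      \<le> (1 + \<gamma>) * real (card B) * (\<Sum>v\<in>U. \<Sum>S\<in>faces k V. if insert v S \<in> E then exp (- \<kappa> * ratio E U S) else 0)"
  shows "potential k V E \<kappa> (U - B) \<le> potential k V E \<kappa> U * (1 + \<eta>\<^sup>2 + \<gamma> * \<eta>)"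
proof -
  let ?SS = "faces k V"
  let ?N = "real (card U)" and ?M = "real (card B)"
  define w where "w S = exp (- \<kappa> * ratio E U S)" for S
  define b where "b S = real (card (common E B {S}))" for S
  have finU: "finite U" and finB: "finite B" using fin U finite_subset by metis+
  have finS: "finite ?SS" using fin by simp
  have NM: "?N > 0" "?N - ?M > 0" "?N \<le> 2 * (?N - ?M)"
    using of_nat_mono[OF U(3), where 'a = real] U(4) by simp_all
  have cUB: "real (card (U - B)) = ?N - ?M"
    using card_Diff_subset[OF finB U(2)] card_mono[OF finU U(2)] by simp
  \<comment> \<open>Double counting turns the vertex weights in \<open>light\<close> into codegrees
    weighted by \<open>w\<close>.\<close>
  have swap: "(\<Sum>v\<in>X. \<Sum>S\<in>?SS. if insert v S \<in> E then w S else 0) = (\<Sum>S\<in>?SS. w S * real (card (common E X {S})))"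
    if "finite X" for X
  proof -
    have "(\<Sum>v\<in>X. \<Sum>S\<in>?SS. if insert v S \<in> E then w S else 0) = (\<Sum>S\<in>?SS. \<Sum>v\<in>X. if insert v S \<in> E then w S else 0)"
      by (rule sum.swap)
    also have "\<dots> = (\<Sum>S\<in>?SS. w S * real (card (common E X {S})))"
      using that by (intro sum.cong) (simp_all add: sum.If_cases common_def Int_def)
    finally show ?thesis .
  qed
  have "?N * (\<Sum>S\<in>?SS. w S * b S) \<le> (1 + \<gamma>) * ?M * (\<Sum>S\<in>?SS. w S * real (card (common E U {S})))"
    using light unfolding w_def[symmetric] swap[OF finB] swap[OF finU] b_def .
  also have "(\<Sum>S\<in>?SS. w S * real (card (common E U {S}))) = ?N * (\<Sum>S\<in>?SS. w S * ratio E U S)"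
    using NM(1) unfolding sum_distrib_left ratio_def by (intro sum.cong) auto
  finally have "?N * (\<Sum>S\<in>?SS. w S * b S) \<le> ?N * ((1 + \<gamma>) * ?M * (\<Sum>S\<in>?SS. w S * ratio E U S))"
    by (simp only: mult.left_commute)
  then have lb: "(\<Sum>S\<in>?SS. w S * b S) \<le> (1 + \<gamma>) * ?M * (\<Sum>S\<in>?SS. w S * ratio E U S)"
    using NM(1) by (simp only: mult_le_cancel_left_pos)
  define y where "y S = \<kappa> / (?N - ?M) * (b S - ?M * ratio E U S)" for S
  have yeq: "- \<kappa> * ratio E (U - B) S = - \<kappa> * ratio E U S + y S" for S
  proof -
    have p: "real (card (common E U {S})) = ?N * ratio E U S" unfolding ratio_def using NM(1) by simp
    have "ratio E (U - B) S = (?N * ratio E U S - b S) / (?N - ?M)"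
      unfolding ratio_def[of E "U - B"] cUB card_common_diff[OF finU U(2)] b_def p ..
    also have "\<dots> = ratio E U S - (b S - ?M * ratio E U S) / (?N - ?M)"
      using NM(2) by (simp add: field_simps)
    finally have "ratio E (U - B) S = ratio E U S - (b S - ?M * ratio E U S) / (?N - ?M)" .
    moreover have "y S = \<kappa> * ((b S - ?M * ratio E U S) / (?N - ?M))" unfolding y_def by simp
    ultimately show ?thesis by (simp only: right_diff_distrib)
  qed
  have \<eta>1: "\<kappa> / (?N - ?M) * ?M \<le> \<eta>"
  proof -
    have "\<kappa> / (?N - ?M) * ?M = \<kappa> * (?M / (?N - ?M))" by simp
    also have "?M / (?N - ?M) \<le> 2 * ?M / ?N"
    proof -
      have "?M * ?N \<le> ?M * (2 * (?N - ?M))" using NM(3) by (intro mult_left_mono) auto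
      then show ?thesis using NM by (simp add: field_simps)
    qed
    then have "\<kappa> * (?M / (?N - ?M)) \<le> \<kappa> * (2 * ?M / ?N)" using par(1) by (intro mult_left_mono) auto
    finally show ?thesis using par(2) by linarith
  qed
  \<comment> \<open>Both \<open>b S\<close> and \<open>?M * ratio E U S\<close> lie between 0 and
    \<open>?M\<close>, and so does the modulus of their difference.\<close>
  have ybd: "\<bar>y S\<bar> \<le> \<eta>" for S
  proof -
    have b: "0 \<le> b S" "b S \<le> ?M" unfolding b_def using card_common_le[OF finB, of E "{S}"] by auto
    have r: "0 \<le> ?M * ratio E U S" "?M * ratio E U S \<le> ?M * 1"
      using ratio_bounds[OF finU, of E S] by (auto intro!: mult_nonneg_nonneg mult_left_mono simp del: mult_1_right)
    have "\<bar>b S - ?M * ratio E U S\<bar> \<le> ?M" using b r by linarith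
    then have "\<kappa> / (?N - ?M) * \<bar>b S - ?M * ratio E U S\<bar> \<le> \<kappa> / (?N - ?M) * ?M"
      using par(1) NM(2) by (intro mult_left_mono) auto
    moreover have "\<bar>y S\<bar> = \<kappa> / (?N - ?M) * \<bar>b S - ?M * ratio E U S\<bar>"
      unfolding y_def using par(1) NM(2) by (simp add: abs_mult)
    ultimately show ?thesis using \<eta>1 by linarith
  qed
  have \<eta>0: "0 \<le> \<eta>" using ybd[of "{}"] by linarith
  have "potential k V E \<kappa> (U - B) = (\<Sum>S\<in>?SS. w S * exp (y S))"
    unfolding potential_def yeq exp_add w_def ..
  also have "\<dots> \<le> (\<Sum>S\<in>?SS. w S * (1 + y S + \<eta>\<^sup>2))"
  proof (intro sum_mono mult_left_mono)
    fix S
    have "\<bar>y S\<bar> \<le> 1" using ybd[of S] par(3) by linarith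
    moreover have "(y S)\<^sup>2 \<le> \<eta>\<^sup>2" using ybd[of S] \<eta>0 by (simp add: abs_le_square_iff[symmetric])
    ultimately show "exp (y S) \<le> 1 + y S + \<eta>\<^sup>2" using exp_le_quadratic[of "y S"] by linarith
  qed (simp add: w_def)
  also have "\<dots> = (\<Sum>S\<in>?SS. w S) * (1 + \<eta>\<^sup>2) + (\<Sum>S\<in>?SS. w S * y S)"
    by (simp add: algebra_simps sum.distrib sum_distrib_left sum_distrib_right)
  also have "(\<Sum>S\<in>?SS. w S * y S) =
      \<kappa> / (?N - ?M) * ((\<Sum>S\<in>?SS. w S * b S) - ?M * (\<Sum>S\<in>?SS. w S * ratio E U S))"
    unfolding y_def sum_distrib_left sum_subtractf[symmetric] by (intro sum.cong refl) (simp add: algebra_simps)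
  also have "\<dots> \<le> \<kappa> / (?N - ?M) * (\<gamma> * ?M * (\<Sum>S\<in>?SS. w S * ratio E U S))"
    using lb par(1) NM(2) by (intro mult_left_mono) (auto simp: algebra_simps)
  also have "\<dots> = (\<kappa> / (?N - ?M) * ?M) * (\<gamma> * (\<Sum>S\<in>?SS. w S * ratio E U S))" by simp
  also have "\<dots> \<le> \<eta> * (\<gamma> * (\<Sum>S\<in>?SS. w S))"
  proof (rule mult_mono[OF \<eta>1 _ \<eta>0])
    show "\<gamma> * (\<Sum>S\<in>?SS. w S * ratio E U S) \<le> \<gamma> * (\<Sum>S\<in>?SS. w S)"
      using ratio_bounds[OF finU] par(4)
      by (intro mult_left_mono sum_mono) (auto simp: w_def)
    show "0 \<le> \<gamma> * (\<Sum>S\<in>?SS. w S * ratio E U S)"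
      using ratio_bounds[OF finU] par(4) by (intro mult_nonneg_nonneg sum_nonneg) (auto simp: w_def)
  qed
  finally show ?thesis unfolding potential_def w_def[symmetric] by (simp add: algebra_simps)
qed

text \<open>A crude bound for connecting vertices, over whose weights there is no control: a face
  loses at most \<open>card C\<close> neighbours, and a smaller denominator only raises its
  ratio.\<close>

lemma potential_remove:
  fixes \<kappa> :: real
  assumes "finite U" "C \<subseteq> U" "card (U - C) > 0" "0 \<le> \<kappa>"
  shows "potential k V E \<kappa> (U - C) \<le> potential k V E \<kappa> U * exp (\<kappa> * real (card C) / real (card U))"
  unfolding potential_def sum_distrib_right
proof (rule sum_mono)
  fix S
  have finC: "finite C" using assms finite_subset by metis
  have cU: "card (U - C) \<le> card U" using assms(1) by (intro card_mono) auto
  have "real (card (common E U {S})) - real (card C) \<le> real (card (common E (U - C) {S}))"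
    unfolding card_common_diff[OF assms(1,2)] using card_common_le[OF finC, of E "{S}"] by simp
  then have "(real (card (common E U {S})) - real (card C)) / real (card U)
      \<le> real (card (common E (U - C) {S})) / real (card U)" by (intro divide_right_mono) auto
  also have "\<dots> \<le> real (card (common E (U - C) {S})) / real (card (U - C))"
    using assms(3) cU by (intro divide_left_mono) auto
  finally have "ratio E U S - real (card C) / real (card U) \<le> ratio E (U - C) S"
    unfolding ratio_def by (simp add: diff_divide_distrib)
  then have "\<kappa> * (ratio E U S - real (card C) / real (card U)) \<le> \<kappa> * ratio E (U - C) S"
    using assms(4) by (rule mult_left_mono)
  then show "exp (- \<kappa> * ratio E (U - C) S) \<le> exp (- \<kappa> * ratio E U S) * exp (\<kappa> * real (card C) / real (card U))"
    unfolding exp_add[symmetric] by (simp add: algebra_simps)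
qed

section \<open>Passing between density and potential\<close>

lemma dense_of_potential:
  assumes "finite V" "\<kappa> > 0" "card U > 0"
    "potential k V E \<kappa> U \<le> exp (- \<kappa> * (1 - gap k + \<beta>))"
  shows "dense k V E \<beta> U"
  unfolding dense_def
proof (intro allI impI)
  fix S assume S: "S \<subseteq> V \<and> card S = k - 1"
  have "exp (- \<kappa> * ratio E U S) \<le> potential k V E \<kappa> U"
    unfolding potential_def using S assms(1)
    by (intro member_le_sum[of S "faces k V" "\<lambda>S. exp (- \<kappa> * ratio E U S)"]) auto
  then have "exp (- \<kappa> * ratio E U S) \<le> exp (- \<kappa> * (1 - gap k + \<beta>))" using assms(4) by linarith
  then have "\<kappa> * (1 - gap k + \<beta>) \<le> \<kappa> * ratio E U S" by simp
  then have "1 - gap k + \<beta> \<le> ratio E U S" using assms(2) by (simp only: mult_le_cancel_left_pos)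
  then show "(1 - gap k + \<beta>) * real (card U) \<le> real (card (common E U {S}))"
    unfolding ratio_def using assms(3) by (simp add: pos_le_divide_eq)
qed

lemma potential_of_dense:
  assumes "finite V" "0 \<le> \<kappa>" "card U > 0" "dense k V E \<beta> U"
  shows "potential k V E \<kappa> U \<le> real (card (faces k V)) * exp (- \<kappa> * (1 - gap k + \<beta>))"
  unfolding potential_def
proof (rule sum_bounded_above)
  fix S assume "S \<in> faces k V"
  then have "1 - gap k + \<beta> \<le> ratio E U S"
    using assms(3,4) unfolding dense_def ratio_def by (simp add: pos_le_divide_eq)
  then have "\<kappa> * (1 - gap k + \<beta>) \<le> \<kappa> * ratio E U S" using assms(2) by (rule mult_left_mono)
  then show "exp (- \<kappa> * ratio E U S) \<le> exp (- \<kappa> * (1 - gap k + \<beta>))" by simp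
qed

lemma card_subsets_le_exp:
  assumes "a > 0"
  shows "\<exists>N. \<forall>V :: 'a set. finite V \<longrightarrow> N \<le> card V \<longrightarrow> real (card {S. S \<subseteq> V \<and> card S = m}) \<le> exp (a * real (card V))"
proof -
  \<comment> \<open>\<open>Suc m\<close> instead of \<open>m\<close> admits \<open>m = 0\<close>;
    one more factor \<open>card V\<close> in the power does no harm.\<close>
  have a: "a / real (Suc m) > 0" using assms by simp
  obtain N where N: "\<And>n. N \<le> n \<Longrightarrow> 1 * real n < exp (a / real (Suc m) * real n)"
    using linear_less_exp[OF a] by blast
  show ?thesis
  proof (intro exI[of _ "Suc N"] allI impI)
    fix V :: "'a set" assume V: "finite V" "Suc N \<le> card V"
    let ?n = "card V"
    have "card {S. S \<subseteq> V \<and> card S = m} = ?n choose m" using n_subsets[OF V(1)] by simp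
    also have "\<dots> \<le> ?n ^ m"
      by (cases "m \<le> ?n") (auto simp: binomial_le_pow binomial_eq_0)
    finally have "real (card {S. S \<subseteq> V \<and> card S = m}) \<le> real ?n ^ m" by (metis of_nat_le_iff of_nat_power)
    also have "\<dots> \<le> real ?n ^ Suc m" using V(2) by (intro power_increasing) auto
    also have "\<dots> \<le> exp (a / real (Suc m) * real ?n) ^ Suc m"
      using N[of ?n] V(2) by (intro power_mono) auto
    also have "\<dots> = exp (a * real ?n)"
      unfolding exp_of_nat_mult[symmetric] by simp
    finally show "real (card {S. S \<subseteq> V \<and> card S = m}) \<le> exp (a * real ?n)" .
  qed
qed

text \<open>The growth of the exponent in one step is budgeted at
  \<open>\<mu> * \<beta> / 4 * M\<close>, proportional to the block length. It has three parts of
  size at most \<open>\<mu> * \<beta> * M / 12\<close>: the second-order term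
  \<open>\<eta>\<^sup>2\<close>, the imbalance \<open>\<gamma> * \<eta>\<close>, and the connector,
  which is cheap because \<open>M\<close> is much larger than \<open>L\<close>. The connector is
  chosen after the block, in what the block leaves of \<open>U\<close>.\<close>

lemma cover_step:
  fixes \<beta> \<epsilon> :: real
  assumes k: "k \<ge> 2" and \<beta>: "0 < \<beta>" "\<beta> \<le> gap k" and \<epsilon>: "0 < \<epsilon>" "\<epsilon> \<le> 1"
    and T: "T \<ge> 1" and M: "M = Suc k * T" and L: "L = length (conn_mid k)"
    and \<gamma>: "\<gamma> = \<epsilon> * \<beta> / 24" and LM: "24 * real L \<le> \<epsilon> * \<beta> * real M"
    and \<mu>: "\<mu> = \<epsilon>\<^sup>2 * \<beta> / (48 * real M)"
  shows "\<exists>N0. \<forall>(V :: 'a set) E U e. finite V \<longrightarrow> N0 \<le> card V \<longrightarrow> U \<subseteq> V \<longrightarrow> \<epsilon> * real (card V) \<le> real (card U) \<longrightarrow>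
     dense k V E (\<beta> / 2) U \<longrightarrow> set e \<subseteq> V - U \<longrightarrow> length e = k \<longrightarrow> distinct e \<longrightarrow> chain k E e \<longrightarrow>
     (\<exists>C B. length C = L \<and> length B = M \<and> set C \<union> set B \<subseteq> U \<and> distinct (C @ B) \<and> chain k E (e @ C @ B) \<and>
        potential k V E (\<mu> * real (card V)) (U - set (C @ B))
          \<le> potential k V E (\<mu> * real (card V)) U * exp (\<mu> * \<beta> / 4 * real M))"
proof -
  have M1: "real M \<ge> 1" "k \<le> M" using T M by (cases T; simp)+
  have \<mu>0: "\<mu> > 0" unfolding \<mu> using \<epsilon> \<beta> M1 by simp
  have \<gamma>0: "\<gamma> > 0" unfolding \<gamma> using \<epsilon> \<beta> by simp
  have \<beta>2: "0 < \<beta> / 2" "\<beta> / 2 \<le> gap k" and \<beta>4: "0 < \<beta> / 4" "\<beta> / 4 \<le> gap k"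
    using \<beta> by auto
  have "gap k \<le> 1" using k by simp
  then have \<beta>1: "\<beta> \<le> 1" using \<beta> by linarith
  define \<eta> where "\<eta> = \<epsilon> * \<beta> / 24"
  have \<eta>: "0 < \<eta>" "\<eta> \<le> 1" unfolding \<eta>_def using \<epsilon> \<beta> \<beta>1 mult_mono[of \<epsilon> 1 \<beta> 1] by auto
  \<comment> \<open>As \<open>\<kappa> / card U\<close> is at most
    \<open>\<mu> / \<epsilon>\<close>, the left side bounds how far a block moves an exponent;
    \<open>\<mu>\<close> is chosen to make it \<open>\<epsilon> * \<beta> / 24\<close>.\<close>
  have \<eta>M: "2 * \<mu> * real M / \<epsilon> = \<eta>" unfolding \<mu> \<eta>_def using \<epsilon> M1 by (simp add: field_simps power2_eq_square)
  from light_block[OF k \<beta>2 \<gamma>0, of T, where 'a = 'a] obtain N1 where N1: "\<forall>(V :: 'a set) E U (c :: 'a \<Rightarrow> real). finite V \<longrightarrow> U \<subseteq> V \<longrightarrow> N1 \<le> card U \<longrightarrow> dense k V E (\<beta> / 2) U \<longrightarrow>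
     (\<forall>v\<in>U. 0 \<le> c v) \<longrightarrow>
     (\<exists>B. set B \<subseteq> U \<and> distinct B \<and> chain k E B \<and> length B = Suc k * T \<and>
        real (card U) * (\<Sum>v\<in>set B. c v) \<le> (1 + \<gamma>) * real (length B) * (\<Sum>v\<in>U. c v))" ..
  note N1 = N1[rule_format (no_asm)]
  from connect[OF k \<beta>4, where 'a = 'a] obtain N2 where N2: "\<forall>(V :: 'a set) E U a b. finite V \<longrightarrow> U \<subseteq> V \<longrightarrow> N2 \<le> card U \<longrightarrow> dense k V E (\<beta> / 4) U \<longrightarrow>
     set a \<subseteq> V \<longrightarrow> set b \<subseteq> V \<longrightarrow> length a = k \<longrightarrow> length b = k \<longrightarrow> distinct (a @ b) \<longrightarrow>
     chain k E a \<longrightarrow> chain k E b \<longrightarrow>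
     (\<exists>c. joins k E U a b c)" ..
  note N2 = N2[rule_format (no_asm)]
  define N0 where "N0 = nat \<lceil>(real N1 + 2 * real N2 + 8 * real M / \<beta> + 2 * real L) / \<epsilon>\<rceil> + 1"
  show ?thesis
  proof (intro exI[of _ N0] allI impI)
    fix V :: "'a set" and E U e
    assume V: "finite V" "N0 \<le> card V" and U: "U \<subseteq> V" "\<epsilon> * real (card V) \<le> real (card U)"
      and d: "dense k V E (\<beta> / 2) U" and e: "set e \<subseteq> V - U" "length e = k" "distinct e" "chain k E e"
    let ?n = "real (card V)" and ?N = "real (card U)"
    define \<kappa> where "\<kappa> = \<mu> * ?n"
    have finU: "finite U" using V U finite_subset by auto
    have "(real N1 + 2 * real N2 + 8 * real M / \<beta> + 2 * real L) / \<epsilon> \<le> ?n"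
      using V(2) unfolding N0_def by linarith
    then have "real N1 + 2 * real N2 + 8 * real M / \<beta> + 2 * real L \<le> \<epsilon> * ?n"
      using \<epsilon> by (simp add: field_simps)
    then have big: "real N1 + 2 * real N2 + 8 * real M / \<beta> + 2 * real L \<le> ?N" using U(2) by linarith
    have "\<beta> * real M \<le> 1 * real M" using \<beta>1 by (intro mult_right_mono) auto
    then have M\<beta>: "8 * real M \<le> 8 * real M / \<beta>" using \<beta> by (simp add: field_simps)
    have sz: "N1 \<le> card U" "2 * real N2 \<le> ?N" "8 * real M \<le> ?N" "8 * real M / \<beta> \<le> ?N" "8 * real M + 2 * real L \<le> ?N"
      using big M\<beta> by linarith+
    have M\<beta>N: "real M \<le> \<beta> / 4 * ?N" using sz(4) \<beta> by (simp add: field_simps)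
    have Vpos: "?n > 0" using V(2) unfolding N0_def by simp
    have \<kappa>0: "0 < \<kappa>" unfolding \<kappa>_def using \<mu>0 Vpos by simp
    define c where "c v = (\<Sum>S\<in>faces k V. if insert v S \<in> E then exp (- \<kappa> * ratio E U S) else 0)" for v
    have "\<forall>v\<in>U. 0 \<le> c v" unfolding c_def by (intro ballI sum_nonneg) auto
    from N1[OF V(1) U(1) sz(1) d this] obtain B where B: "set B \<subseteq> U" "distinct B" "chain k E B" "length B = M"
      and light: "?N * (\<Sum>v\<in>set B. c v) \<le> (1 + \<gamma>) * real (length B) * (\<Sum>v\<in>U. c v)" unfolding M by blast
    have cB: "card (set B) = M" using distinct_card[OF B(2)] B(4) by simp
    have M2: "2 * card (set B) \<le> card U" using sz(3) unfolding cB by linarith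
    have ratio\<kappa>: "\<kappa> / ?N \<le> \<mu> / \<epsilon>"
    proof -
      have "\<mu> * (\<epsilon> * ?n) \<le> \<mu> * ?N" using U(2) \<mu>0 by (intro mult_left_mono) auto
      then show ?thesis unfolding \<kappa>_def using \<epsilon> sz(3) M1 by (simp add: field_simps)
    qed
    have par: "\<kappa> * (2 * real (card (set B)) / ?N) \<le> \<eta>"
    proof -
      have "\<kappa> * (2 * real (card (set B)) / ?N) = \<kappa> / ?N * (2 * real M)" unfolding cB by simp
      also have "\<dots> \<le> \<mu> / \<epsilon> * (2 * real M)" using ratio\<kappa> by (intro mult_right_mono) auto
      also have "\<dots> = \<eta>" using \<eta>M by (simp add: mult_ac)
      finally show ?thesis .
    qed
    have Upos: "card U > 0" using sz(3) M1 by linarith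
    let ?U1 = "U - set B"
    have p1: "potential k V E \<kappa> ?U1 \<le> potential k V E \<kappa> U * (1 + \<eta>\<^sup>2 + \<gamma> * \<eta>)"
      by (rule potential_block[OF V(1) U(1) B(1) M2 Upos less_imp_le[OF \<kappa>0] par \<eta>(2) less_imp_le[OF \<gamma>0]])
        (use light cB B(4) in \<open>simp add: c_def\<close>)
    have cU1: "real (card ?U1) = ?N - real M"
      using card_Diff_subset[OF _ B(1)] card_mono[OF finU B(1)] cB by simp
    have half: "?N / 2 \<le> real (card ?U1)" unfolding cU1 using sz(3) by linarith
    have UU1: "U - ?U1 = set B" using B(1) by auto
    have "dense k V E (\<beta> / 2 - \<beta> / 4) ?U1"
      by (rule dense_subset[OF d finU]) (use UU1 cB M\<beta>N \<beta> k in auto)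
    then have d1: "dense k V E (\<beta> / 4) ?U1" by simp
    have N2U: "N2 \<le> card ?U1" using half sz(2) by linarith
    have sub: "set (take k B) \<subseteq> set B" by (rule set_take_subset)
    have "\<exists>C. length C = length (conn_mid k) \<and> distinct (e @ C @ take k B) \<and> set C \<subseteq> ?U1 \<and> chain k E (e @ C @ take k B)"
    proof (rule N2[OF V(1) _ N2U d1])
      show "?U1 \<subseteq> V" "set e \<subseteq> V" "set (take k B) \<subseteq> V" using U(1) e(1) B(1) sub by blast+
      show "length (take k B) = k" using M1 B(4) by simp
      have "set e \<inter> set (take k B) = {}" using sub B(1) e(1) by blast
      then show "distinct (e @ take k B)" using e(3) B(2) by simp
      show "chain k E (take k B)" using B(3) by (metis append_take_drop_id chain_appendD1)
    qed (use e in auto)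
    then obtain C where C: "length C = L" "distinct (e @ C @ take k B)" "set C \<subseteq> ?U1" "chain k E (e @ C @ take k B)"
      unfolding L by blast
    have chB: "chain k E (take k B @ drop k B)" using B(3) by simp
    have ch: "chain k E (e @ C @ B)"
      using chain_glue[of k E "e @ C" "take k B" "drop k B"] C(4) chB M1 B(4) by simp
    have dCB: "distinct (C @ B)" using C(2,3) B(2) by auto
    have cC: "card (set C) = L" using C(1,2) distinct_card[of C] by simp
    have cC1: "card (?U1 - set C) > 0"
    proof -
      have "real (card (?U1 - set C)) = ?N - real M - real L"
        using card_Diff_subset[OF _ C(3)] card_mono[OF _ C(3)] cC cU1 finU by simp
      moreover have "0 < ?N - real M - real L" using sz(5) M1 by linarith
      ultimately show ?thesis by simp
    qed
    have "potential k V E \<kappa> (?U1 - set C) \<le> potential k V E \<kappa> ?U1 * exp (\<kappa> * real (card (set C)) / real (card ?U1))"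
      by (rule potential_remove[OF _ C(3) cC1]) (use finU \<kappa>0 in auto)
    also have "\<dots> \<le> (potential k V E \<kappa> U * (1 + \<eta>\<^sup>2 + \<gamma> * \<eta>)) * exp (2 * \<mu> * real L / \<epsilon>)"
    proof (intro mult_mono[OF p1])
      have "\<kappa> * real (card (set C)) / real (card ?U1) \<le> \<kappa> * real L / (?N / 2)"
        unfolding cC using half \<kappa>0 sz(3) M1 by (intro divide_left_mono) auto
      also have "\<dots> = \<kappa> / ?N * (2 * real L)" by simp
      also have "\<dots> \<le> \<mu> / \<epsilon> * (2 * real L)" using ratio\<kappa> by (intro mult_right_mono) auto
      finally show "exp (\<kappa> * real (card (set C)) / real (card ?U1)) \<le> exp (2 * \<mu> * real L / \<epsilon>)" by (simp add: mult_ac)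
      show "0 \<le> potential k V E \<kappa> U * (1 + \<eta>\<^sup>2 + \<gamma> * \<eta>)"
        unfolding potential_def using \<eta> \<gamma>0 by (intro mult_nonneg_nonneg sum_nonneg) auto
    qed simp
    also have "\<dots> \<le> (potential k V E \<kappa> U * exp (\<eta>\<^sup>2 + \<gamma> * \<eta>)) * exp (2 * \<mu> * real L / \<epsilon>)"
    proof (intro mult_right_mono mult_left_mono)
      show "1 + \<eta>\<^sup>2 + \<gamma> * \<eta> \<le> exp (\<eta>\<^sup>2 + \<gamma> * \<eta>)" 
        using exp_ge_add_one_self[of "\<eta>\<^sup>2 + \<gamma> * \<eta>"] by linarith
      show "0 \<le> potential k V E \<kappa> U" unfolding potential_def by (intro sum_nonneg) auto
    qed simp
    also have "\<dots> = potential k V E \<kappa> U * exp (\<eta>\<^sup>2 + \<gamma> * \<eta> + 2 * \<mu> * real L / \<epsilon>)"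
      by (simp add: exp_add)
    also have "\<dots> \<le> potential k V E \<kappa> U * exp (\<mu> * \<beta> / 4 * real M)"
    proof (intro mult_left_mono)
      have "\<eta>\<^sup>2 = \<mu> * \<beta> * real M / 12"
      proof -
        have "\<eta>\<^sup>2 = (2 * \<mu> * real M / \<epsilon>) * \<eta>" using \<eta>M by (simp add: power2_eq_square)
        then show ?thesis unfolding \<eta>_def using \<epsilon> by (simp add: field_simps)
      qed
      moreover have "\<gamma> * \<eta> = \<mu> * \<beta> * real M / 12"
      proof -
        have "\<gamma> * \<eta> = (2 * \<mu> * real M / \<epsilon>) * \<gamma>" using \<eta>M by simp
        then show ?thesis unfolding \<gamma> using \<epsilon> by (simp add: field_simps)
      qed
      moreover have "2 * \<mu> * real L / \<epsilon> \<le> \<mu> * \<beta> * real M / 12"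
      proof -
        have "\<mu> * (24 * real L) \<le> \<mu> * (\<epsilon> * \<beta> * real M)" using LM \<mu>0 by (intro mult_left_mono) auto
        then show ?thesis using \<epsilon> by (simp add: field_simps)
      qed
      moreover have "\<mu> * \<beta> / 4 * real M = 3 * (\<mu> * \<beta> * real M / 12)" by simp
      ultimately show "exp (\<eta>\<^sup>2 + \<gamma> * \<eta> + 2 * \<mu> * real L / \<epsilon>) \<le> exp (\<mu> * \<beta> / 4 * real M)"
        unfolding exp_le_cancel_iff by linarith
      show "0 \<le> potential k V E \<kappa> U" unfolding potential_def by (intro sum_nonneg) auto
    qed
    finally have p2: "potential k V E \<kappa> (?U1 - set C) \<le> potential k V E \<kappa> U * exp (\<mu> * \<beta> / 4 * real M)" .
    have "?U1 - set C = U - set (C @ B)" by auto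
    then show "\<exists>C B. length C = L \<and> length B = M \<and> set C \<union> set B \<subseteq> U \<and> distinct (C @ B) \<and> chain k E (e @ C @ B) \<and>
        potential k V E (\<mu> * ?n) (U - set (C @ B)) \<le> potential k V E (\<mu> * ?n) U * exp (\<mu> * \<beta> / 4 * real M)"
      using p2 C(1,3) B(1,4) dCB ch unfolding \<kappa>_def by (intro exI[of _ C] exI[of _ B]) auto
  qed
qed

text \<open>The errors of all steps together are charged to the length of \<open>Q\<close> and cost
  at most \<open>\<mu> * \<beta> / 4 * card V\<close> in the exponent; the number of faces costs as
  much again. This is half of the slack \<open>\<kappa> * \<beta>\<close>, so density
  \<open>\<beta> / 2\<close> persists to the end. The lower bound on the remainder leaves room for
  one more connection.\<close>

lemma cover:
  fixes \<beta> \<epsilon> :: real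
  assumes k: "k \<ge> 2" and \<beta>: "0 < \<beta>" "\<beta> \<le> gap k" and \<epsilon>: "0 < \<epsilon>" "\<epsilon> \<le> 1"
  shows "\<exists>N0. \<forall>(V :: 'a set) E U0 a. finite V \<longrightarrow> N0 \<le> card V \<longrightarrow> U0 \<subseteq> V \<longrightarrow> \<epsilon> * real (card V) \<le> real (card U0) \<longrightarrow>
     dense k V E \<beta> U0 \<longrightarrow> set a \<subseteq> V - U0 \<longrightarrow> length a = k \<longrightarrow> distinct a \<longrightarrow> chain k E a \<longrightarrow>
     (\<exists>Q. set Q \<subseteq> U0 \<and> distinct Q \<and> chain k E (a @ Q) \<and> real (card (U0 - set Q)) \<le> \<epsilon> * real (card V) \<and>
        \<epsilon> / 2 * real (card V) \<le> real (card (U0 - set Q)) \<and> dense k V E (\<beta> / 2) (U0 - set Q))"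
proof -
  define L where "L = length (conn_mid k)"
  define T where "T = nat \<lceil>24 * real L / (\<epsilon> * \<beta>)\<rceil> + 1"
  define M where "M = Suc k * T"
  define \<gamma> where "\<gamma> = \<epsilon> * \<beta> / 24"
  define \<mu> where "\<mu> = \<epsilon>\<^sup>2 * \<beta> / (48 * real M)"
  have T1: "T \<ge> 1" unfolding T_def by simp
  have TM: "T \<le> M" unfolding M_def by simp
  have LM: "24 * real L \<le> \<epsilon> * \<beta> * real M"
  proof -
    have "24 * real L / (\<epsilon> * \<beta>) \<le> real T" unfolding T_def by linarith
    also have "\<dots> \<le> real M" using TM by simp
    finally show ?thesis using \<epsilon> \<beta> by (simp add: field_simps)
  qed
  have M1: "real M \<ge> 1" using T1 TM by linarith
  have \<mu>0: "\<mu> > 0" unfolding \<mu>_def using \<epsilon> \<beta> M1 by simp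
  from cover_step[OF k \<beta> \<epsilon> T1 M_def L_def \<gamma>_def LM \<mu>_def, where 'a = 'a] obtain N1 where N1: "\<forall>(V :: 'a set) E U e. finite V \<longrightarrow> N1 \<le> card V \<longrightarrow> U \<subseteq> V \<longrightarrow> \<epsilon> * real (card V) \<le> real (card U) \<longrightarrow>
     dense k V E (\<beta> / 2) U \<longrightarrow> set e \<subseteq> V - U \<longrightarrow> length e = k \<longrightarrow> distinct e \<longrightarrow> chain k E e \<longrightarrow>
     (\<exists>C B. length C = L \<and> length B = M \<and> set C \<union> set B \<subseteq> U \<and> distinct (C @ B) \<and> chain k E (e @ C @ B) \<and>
        potential k V E (\<mu> * real (card V)) (U - set (C @ B))
          \<le> potential k V E (\<mu> * real (card V)) U * exp (\<mu> * \<beta> / 4 * real M))" ..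
  note N1 = N1[rule_format (no_asm)]
  have "\<mu> * \<beta> / 4 > 0" using \<mu>0 \<beta> by simp
  from card_subsets_le_exp[OF this, of "k - 1", where 'a = 'a] obtain N2 where N2: "\<forall>V :: 'a set. finite V \<longrightarrow> N2 \<le> card V \<longrightarrow>
      real (card (faces k V)) \<le> exp (\<mu> * \<beta> / 4 * real (card V))" ..
  note N2 = N2[rule_format (no_asm)]
  define N0 where "N0 = N1 + N2 + nat \<lceil>2 * (real M + real L) / \<epsilon>\<rceil> + 1"
  show ?thesis
  proof (intro exI[of _ N0] allI impI)
    fix V :: "'a set" and E U0 a
    assume V: "finite V" "N0 \<le> card V" and U0: "U0 \<subseteq> V" "\<epsilon> * real (card V) \<le> real (card U0)"
      and d: "dense k V E \<beta> U0" and a: "set a \<subseteq> V - U0" "length a = k" "distinct a" "chain k E a"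
    let ?n = "real (card V)"
    define \<kappa> where "\<kappa> = \<mu> * ?n"
    have N: "N1 \<le> card V" "N2 \<le> card V" "2 * (real M + real L) / \<epsilon> \<le> ?n" "?n > 0"
      using V(2) unfolding N0_def by linarith+
    \<comment> \<open>A step that starts above \<open>\<epsilon> * ?n\<close> cannot fall below
      \<open>\<epsilon> / 2 * ?n\<close>.\<close>
    have step_size: "real M + real L \<le> \<epsilon> / 2 * ?n" using N(3) \<epsilon> by (simp add: field_simps)
    have \<kappa>0: "\<kappa> > 0" unfolding \<kappa>_def using \<mu>0 N by simp
    have finU0: "finite U0" using U0 V finite_subset by auto
    \<comment> \<open>The first factor bounds the number of faces, the second one the term of a
      single face at the start.\<close>
    define \<Phi>0 where "\<Phi>0 = exp (\<mu> * \<beta> / 4 * ?n) * exp (- \<kappa> * (1 - gap k + \<beta>))"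
    define inv where "inv Q \<longleftrightarrow> set Q \<subseteq> U0 \<and> distinct Q \<and> chain k E (a @ Q) \<and>
      \<epsilon> / 2 * ?n \<le> real (card (U0 - set Q)) \<and>
      potential k V E \<kappa> (U0 - set Q) \<le> \<Phi>0 * exp (\<mu> * \<beta> / 4 * real (length Q))" for Q
    have inv_dense: "dense k V E (\<beta> / 2) (U0 - set Q)" if "inv Q" for Q
    proof (rule dense_of_potential[OF V(1) \<kappa>0])
      have "0 < \<epsilon> / 2 * ?n" using \<epsilon> N by simp
      then show "card (U0 - set Q) > 0" using that unfolding inv_def by (metis less_le_trans of_nat_0_less_iff)
      have "length Q = card (set Q)" using that distinct_card unfolding inv_def by metis
      also have "\<dots> \<le> card V" using that U0(1) V(1) unfolding inv_def by (intro card_mono) auto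
      finally have "\<mu> * \<beta> / 4 * real (length Q) \<le> \<mu> * \<beta> / 4 * ?n" using \<mu>0 \<beta> by (intro mult_left_mono) auto
      then have "\<Phi>0 * exp (\<mu> * \<beta> / 4 * real (length Q)) \<le> \<Phi>0 * exp (\<mu> * \<beta> / 4 * ?n)"
        unfolding \<Phi>0_def by (intro mult_left_mono) auto
      also have "\<dots> = exp (- \<kappa> * (1 - gap k + \<beta> / 2))"
        unfolding \<Phi>0_def exp_add[symmetric] \<kappa>_def by (simp add: algebra_simps)
      finally show "potential k V E \<kappa> (U0 - set Q) \<le> exp (- \<kappa> * (1 - gap k + \<beta> / 2))"
        using that unfolding inv_def by linarith
    qed
    have inv0: "inv []"
    proof -
      have "\<epsilon> / 2 * ?n \<le> \<epsilon> * ?n" using \<epsilon> N(4) by (intro mult_right_mono) auto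
      then have c: "\<epsilon> / 2 * ?n \<le> real (card U0)" using U0(2) by linarith
      have "0 < \<epsilon> / 2 * ?n" using \<epsilon> N by simp
      then have "card U0 > 0" using c by (metis less_le_trans of_nat_0_less_iff)
      from potential_of_dense[OF V(1) less_imp_le[OF \<kappa>0] this d]
      have "potential k V E \<kappa> U0 \<le> \<Phi>0"
        unfolding \<Phi>0_def by (rule order_trans) (intro mult_right_mono N2[OF V(1) N(2)], simp)
      then show ?thesis unfolding inv_def using a c by simp
    qed
    have step: "\<exists>Q'. inv Q' \<and> card (U0 - set Q') < card (U0 - set Q)"
      if Q: "inv Q" "\<epsilon> * ?n < real (card (U0 - set Q))" for Q
    proof -
      let ?U = "U0 - set Q"
      \<comment> \<open>The path is continued from the last \<open>k\<close> vertices of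
        \<open>a @ Q\<close>, so \<open>a\<close> itself serves as the end while \<open>Q\<close> is
        empty.\<close>
      define P where "P = a @ Q"
      have P: "length P \<ge> k" "chain k E P" "distinct P" "set P \<subseteq> V - ?U"
        using Q(1) a U0(1) unfolding P_def inv_def by auto
      define p where "p = take (length P - k) P"
      define e where "e = drop (length P - k) P"
      have pe: "P = p @ e" unfolding p_def e_def by simp
      have e: "length e = k" "chain k E e" "distinct e" "set e \<subseteq> V - ?U"
      proof -
        show "length e = k" unfolding e_def using P(1) by simp
        show "chain k E e" using P(2) unfolding pe by (rule chain_appendD2)
        show "distinct e" "set e \<subseteq> V - ?U" using P(3,4) unfolding pe by auto
      qed
      have "?U \<subseteq> V" using U0(1) by auto
      from N1[OF V(1) N(1) this less_imp_le[OF Q(2)] inv_dense[OF Q(1)] e(4,1,3,2)]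
      obtain C B where CB: "length C = L" "length B = M" "set C \<union> set B \<subseteq> ?U" "distinct (C @ B)" "chain k E (e @ C @ B)"
        and pot: "potential k V E \<kappa> (?U - set (C @ B)) \<le> potential k V E \<kappa> ?U * exp (\<mu> * \<beta> / 4 * real M)"
        unfolding \<kappa>_def by blast
      define Q' where "Q' = Q @ C @ B"
      have eq: "U0 - set Q' = ?U - set (C @ B)" unfolding Q'_def by auto
      have sub: "set (C @ B) \<subseteq> ?U" using CB(3) by simp
      have cCB: "card (set (C @ B)) = M + L" using distinct_card[OF CB(4)] CB(1,2) by simp
      have cle: "card (set (C @ B)) \<le> card ?U" using sub finU0 by (intro card_mono) auto
      have cnew: "card (U0 - set Q') = card ?U - (M + L)"
        unfolding eq using card_Diff_subset[OF _ sub] cCB by simp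
      have ch: "chain k E (a @ Q')"
        using chain_glue[of k E p e "C @ B"] P(2) CB(5) e(1) unfolding pe Q'_def
        by (metis P_def append_assoc order_refl pe)
      have pot': "potential k V E \<kappa> (U0 - set Q') \<le> \<Phi>0 * exp (\<mu> * \<beta> / 4 * real (length Q'))"
      proof -
        have "potential k V E \<kappa> (U0 - set Q') \<le> (\<Phi>0 * exp (\<mu> * \<beta> / 4 * real (length Q))) * exp (\<mu> * \<beta> / 4 * real M)"
          unfolding eq using pot Q(1) unfolding inv_def
          by (meson exp_ge_zero mult_right_mono order_trans)
        also have "\<dots> = \<Phi>0 * exp (\<mu> * \<beta> / 4 * (real (length Q) + real M))"
          by (simp add: exp_add distrib_left)
        \<comment> \<open>The connector increases \<open>length Q'\<close> too, although the step is
          charged only for the block.\<close>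
        also have "\<dots> \<le> \<Phi>0 * exp (\<mu> * \<beta> / 4 * real (length Q'))"
          unfolding \<Phi>0_def Q'_def using CB(2) \<mu>0 \<beta> by (intro mult_left_mono iffD2[OF exp_le_cancel_iff]) auto
        finally show ?thesis .
      qed
      have "inv Q'" unfolding inv_def
      proof (intro conjI ch pot')
        show "set Q' \<subseteq> U0" "distinct Q'" using Q(1) CB(3,4) unfolding inv_def Q'_def by auto
        have "real (card (U0 - set Q')) = real (card ?U) - (real M + real L)"
          unfolding cnew using cle cCB by (simp add: of_nat_diff)
        then show "\<epsilon> / 2 * ?n \<le> real (card (U0 - set Q'))" using Q(2) step_size by linarith
      qed
      moreover have "card (U0 - set Q') < card ?U" unfolding cnew using cle cCB M1 by linarith
      ultimately show ?thesis by blast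
    qed
    have "\<exists>Q. inv Q \<and> real (card (U0 - set Q)) \<le> \<epsilon> * ?n" if "inv Q" for Q
      using that
    proof (induction "card (U0 - set Q)" arbitrary: Q rule: less_induct)
      case less
      show ?case
      proof (cases "real (card (U0 - set Q)) \<le> \<epsilon> * ?n")
        case False
        then obtain Q' where "inv Q'" "card (U0 - set Q') < card (U0 - set Q)"
          using step[OF less.prems] by auto
        then show ?thesis using less.hyps by blast
      qed (use less.prems in blast)
    qed
    from this[OF inv0] obtain Q where Q: "inv Q" "real (card (U0 - set Q)) \<le> \<epsilon> * ?n" by blast
    then show "\<exists>Q. set Q \<subseteq> U0 \<and> distinct Q \<and> chain k E (a @ Q) \<and> real (card (U0 - set Q)) \<le> \<epsilon> * ?n \<and>
        \<epsilon> / 2 * ?n \<le> real (card (U0 - set Q)) \<and> dense k V E (\<beta> / 2) (U0 - set Q)"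
      using inv_dense[OF Q(1)] unfolding inv_def by (intro exI[of _ Q]) simp
  qed
qed

section \<open>The square of a tight Hamilton cycle\<close>

text \<open>An edge containing \<open>S\<close> is \<open>S\<close> with one further vertex, so at
  most as many edges contain \<open>S\<close> as there are vertices completing it.\<close>

lemma dense_of_min_codegree:
  assumes G: "k_graph k V E" "k \<ge> 2" "k \<le> card V"
    and deg: "(1 - gap k + \<beta>) * real (card V) \<le> real (min_codegree k V E)"
  shows "dense k V E \<beta> V"
  unfolding dense_def
proof (intro allI impI)
  fix S assume S: "S \<subseteq> V \<and> card S = k - 1"
  have fin: "finite V" and edge: "e \<subseteq> V \<and> card e = k" if "e \<in> E" for e
    using G(1) that unfolding k_graph_def by auto
  have finV: "finite V" using G(1) unfolding k_graph_def by simp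
  have "{e \<in> E. S \<subseteq> e} \<subseteq> (\<lambda>v. insert v S) ` common E V {S}"
  proof
    fix e assume "e \<in> {e \<in> E. S \<subseteq> e}"
    then have e: "e \<in> E" "S \<subseteq> e" by auto
    have finS: "finite S" using S finV by (auto intro: finite_subset)
    have "card (e - S) = 1" using card_Diff_subset[OF finS e(2)] edge[OF e(1)] S G(2) by simp
    then obtain v where "e - S = {v}" by (auto simp: card_1_singleton_iff)
    then have "e = insert v S" "v \<in> V" using e edge[OF e(1)] by auto
    then show "e \<in> (\<lambda>v. insert v S) ` common E V {S}" using e(1) unfolding common_def by auto
  qed
  then have "card {e \<in> E. S \<subseteq> e} \<le> card ((\<lambda>v. insert v S) ` common E V {S})"
    using finite_common[OF finV] by (intro card_mono) auto
  also have "\<dots> \<le> card (common E V {S})" by (rule card_image_le[OF finite_common[OF finV]])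
  finally have "card {e \<in> E. S \<subseteq> e} \<le> card (common E V {S})" .
  moreover have "min_codegree k V E \<le> card {e \<in> E. S \<subseteq> e}"
    using le_min_codegree_iff[OF G(1), of "min_codegree k V E"] G(3) S by simp
  ultimately have "real (min_codegree k V E) \<le> real (card (common E V {S}))" by linarith
  then show "(1 - gap k + \<beta>) * real (card V) \<le> real (card (common E V {S}))"
    using deg by linarith
qed

text \<open>Appending the first \<open>k\<close> vertices unrolls the cycle: a window of
  \<open>k + 1\<close> positions that starts inside \<open>Z\<close> ends inside
  \<open>Z @ take k Z\<close>.\<close>

lemma contains_copy_of_chain:
  assumes Z: "distinct Z" "set Z = V" "k \<le> length Z" "chain k E (Z @ take k Z)"
  shows "contains_copy V E {..<length Z} (cycle_power_edges 2 k (length Z))"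
  unfolding contains_copy_def
proof (intro exI[of _ "(!) Z"] conjI ballI)
  show "inj_on ((!) Z) {..<length Z}" using inj_on_nth[OF Z(1)] by simp
  show "(!) Z ` {..<length Z} \<subseteq> V" using Z(2) by auto
  fix e assume "e \<in> cycle_power_edges 2 k (length Z)"
  then obtain i where e: "card e = k" "i < length Z" "e \<subseteq> (\<lambda>t. (i + t) mod length Z) ` {..<k + 2 - 1}"
    unfolding cycle_power_edges_def by auto
  let ?f = "\<lambda>t. (i + t) mod length Z"
  \<comment> \<open>The offsets are chosen so that reduction modulo \<open>length Z\<close> is
    injective on them; for \<open>length Z = k\<close> the first and last offset of a window
    coincide modulo \<open>length Z\<close>.\<close>
  from e(3) obtain J where J: "J \<subseteq> {..<k + 2 - 1}" "inj_on ?f J" "e = ?f ` J"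
    unfolding subset_image_inj by auto
  define I where "I = (+) i ` J"
  have cI: "card I = k" using e(1) J(2,3) unfolding I_def by (simp add: card_image)
  have nth: "(Z @ take k Z) ! (i + t) = Z ! ((i + t) mod length Z)" if "t \<in> J" for t
  proof (cases "i + t < length Z")
    case False
    moreover have "t \<le> k" using that J(1) by auto
    ultimately have "(i + t) mod length Z = i + t - length Z" "i + t - length Z < k"
      using e(2) Z(3) by (auto simp: mod_if)
    then show ?thesis using False by (simp add: nth_append)
  qed (simp add: nth_append)
  have "(!) (Z @ take k Z) ` I \<in> E"
  proof (rule chainD[OF Z(4) _ _ cI])
    show "I \<subseteq> {i..i + k}" unfolding I_def using J(1) by auto
    show "I \<subseteq> {..<length (Z @ take k Z)}" unfolding I_def using J(1) e(2) Z(3) by force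
  qed
  moreover have "(!) (Z @ take k Z) ` I = (!) Z ` e"
    unfolding I_def J(3) image_image using nth by (rule image_cong[OF refl])
  ultimately show "(!) Z ` e \<in> E" by simp
qed

text \<open>The vertices to be absorbed are those used neither by the cover nor by the closing
  connector, so they are known only once the cycle through \<open>A\<close> is closed. Their number
  is at most \<open>\<epsilon> * card V\<close>, within the capacity of \<open>A\<close>.\<close>

theorem corollary1p2:
  fixes k :: nat and \<alpha> :: real
  assumes "k \<ge> 2" and "\<alpha> > 0"
  shows "\<exists>n\<^sub>0::nat. \<forall>n\<ge>n\<^sub>0. \<forall>(V :: 'a set) E.
    k_graph k V E \<and> card V = n \<and>
    real (min_codegree k V E) \<ge> (1 - 1 / (2 * real k - 1) + \<alpha>) * real n \<longrightarrow>
    contains_copy V E {..<n} (cycle_power_edges 2 k n)"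
proof -
  note k = assms(1)
  define \<beta> where "\<beta> = min \<alpha> (gap k)"
  have \<beta>: "0 < \<beta>" "\<beta> \<le> gap k" "\<beta> \<le> \<alpha>"
    unfolding \<beta>_def using assms by auto
  have \<beta>2: "0 < \<beta> / 2" "\<beta> / 2 \<le> gap k" and \<beta>4: "0 < \<beta> / 4" "\<beta> / 4 \<le> gap k"
    using \<beta> by auto
  have "gap k \<le> 1" using k by simp
  then have \<beta>1: "\<beta> \<le> 1" using \<beta> by linarith
  from absorbing_path[OF k \<beta>(1,2), where 'a = 'a] obtain \<rho> N1 where \<rho>: "\<rho> > 0" and N1: "\<forall>(V :: 'a set) E. finite V \<longrightarrow> N1 \<le> card V \<longrightarrow> dense k V E \<beta> V \<longrightarrow>
    (\<exists>A. set A \<subseteq> V \<and> distinct A \<and> chain k E A \<and> 2 * k \<le> length A \<and> real (length A) \<le> \<beta> / 2 * real (card V) \<and>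
      (\<forall>W R. W \<subseteq> V - set A \<and> real (card W) \<le> \<rho> * real (card V) \<and> chain k E (A @ R @ take k A) \<longrightarrow>
        (\<exists>A'. set A' = set A \<union> W \<and> distinct A' \<and> k \<le> length A' \<and> chain k E (A' @ R @ take k A'))))"
    by (elim exE conjE)
  note N1 = N1[rule_format (no_asm)]
  \<comment> \<open>\<open>\<epsilon> \<le> \<rho>\<close> lets \<open>A\<close> absorb the
    leftover; with \<open>\<epsilon> \<le> 1 / 2\<close> the complement of \<open>A\<close>, at
    least half of \<open>V\<close>, is large enough for \<open>cover\<close>.\<close>
  define \<epsilon> where "\<epsilon> = min \<rho> (1 / 2)"
  have \<epsilon>: "0 < \<epsilon>" "\<epsilon> \<le> 1" "\<epsilon> \<le> \<rho>" "\<epsilon> \<le> 1 / 2" unfolding \<epsilon>_def using \<rho> by auto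
  from cover[OF k \<beta>2 \<epsilon>(1,2), where 'a = 'a] obtain N2 where N2: "\<forall>(V :: 'a set) E U0 a. finite V \<longrightarrow> N2 \<le> card V \<longrightarrow> U0 \<subseteq> V \<longrightarrow> \<epsilon> * real (card V) \<le> real (card U0) \<longrightarrow>
     dense k V E (\<beta> / 2) U0 \<longrightarrow> set a \<subseteq> V - U0 \<longrightarrow> length a = k \<longrightarrow> distinct a \<longrightarrow> chain k E a \<longrightarrow>
     (\<exists>Q. set Q \<subseteq> U0 \<and> distinct Q \<and> chain k E (a @ Q) \<and> real (card (U0 - set Q)) \<le> \<epsilon> * real (card V) \<and>
        \<epsilon> / 2 * real (card V) \<le> real (card (U0 - set Q)) \<and> dense k V E (\<beta> / 2 / 2) (U0 - set Q))" ..
  note N2 = N2[rule_format (no_asm)]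
  from connect[OF k \<beta>4, where 'a = 'a] obtain N3 where N3: "\<forall>(V :: 'a set) E U a b. finite V \<longrightarrow> U \<subseteq> V \<longrightarrow> N3 \<le> card U \<longrightarrow> dense k V E (\<beta> / 4) U \<longrightarrow>
     set a \<subseteq> V \<longrightarrow> set b \<subseteq> V \<longrightarrow> length a = k \<longrightarrow> length b = k \<longrightarrow> distinct (a @ b) \<longrightarrow>
     chain k E a \<longrightarrow> chain k E b \<longrightarrow>
     (\<exists>c. joins k E U a b c)" ..
  note N3 = N3[rule_format (no_asm)]
  define N0 where "N0 = N1 + N2 + nat \<lceil>2 * real N3 / \<epsilon>\<rceil> + k"
  show ?thesis
  proof (intro exI[of _ N0] allI impI, elim conjE)
    fix n :: nat and V :: "'a set" and E
    assume n: "N0 \<le> n" and G: "k_graph k V E" "card V = n"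
      and deg: "(1 - gap k + \<alpha>) * real n \<le> real (min_codegree k V E)"
    have fin: "finite V" using G unfolding k_graph_def by simp
    have big: "N1 \<le> card V" "N2 \<le> card V" "2 * real N3 / \<epsilon> \<le> real (card V)" "k \<le> card V"
      using n unfolding N0_def G(2) by linarith+
    have "(1 - gap k + \<beta>) * real n \<le> (1 - gap k + \<alpha>) * real n"
      using \<beta>(3) by (intro mult_right_mono) auto
    then have dV: "dense k V E \<beta> V"
      using deg unfolding G(2)[symmetric] by (intro dense_of_min_codegree[OF G(1) k big(4)]) linarith
    from N1[OF fin big(1) dV] obtain A where A: "set A \<subseteq> V" "distinct A" "chain k E A" "2 * k \<le> length A"
        "real (length A) \<le> \<beta> / 2 * real (card V)"
      and absorb: "\<forall>W R. W \<subseteq> V - set A \<and> real (card W) \<le> \<rho> * real (card V) \<and> chain k E (A @ R @ take k A) \<longrightarrow>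
        (\<exists>A'. set A' = set A \<union> W \<and> distinct A' \<and> k \<le> length A' \<and> chain k E (A' @ R @ take k A'))"
      by (elim exE conjE)
    define U0 where "U0 = V - set A"
    have cA: "card (set A) = length A" by (rule distinct_card[OF A(2)])
    have VU: "V - U0 = set A" unfolding U0_def using A(1) by auto
    have "dense k V E (\<beta> - \<beta> / 2) U0"
      by (rule dense_subset[OF dV fin]) (use VU cA A(5) \<beta> k in \<open>auto simp: U0_def\<close>)
    then have dU0: "dense k V E (\<beta> / 2) U0" by simp
    have "card U0 = card V - length A" unfolding U0_def using card_Diff_subset[OF _ A(1)] cA by simp
    moreover have "\<beta> / 2 * real (card V) \<le> 1 / 2 * real (card V)" using \<beta>1 by (intro mult_right_mono) auto
    ultimately have "1 / 2 * real (card V) \<le> real (card U0)" using A(5) by linarith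
    moreover have "\<epsilon> * real (card V) \<le> 1 / 2 * real (card V)" using \<epsilon>(4) by (intro mult_right_mono) auto
    ultimately have cU0: "\<epsilon> * real (card V) \<le> real (card U0)" by linarith
    define p a where "p = take (length A - k) A" and "a = drop (length A - k) A"
    have pa: "A = p @ a" unfolding p_def a_def by simp
    have a: "length a = k" "distinct a" "chain k E a" "set a \<subseteq> V - U0"
    proof -
      show "length a = k" unfolding a_def using A(4) by simp
      show "distinct a" "set a \<subseteq> V - U0" using A(2) VU unfolding pa by auto
      show "chain k E a" using A(3) unfolding pa by (rule chain_appendD2)
    qed
    have "U0 \<subseteq> V" unfolding U0_def by auto
    from N2[OF fin big(2) this cU0 dU0 a(4,1,2,3)] obtain Q where Q: "set Q \<subseteq> U0" "distinct Q" "chain k E (a @ Q)"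
      "real (card (U0 - set Q)) \<le> \<epsilon> * real (card V)" "\<epsilon> / 2 * real (card V) \<le> real (card (U0 - set Q))"
      "dense k V E (\<beta> / 2 / 2) (U0 - set Q)" by (elim exE conjE)
    \<comment> \<open>The closing connector is taken from the uncovered vertices, which are still
      dense with \<open>\<beta> / 4\<close> and number at least
      \<open>\<epsilon> / 2 * card V\<close>.\<close>
    define U where "U = U0 - set Q"
    have chAQ: "chain k E (A @ Q)"
      using chain_glue[of k E p a Q] A(3) Q(3) a(1) unfolding pa by simp
    have dAQ: "distinct (A @ Q)" using A(2) Q(1,2) unfolding U0_def by auto
    define p' a' where "p' = take (length (A @ Q) - k) (A @ Q)" and "a' = drop (length (A @ Q) - k) (A @ Q)"
    have pa': "A @ Q = p' @ a'" unfolding p'_def a'_def by (rule append_take_drop_id[symmetric])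
    have a': "length a' = k" "chain k E a'"
    proof -
      show "length a' = k" unfolding a'_def using A(4) by simp
      show "chain k E a'" using chAQ unfolding pa' by (rule chain_appendD2)
    qed
    have "\<exists>c. length c = length (conn_mid k) \<and> distinct (a' @ c @ take k A) \<and> set c \<subseteq> U \<and> chain k E (a' @ c @ take k A)"
    proof (rule N3[OF fin])
      show "U \<subseteq> V" unfolding U_def U0_def by auto
      have "real N3 \<le> \<epsilon> / 2 * real (card V)" using big(3) \<epsilon>(1) by (simp add: field_simps)
      then show "N3 \<le> card U" using Q(5) unfolding U_def by linarith
      show "dense k V E (\<beta> / 4) U" unfolding U_def using Q(6) by simp
      have "set a' \<subseteq> set (A @ Q)" unfolding a'_def by (rule set_drop_subset)
      then show "set a' \<subseteq> V" using A(1) Q(1) unfolding U0_def by auto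
      show "set (take k A) \<subseteq> V" using A(1) set_take_subset by fast
      show "length a' = k" "chain k E a'" by (fact a')+
      show "length (take k A) = k" using A(4) by simp
      show "chain k E (take k A)" using A(3) by (metis append_take_drop_id chain_appendD1)
      have "take k (A @ Q) = take k A" using A(4) by simp
      \<comment> \<open>\<open>A\<close> has at least \<open>2 * k\<close> vertices, so the first
        and the last \<open>k\<close> vertices of \<open>A @ Q\<close> are disjoint even if
        \<open>Q\<close> is empty.\<close>
      moreover have "k \<le> length (A @ Q) - k" using A(4) by simp
      then have "set (take k (A @ Q)) \<inter> set a' = {}" unfolding a'_def
        by (rule set_take_disj_set_drop_if_distinct[OF dAQ])
      ultimately have "set a' \<inter> set (take k A) = {}" by auto
      moreover have "distinct a'" using dAQ unfolding pa' by auto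
      ultimately show "distinct (a' @ take k A)" using A(2) by simp
    qed
    then obtain C where C: "distinct (a' @ C @ take k A)" "set C \<subseteq> U" "chain k E (a' @ C @ take k A)" by blast
    have "chain k E (p' @ a' @ C @ take k A)"
      using chain_glue[of k E p' a' "C @ take k A"] chAQ C(3) a'(1) unfolding pa' by simp
    then have "chain k E ((p' @ a') @ C @ take k A)" by (simp only: append_assoc)
    then have ch: "chain k E (A @ (Q @ C) @ take k A)" unfolding pa'[symmetric] by (simp only: append_assoc)
    define W where "W = U - set C"
    have WV: "W \<subseteq> V - set A" unfolding W_def U_def U0_def by auto
    have "card W \<le> card U" unfolding W_def U_def U0_def using fin by (intro card_mono) auto
    then have "real (card W) \<le> \<epsilon> * real (card V)" using Q(4) unfolding U_def by linarith
    also have "\<dots> \<le> \<rho> * real (card V)" using \<epsilon>(3) by (intro mult_right_mono) auto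
    finally have cW: "real (card W) \<le> \<rho> * real (card V)" .
    obtain A' where A': "set A' = set A \<union> W" "distinct A'" "k \<le> length A'" "chain k E (A' @ (Q @ C) @ take k A')"
      using absorb[rule_format, OF conjI[OF WV conjI[OF cW ch]]] by (elim exE conjE)
    define Z where "Z = A' @ Q @ C"
    have "distinct Z" unfolding Z_def distinct_append set_append A'(1) W_def
      using A'(2) Q(1,2) C(1,2) unfolding U_def U0_def by auto
    moreover have "set Z = V" unfolding Z_def set_append A'(1) W_def
      using A(1) Q(1) C(2) unfolding U_def U0_def by auto
    moreover have "k \<le> length Z" unfolding Z_def using A'(3) by simp
    moreover have "chain k E (Z @ take k Z)"
      using A'(3,4) unfolding Z_def by simp
    ultimately have "contains_copy V E {..<length Z} (cycle_power_edges 2 k (length Z))"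
      by (rule contains_copy_of_chain)
    moreover have "length Z = n" using distinct_card[OF \<open>distinct Z\<close>] \<open>set Z = V\<close> G(2) by simp
    ultimately show "contains_copy V E {..<n} (cycle_power_edges 2 k n)" by simp
  qed
qed

end
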